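(* Let $\mathcal{M}$ be a connected Riemannian manifold, $\mathbb{Y}$ a Euclidean space, $f:\mathcal{M}\to\mathbb{R}$ and $g:\mathcal{M}\to\mathbb{Y}$ continuously differentiable, and $\theta:\mathbb{Y}\to(-\infty,\infty]$ proper closed convex. Let $(\bar{x},\bar{y})\in\mathcal{M}\times\mathbb{Y}$ be a KKT pair of $\min_{x\in\mathcal{M}}f(x)+\theta(g(x))$ and $R_{\bar x}$ a retraction at $\bar x$. The manifold (strong) variational sufficient condition under the retraction $R_{\bar{x}}$ holds with respect to $(\bar{x},\bar{y})$ at level $\rho>0$ if and only if there exists a closed convex neighborhood $\mathcal{W}\times\mathcal{Y}$ of $(0_{\bar{x}},\bar{y})$ such that (i) $l^{\rho}_{R_{\bar{x}}}(\xi,y)$ is locally (strongly) convex (in $\xi$) at $0_{\bar x}$ for every $y\in\mathcal{Y}$; (ii) $l^{\rho}_{R_{\bar{x}}}(\xi,y)$ is concave in $y$ for every $\xi\in\mathcal{W}\subseteq B_{\bar x}(r_{R_{\bar x}})$. Under these conditions, $(\bar{x},\bar{y})$ is a saddle point of $l^{\rho}(x,y)$ with respect to minimization over $x\in R_{\bar{x}}(\mathcal{W})$ and maximization over $y\in\mathcal{Y}$. Moreover, these properties hold for any $\rho'\ge\rho$.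
   Context: $(\bar x,\bar y)$ is a KKT pair if $\operatorname{grad}f(\bar x)+Dg(\bar x)^*\bar y=0$ and $\bar y\in\partial\theta(g(\bar x))$. A retraction is a smooth map $R:T\mathcal{M}\to\mathcal{M}$ with $R_x(0_x)=x$, $DR_x(0_x)=\mathrm{id}$. $B_{\bar x}(r)=\{v\in T_{\bar x}\mathcal{M}:\|v\|<r\}$, and $r_{R_{\bar x}}>0$ is the supremum of radii $r$ such that $R_{\bar x}$ is a well-defined diffeomorphism on $B_{\bar x}(r)$. $\varphi(x,b)=f(x)+\theta(g(x)+b)$ on $\mathcal{M}\times\mathbb{Y}$; $\varphi_{R_{\bar x}}(\xi,b)=\varphi(R_{\bar x}(\xi),b)$ for $\xi\in B_{\bar x}(r_{R_{\bar x}})$ and $+\infty$ for other $\xi\in T_{\bar x}\mathcal{M}$. For $\rho>0$: $\varphi^\rho(x,b)=\varphi(x,b)+\frac\rho2\|b\|^2$, $\varphi^\rho_{R_{\bar x}}(\xi,b)=\varphi_{R_{\bar x}}(\xi,b)+\frac\rho2\|b\|^2$, and $l^\rho(x,y)=\inf_b\{\varphi^\rho(x,b)-\langle y,b\rangle\}$, $l^\rho_{R_{\bar x}}(\xi,y)=\inf_b\{\varphi^\rho_{R_{\bar x}}(\xi,b)-\langle y,b\rangle\}$. Locally (strongly) convex at a point means (strongly) convex on a neighborhood of that point. A lsc function $h_0$ on a Euclidean space is variationally convex with respect to $(\bar w,\bar z)\in\operatorname{gph}\partial h_0$ if there are convex open neighborhoods $\mathcal{N}$ of $\bar w$, $\mathcal{Z}$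 of $\bar z$ and a proper lsc convex function $h\le h_0$ on $\mathcal{N}$ with $(\mathcal{N}\times\mathcal{Z})\cap\operatorname{gph}\partial h=(\mathcal{N}\times\mathcal{Z})\cap\operatorname{gph}\partial h_0$ and $h(w)=h_0(w)$ for all $(w,z)$ in this common set; it is variationally strongly convex if in addition $h$ is strongly convex on $\mathcal{N}$. The manifold (strong) variational sufficient condition under $R_{\bar x}$ with respect to $(\bar x,\bar y)$ at level $\rho$ means: $\varphi^\rho_{R_{\bar x}}$ is variationally (strongly) convex with respect to $((0_{\bar x},0),(0_{\bar x},\bar y))\in\operatorname{gph}\partial\varphi^\rho_{R_{\bar x}}$. The statement is to be read twice: once without and once with the parenthesized "strong(ly)".
   Formalization: Condition (i) is required uniformly: l is (strongly) convex in ξ on all of W for every y in Y, with one modulus in the strong case; with neighborhoods or moduli depending on y the equivalence is false. Lower semicontinuity of the pulled-back function is not demanded. *)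

theory Defs
  imports "HOL-Analysis.Analysis"
begin

section \<open>Differentiability classes on open subsets of Euclidean spaces\<close>

primrec Ck_on :: "nat \<Rightarrow> 'a::euclidean_space set \<Rightarrow> ('a \<Rightarrow> 'b::euclidean_space) \<Rightarrow> bool" where
  "Ck_on 0 S f \<longleftrightarrow> continuous_on S f"
| "Ck_on (Suc k) S f \<longleftrightarrow>
     (\<forall>x\<in>S. f differentiable (at x)) \<and>
     (\<forall>v. Ck_on k S (\<lambda>x. frechet_derivative f (at x) v))"

definition smooth_on :: "'a::euclidean_space set \<Rightarrow> ('a \<Rightarrow> 'b::euclidean_space) \<Rightarrow> bool" where
  "smooth_on S f \<longleftrightarrow> (\<forall>k. Ck_on k S f)"

section \<open>Manifolds\<close>

text \<open>
  A chart is a pair of its domain and a map into the model space, and a manifold is given by an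
  atlas; its underlying set is the union of the chart domains, and its topology is the one that
  the charts induce.
\<close>

type_synonym ('m, 'e) chart = "'m set \<times> ('m \<Rightarrow> 'e)"
type_synonym ('m, 'e) atlas = "('m, 'e) chart set"

definition points :: "('m, 'e) atlas \<Rightarrow> 'm set" where
  "points A = (\<Union>c\<in>A. fst c)"

definition charts_at :: "('m, 'e) atlas \<Rightarrow> 'm \<Rightarrow> ('m, 'e) chart set" where
  "charts_at A x = {c \<in> A. x \<in> fst c}"

definition chart_inv :: "('m, 'e) chart \<Rightarrow> 'e \<Rightarrow> 'm" where
  "chart_inv c = inv_into (fst c) (snd c)"

definition local_rep ::
    "('m, 'e) chart \<Rightarrow> ('n, 'd) chart \<Rightarrow> ('m \<Rightarrow> 'n) \<Rightarrow> 'e \<Rightarrow> 'd" where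
  "local_rep c d F = (\<lambda>u. snd d (F (chart_inv c u)))"

definition rep_domain ::
    "('m, 'e) chart \<Rightarrow> ('n, 'd) chart \<Rightarrow> ('m \<Rightarrow> 'n) \<Rightarrow> 'e set" where
  "rep_domain c d F = snd c ` {x \<in> fst c. F x \<in> fst d}"

definition manifold_topology :: "('m, 'e::euclidean_space) atlas \<Rightarrow> 'm topology" where
  "manifold_topology A =
     topology_generated_by {{x \<in> fst c. snd c x \<in> S} |c S. c \<in> A \<and> open S}"

definition smooth_manifold :: "('m, 'e::euclidean_space) atlas \<Rightarrow> bool" where
  "smooth_manifold A \<longleftrightarrow>
     (\<forall>c\<in>A. inj_on (snd c) (fst c)) \<and>
     (\<forall>c\<in>A. \<forall>d\<in>A. open (rep_domain c d (\<lambda>x. x)) \<and>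
                     smooth_on (rep_domain c d (\<lambda>x. x)) (local_rep c d (\<lambda>x. x))) \<and>
     Hausdorff_space (manifold_topology A) \<and> second_countable (manifold_topology A)"

text \<open>Openness of the domains of all local representatives expresses continuity of the map.\<close>

definition Ck_map ::
    "nat \<Rightarrow> ('m, 'e::euclidean_space) atlas \<Rightarrow> ('n, 'd::euclidean_space) atlas \<Rightarrow> ('m \<Rightarrow> 'n) \<Rightarrow> bool"
  where
  "Ck_map k A B F \<longleftrightarrow>
     F ` points A \<subseteq> points B \<and>
     (\<forall>c\<in>A. \<forall>d\<in>B. open (rep_domain c d F) \<and> Ck_on k (rep_domain c d F) (local_rep c d F))"

definition smooth_map ::
    "('m, 'e::euclidean_space) atlas \<Rightarrow> ('n, 'd::euclidean_space) atlas \<Rightarrow> ('m \<Rightarrow> 'n) \<Rightarrow> bool" where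
  "smooth_map A B F \<longleftrightarrow> (\<forall>k. Ck_map k A B F)"

definition diffeomorphism ::
    "('m, 'e::euclidean_space) atlas \<Rightarrow> ('n, 'd::euclidean_space) atlas \<Rightarrow> ('m \<Rightarrow> 'n) \<Rightarrow> bool" where
  "diffeomorphism A B F \<longleftrightarrow>
     bij_betw F (points A) (points B) \<and> smooth_map A B F \<and>
     smooth_map B A (inv_into (points A) F)"

definition euclidean_atlas :: "('a, 'a::euclidean_space) atlas" where
  "euclidean_atlas = {(UNIV, \<lambda>x. x)}"

definition restrict_atlas :: "('m, 'e) atlas \<Rightarrow> 'm set \<Rightarrow> ('m, 'e) atlas" where
  "restrict_atlas A S = (\<lambda>c. (fst c \<inter> S, snd c)) ` A"

section \<open>Tangent vectors\<close>

text \<open>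
  A tangent vector at \<open>x\<close> assigns to every chart around \<open>x\<close> its coordinate vector in that chart,
  coordinates in different charts being related by the derivative of the transition map. The value
  \<open>0\<close> at all other charts makes this representation unique, so that addition, scaling and the zero
  vector are the pointwise ones.
\<close>

type_synonym ('m, 'e) tangent = "('m, 'e) chart \<Rightarrow> 'e"

definition tangent_space ::
    "('m, 'e::euclidean_space) atlas \<Rightarrow> 'm \<Rightarrow> ('m, 'e) tangent set" where
  "tangent_space A x =
     {v. (\<forall>c. c \<notin> charts_at A x \<longrightarrow> v c = 0) \<and>
         (\<forall>c\<in>charts_at A x. \<forall>d\<in>charts_at A x.
            v d = frechet_derivative (local_rep c d (\<lambda>z. z)) (at (snd c x)) (v c))}"

abbreviation tan_zero :: "('m, 'e::euclidean_space) tangent" where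
  "tan_zero \<equiv> (\<lambda>_. 0)"

abbreviation tan_add ::
    "('m, 'e::euclidean_space) tangent \<Rightarrow> ('m, 'e) tangent \<Rightarrow> ('m, 'e) tangent" where
  "tan_add v w \<equiv> (\<lambda>c. v c + w c)"

abbreviation tan_scale ::
    "real \<Rightarrow> ('m, 'e::euclidean_space) tangent \<Rightarrow> ('m, 'e) tangent" where
  "tan_scale t v \<equiv> (\<lambda>c. t *\<^sub>R v c)"

text \<open>The tangent vector at \<open>x\<close> whose coordinate vector in the chart \<open>c\<close> is \<open>a\<close>.\<close>

definition tangent_of ::
    "('m, 'e::euclidean_space) atlas \<Rightarrow> ('m, 'e) chart \<Rightarrow> 'm \<Rightarrow> 'e \<Rightarrow> ('m, 'e) tangent" where
  "tangent_of A c x a =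
     (\<lambda>d. if d \<in> charts_at A x
          then frechet_derivative (local_rep c d (\<lambda>z. z)) (at (snd c x)) a else 0)"

definition tangent_bundle_atlas ::
    "('m, 'e::euclidean_space) atlas \<Rightarrow> ('m \<times> ('m, 'e) tangent, 'e \<times> 'e) atlas" where
  "tangent_bundle_atlas A =
     (\<lambda>c. ({(x, v). x \<in> fst c \<and> v \<in> tangent_space A x}, \<lambda>(x, v). (snd c x, v c))) ` A"

text \<open>
  The differential at \<open>x\<close> of a map into a Euclidean space. By the chain rule it does not depend on
  the chart that is picked.
\<close>

definition differential ::
    "('m, 'e::euclidean_space) atlas \<Rightarrow> ('m \<Rightarrow> 'b::euclidean_space) \<Rightarrow> 'm \<Rightarrow> ('m, 'e) tangent \<Rightarrow> 'b"
  where
  "differential A F x v =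
     (let c = (SOME c. c \<in> charts_at A x)
      in frechet_derivative (\<lambda>u. F (chart_inv c u)) (at (snd c x)) (v c))"

section \<open>Riemannian manifolds\<close>

type_synonym ('m, 'e) metric = "'m \<Rightarrow> ('m, 'e) tangent \<Rightarrow> ('m, 'e) tangent \<Rightarrow> real"

definition riemannian_metric ::
    "('m, 'e::euclidean_space) atlas \<Rightarrow> ('m, 'e) metric \<Rightarrow> bool" where
  "riemannian_metric A G \<longleftrightarrow>
     (\<forall>x\<in>points A.
        (\<forall>u\<in>tangent_space A x. \<forall>v\<in>tangent_space A x. G x u v = G x v u) \<and>
        (\<forall>u\<in>tangent_space A x. \<forall>v\<in>tangent_space A x. \<forall>w\<in>tangent_space A x.
           G x (tan_add u v) w = G x u w + G x v w) \<and>
        (\<forall>t. \<forall>u\<in>tangent_space A x. \<forall>v\<in>tangent_space A x.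
           G x (tan_scale t u) v = t * G x u v) \<and>
        (\<forall>u\<in>tangent_space A x. u \<noteq> tan_zero \<longrightarrow> G x u u > 0)) \<and>
     (\<forall>c\<in>A. \<forall>a b. smooth_on (snd c ` fst c)
        (\<lambda>u. G (chart_inv c u) (tangent_of A c (chart_inv c u) a)
                                (tangent_of A c (chart_inv c u) b)))"

definition riemannian_manifold ::
    "('m, 'e::euclidean_space) atlas \<Rightarrow> ('m, 'e) metric \<Rightarrow> bool" where
  "riemannian_manifold A G \<longleftrightarrow> smooth_manifold A \<and> riemannian_metric A G"

definition tan_norm :: "('m, 'e) metric \<Rightarrow> 'm \<Rightarrow> ('m, 'e) tangent \<Rightarrow> real" where
  "tan_norm G x v = sqrt (G x v v)"

definition grad ::
    "('m, 'e::euclidean_space) atlas \<Rightarrow> ('m, 'e) metric \<Rightarrow> ('m \<Rightarrow> real) \<Rightarrow> 'm \<Rightarrow> ('m, 'e) tangent"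
  where
  "grad A G f x =
     (THE v. v \<in> tangent_space A x \<and>
             (\<forall>w\<in>tangent_space A x. G x v w = differential A f x w))"

definition differential_adj ::
    "('m, 'e::euclidean_space) atlas \<Rightarrow> ('m, 'e) metric \<Rightarrow> ('m \<Rightarrow> 'y::euclidean_space) \<Rightarrow> 'm \<Rightarrow>
     'y \<Rightarrow> ('m, 'e) tangent" where
  "differential_adj A G g x y =
     (THE v. v \<in> tangent_space A x \<and>
             (\<forall>w\<in>tangent_space A x. G x v w = y \<bullet> differential A g x w))"

text \<open>
  A linear isometry of the model space onto the tangent space at \<open>x\<close>. It presents that tangent
  space as a Euclidean space in the sense of the type class.
\<close>

definition orthonormal_frame ::
    "('m, 'e::euclidean_space) atlas \<Rightarrow> ('m, 'e) metric \<Rightarrow> 'm \<Rightarrow> ('e \<Rightarrow> ('m, 'e) tangent) \<Rightarrow> bool"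
  where
  "orthonormal_frame A G x \<iota> \<longleftrightarrow>
     bij_betw \<iota> UNIV (tangent_space A x) \<and>
     (\<forall>a b. \<iota> (a + b) = tan_add (\<iota> a) (\<iota> b)) \<and>
     (\<forall>t a. \<iota> (t *\<^sub>R a) = tan_scale t (\<iota> a)) \<and>
     (\<forall>a b. G x (\<iota> a) (\<iota> b) = a \<bullet> b)"

lemma orthonormal_family_exists:
  fixes B :: "'e::euclidean_space \<Rightarrow> 'e \<Rightarrow> real" and S :: "'e set"
  assumes bil: "\<And>u. linear (B u)" "\<And>v. linear (\<lambda>u. B u v)"
    and sym: "\<And>u v. B u v = B v u" and pos: "\<And>u. u \<noteq> 0 \<Longrightarrow> B u u > 0"
    and S: "S \<subseteq> Basis"
  shows "\<exists>q. \<forall>i\<in>S. \<forall>j\<in>S. B (q i) (q j) = (if i = j then 1 else 0)"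
proof -
  have "finite S" using S finite_Basis finite_subset by blast
  then show ?thesis using S
  proof (induction S rule: finite_induct)
    case empty
    then show ?case by simp
  next
    case (insert k S)
    then obtain q where q: "\<And>i j. i \<in> S \<Longrightarrow> j \<in> S \<Longrightarrow> B (q i) (q j) = (if i = j then 1 else 0)"
      by blast
    have "card (insert k S) \<le> DIM('e)" using insert.prems by (intro card_mono) auto
    then have "card S < DIM('e)" using insert.hyps by simp
    moreover have "dim (span (q ` S)) \<le> card S"
      using insert.hyps(1) by (metis card_image_le dim_le_card' dim_span finite_imageI le_trans)
    ultimately have "span (q ` S) \<noteq> UNIV" by (metis dim_UNIV leD)
    then obtain v where v: "v \<notin> span (q ` S)" by blast
    define w where "w = v - (\<Sum>i\<in>S. B v (q i) *\<^sub>R q i)"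
    have "w \<noteq> 0"
    proof
      assume "w = 0"
      then have "v = (\<Sum>i\<in>S. B v (q i) *\<^sub>R q i)" by (simp add: w_def)
      moreover have "(\<Sum>i\<in>S. B v (q i) *\<^sub>R q i) \<in> span (q ` S)"
        by (intro span_sum span_scale span_base) auto
      ultimately show False using v by simp
    qed
    then have wpos: "B w w > 0" by (rule pos)
    have wq: "B w (q j) = 0" if "j \<in> S" for j
    proof -
      have "B w (q j) = B v (q j) - (\<Sum>i\<in>S. B v (q i) * B (q i) (q j))"
        unfolding w_def by (simp add: linear_diff[OF bil(2)] linear_sum[OF bil(2)] linear_cmul[OF bil(2)])
      also have "(\<Sum>i\<in>S. B v (q i) * B (q i) (q j)) = (\<Sum>i\<in>S. if i = j then B v (q i) else 0)"
        using that by (intro sum.cong) (auto simp: q)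
      also have "\<dots> = B v (q j)" using that insert.hyps(1) by simp
      finally show ?thesis by simp
    qed
    define q' where "q' = q(k := (1 / sqrt (B w w)) *\<^sub>R w)"
    have kk: "B (q' k) (q' k) = 1" using wpos
      by (simp add: q'_def linear_cmul[OF bil(2)] linear_cmul[OF bil(1)])
    have kj: "B (q' k) (q' j) = 0 \<and> B (q' j) (q' k) = 0" if "j \<in> S" for j
      using wq[OF that] that insert.hyps(2) sym[of "q j" w]
      by (auto simp: q'_def linear_cmul[OF bil(2)] linear_cmul[OF bil(1)])
    have "B (q' i) (q' j) = (if i = j then 1 else 0)" if ij: "i \<in> insert k S" "j \<in> insert k S" for i j
    proof -
      consider "i = k" "j = k" | "i = k" "j \<in> S" | "j = k" "i \<in> S" | "i \<in> S" "j \<in> S"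
        using ij by blast
      then show ?thesis
      proof cases
        case 1 then show ?thesis using kk by simp
      next
        case 2 then show ?thesis using kj insert.hyps(2) by auto
      next
        case 3 then show ?thesis using kj insert.hyps(2) by auto
      next
        case 4
        then have "q' i = q i" "q' j = q j" using insert.hyps(2) by (auto simp: q'_def)
        then show ?thesis using q 4 by simp
      qed
    qed
    then show ?case by blast
  qed
qed

lemma linear_isometry_exists:
  fixes B :: "'e::euclidean_space \<Rightarrow> 'e \<Rightarrow> real"
  assumes bil: "\<And>u. linear (B u)" "\<And>v. linear (\<lambda>u. B u v)"
    and sym: "\<And>u v. B u v = B v u" and pos: "\<And>u. u \<noteq> 0 \<Longrightarrow> B u u > 0"
  obtains L :: "'e \<Rightarrow> 'e" where "linear L" "bij L" "\<And>a b. B (L a) (L b) = a \<bullet> b"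
proof -
  have "\<exists>q :: 'e \<Rightarrow> 'e. \<forall>i\<in>Basis. \<forall>j\<in>Basis. B (q i) (q j) = (if i = j then 1 else 0)"
    by (rule orthonormal_family_exists[OF bil sym pos]) simp_all
  then obtain q :: "'e \<Rightarrow> 'e" where
    q: "\<And>i j. i \<in> Basis \<Longrightarrow> j \<in> Basis \<Longrightarrow> B (q i) (q j) = (if i = j then 1 else 0)"
    by blast
  define L where "L a = (\<Sum>i\<in>Basis. (a \<bullet> i) *\<^sub>R q i)" for a :: 'e
  have lin: "linear L" unfolding L_def
    by (intro linearI) (simp_all add: inner_add_left scaleR_add_left sum.distrib scaleR_right.sum)
  have iso: "B (L a) (L b) = a \<bullet> b" for a b
  proof -
    have right: "B u (L b) = (\<Sum>j\<in>Basis. (b \<bullet> j) * B u (q j))" for u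
      unfolding L_def by (simp add: linear_sum[OF bil(1)] linear_cmul[OF bil(1)])
    have "B (L a) (L b) = (\<Sum>i\<in>Basis. (a \<bullet> i) * B (q i) (L b))"
      unfolding L_def[of a]
      by (simp only: linear_sum[OF bil(2)] linear_cmul[OF bil(2)] real_scaleR_def)
    also have "\<dots> = (\<Sum>i\<in>Basis. (a \<bullet> i) * (b \<bullet> i))"
    proof (rule sum.cong)
      fix i :: 'e
      assume i: "i \<in> Basis"
      have "B (q i) (L b) = (\<Sum>j\<in>Basis. (b \<bullet> j) * B (q i) (q j))"
        by (rule right)
      also have "\<dots> = (\<Sum>j\<in>Basis. if i = j then b \<bullet> j else 0)"
        by (rule sum.cong) (simp_all add: q i)
      also have "\<dots> = b \<bullet> i" using i by simp
      finally show "(a \<bullet> i) * B (q i) (L b) = (a \<bullet> i) * (b \<bullet> i)"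
        by simp
    qed simp
    also have "\<dots> = a \<bullet> b" by (rule euclidean_inner[symmetric])
    finally show ?thesis .
  qed
  have "a = 0" if "L a = 0" for a
    using iso[of a a] linear_0[OF bil(1), of 0] that by simp
  then have "inj L" using lin by (simp add: linear_injective_0)
  then have "bij L" unfolding bij_def using linear_injective_imp_surjective[OF lin] by blast
  then show ?thesis by (rule that[OF lin _ iso])
qed

lemma Ck_on_Suc_differentiable: "Ck_on (Suc k) S f \<Longrightarrow> x \<in> S \<Longrightarrow> f differentiable (at x)"
  by simp

lemma transition_differentiable:
  assumes "smooth_manifold A" "c \<in> charts_at A x" "d \<in> charts_at A x"
  shows "local_rep c d (\<lambda>z. z) differentiable (at (snd c x))"
proof -
  have cd: "c \<in> A" "d \<in> A" "x \<in> fst c" "x \<in> fst d" using assms(2,3) by (auto simp: charts_at_def)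
  then have "Ck_on (Suc 0) (rep_domain c d (\<lambda>z. z)) (local_rep c d (\<lambda>z. z))"
    using assms(1) unfolding smooth_manifold_def smooth_on_def by blast
  moreover have "snd c x \<in> rep_domain c d (\<lambda>z. z)" using cd by (auto simp: rep_domain_def)
  ultimately show ?thesis using Ck_on_Suc_differentiable by blast
qed

lemma chart_inv_left:
  assumes "smooth_manifold A" "c \<in> A" "x \<in> fst c"
  shows "chart_inv c (snd c x) = x"
  using assms by (auto simp: chart_inv_def smooth_manifold_def)

lemma transition_derivative_comp:
  assumes A: "smooth_manifold A"
    and c: "c \<in> charts_at A x" and d: "d \<in> charts_at A x" and e: "e \<in> charts_at A x"
  shows "frechet_derivative (local_rep c e (\<lambda>z. z)) (at (snd c x)) a =
    frechet_derivative (local_rep d e (\<lambda>z. z)) (at (snd d x))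
      (frechet_derivative (local_rep c d (\<lambda>z. z)) (at (snd c x)) a)"
proof -
  let ?I = "\<lambda>z::'a. z"
  have in_A: "c \<in> A" "d \<in> A" "x \<in> fst c" "x \<in> fst d" using c d by (auto simp: charts_at_def)
  have D: "(local_rep c d ?I has_derivative frechet_derivative (local_rep c d ?I) (at (snd c x)))
      (at (snd c x))"
    "(local_rep d e ?I has_derivative frechet_derivative (local_rep d e ?I) (at (snd d x)))
      (at (snd d x))"
    using transition_differentiable[OF A c d] transition_differentiable[OF A d e]
    by (simp_all add: frechet_derivative_works)
  have "local_rep c d ?I (snd c x) = snd d x"
    using chart_inv_left[OF A] in_A by (simp add: local_rep_def)
  then have "(local_rep d e ?I \<circ> local_rep c d ?I has_derivative
      frechet_derivative (local_rep d e ?I) (at (snd d x)) \<circ>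
      frechet_derivative (local_rep c d ?I) (at (snd c x))) (at (snd c x))"
    using D by (intro diff_chain_at) simp_all
  then have "(local_rep c e ?I has_derivative
      frechet_derivative (local_rep d e ?I) (at (snd d x)) \<circ>
      frechet_derivative (local_rep c d ?I) (at (snd c x))) (at (snd c x))"
  proof (rule has_derivative_transform_within_open)
    show "open (rep_domain c d ?I)" using A in_A by (auto simp: smooth_manifold_def)
    show "snd c x \<in> rep_domain c d ?I" using in_A by (auto simp: rep_domain_def)
    show "(local_rep d e ?I \<circ> local_rep c d ?I) u = local_rep c e ?I u"
      if "u \<in> rep_domain c d ?I" for u
      using that chart_inv_left[OF A in_A(1)] chart_inv_left[OF A in_A(2)]
      by (auto simp: rep_domain_def local_rep_def)
  qed
  then show ?thesis by (metis comp_apply frechet_derivative_at)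
qed

lemma transition_derivative_refl:
  assumes A: "smooth_manifold A" and c: "c \<in> charts_at A x"
  shows "frechet_derivative (local_rep c c (\<lambda>z. z)) (at (snd c x)) a = a"
proof -
  let ?I = "\<lambda>z::'a. z"
  have in_A: "c \<in> A" "x \<in> fst c" using c by (auto simp: charts_at_def)
  have "((\<lambda>u. u) has_derivative (\<lambda>u. u)) (at (snd c x))" by (rule has_derivative_ident)
  then have "(local_rep c c ?I has_derivative (\<lambda>u. u)) (at (snd c x))"
  proof (rule has_derivative_transform_within_open)
    show "open (rep_domain c c ?I)" using A in_A by (auto simp: smooth_manifold_def)
    show "snd c x \<in> rep_domain c c ?I" using in_A by (auto simp: rep_domain_def)
    show "u = local_rep c c ?I u" if "u \<in> rep_domain c c ?I" for u
      using that chart_inv_left[OF A in_A(1)] in_A by (auto simp: rep_domain_def local_rep_def)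
  qed
  then show ?thesis by (metis frechet_derivative_at)
qed

lemma tangent_of_in_tangent_space:
  assumes "smooth_manifold A" "c \<in> charts_at A x"
  shows "tangent_of A c x a \<in> tangent_space A x"
  unfolding tangent_space_def tangent_of_def
  by (auto intro: transition_derivative_comp[OF assms])

lemma tangent_of_self:
  assumes "smooth_manifold A" "c \<in> charts_at A x"
  shows "tangent_of A c x a c = a"
  using transition_derivative_refl[OF assms] assms(2) by (simp add: tangent_of_def)

lemma tangent_of_coordinates:
  assumes "c \<in> charts_at A x" "v \<in> tangent_space A x"
  shows "tangent_of A c x (v c) = v"
proof
  fix d
  show "tangent_of A c x (v c) d = v d"
  proof (cases "d \<in> charts_at A x")
    case True
    then have "v d = frechet_derivative (local_rep c d (\<lambda>z. z)) (at (snd c x)) (v c)"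
      using assms unfolding tangent_space_def by blast
    then show ?thesis using True unfolding tangent_of_def by presburger
  next
    case False
    then have "v d = 0" using assms(2) unfolding tangent_space_def by blast
    then show ?thesis using False by (simp add: tangent_of_def)
  qed
qed

text \<open>Every tangent space admits a frame, so fixing one is no restriction.\<close>

lemma orthonormal_frame_exists:
  assumes R: "riemannian_manifold A G" and x: "x \<in> points A"
  shows "\<exists>\<iota>. orthonormal_frame A G x \<iota>"
proof -
  have A: "smooth_manifold A" and G: "riemannian_metric A G"
    using R by (auto simp: riemannian_manifold_def)
  obtain c where c: "c \<in> charts_at A x" using x by (auto simp: points_def charts_at_def)
  define t where "t = tangent_of A c x"
  have t_in: "t a \<in> tangent_space A x" for a
    unfolding t_def by (rule tangent_of_in_tangent_space[OF A c])
  have lin: "linear (frechet_derivative (local_rep c d (\<lambda>z. z)) (at (snd c x)))"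
    if "d \<in> charts_at A x" for d
    using transition_differentiable[OF A c that] by (rule linear_frechet_derivative)
  have t_add: "t (a + b) = tan_add (t a) (t b)" for a b
    by (auto simp: t_def tangent_of_def linear_add[OF lin])
  have t_scale: "t (s *\<^sub>R a) = tan_scale s (t a)" for s a
    by (auto simp: t_def tangent_of_def linear_cmul[OF lin])
  have t_c: "t a c = a" for a unfolding t_def by (rule tangent_of_self[OF A c])
  have t_bij: "bij_betw t UNIV (tangent_space A x)"
    using t_in t_c tangent_of_coordinates[OF c] unfolding t_def
    by (intro bij_betwI[where g = "\<lambda>v. v c"]) auto
  define B where "B a b = G x (t a) (t b)" for a b
  have sym: "B a b = B b a" for a b
    using G x t_in by (auto simp: riemannian_metric_def B_def)
  have add: "B (a + a') b = B a b + B a' b" for a a' b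
    using G x t_in by (auto simp: riemannian_metric_def B_def t_add)
  have scale: "B (s *\<^sub>R a) b = s * B a b" for s a b
    using G x t_in by (auto simp: riemannian_metric_def B_def t_scale)
  have pos: "B a a > 0" if "a \<noteq> 0" for a
  proof -
    have "t a \<noteq> tan_zero" using t_c[of a] that by auto
    then show ?thesis using G x t_in by (auto simp: riemannian_metric_def B_def)
  qed
  have "linear (\<lambda>u. B u v)" for v by (intro linearI) (simp_all add: add scale)
  moreover have "linear (B u)" for u
    using add scale sym[of u] by (intro linearI) simp_all
  ultimately obtain L :: "'b \<Rightarrow> 'b" where L: "linear L" "bij L" "\<And>a b. B (L a) (L b) = a \<bullet> b"
    using linear_isometry_exists[of B] sym pos by blast
  have "orthonormal_frame A G x (t \<circ> L)"
    unfolding orthonormal_frame_def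
    using bij_betw_trans[OF L(2) t_bij] L(3)
    by (auto simp: linear_add[OF L(1)] linear_cmul[OF L(1)] t_add t_scale B_def)
  then show ?thesis by blast
qed

section \<open>Retractions\<close>

text \<open>
  The last condition is \<open>DR\<^sub>x(0\<^sub>x) = id\<close>, where \<open>T\<^sub>xM\<close> and a neighbourhood of \<open>x\<close> carry the
  coordinates given by a chart \<open>c\<close>.
\<close>

definition manifold_retraction ::
    "('m, 'e::euclidean_space) atlas \<Rightarrow> ('m \<times> ('m, 'e) tangent \<Rightarrow> 'm) \<Rightarrow> bool" where
  "manifold_retraction A R \<longleftrightarrow>
     smooth_map (tangent_bundle_atlas A) A R \<and>
     (\<forall>x\<in>points A.
        R (x, tan_zero) = x \<and>
        (\<forall>c\<in>charts_at A x.
           ((\<lambda>a. snd c (R (x, tangent_of A c x a))) has_derivative (\<lambda>a. a)) (at 0)))"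

definition tangent_ball ::
    "('m, 'e::euclidean_space) atlas \<Rightarrow> ('m, 'e) metric \<Rightarrow> 'm \<Rightarrow> ereal \<Rightarrow> ('m, 'e) tangent set" where
  "tangent_ball A G x r = {v \<in> tangent_space A x. ereal (tan_norm G x v) < r}"

definition tangent_ball_atlas ::
    "('m, 'e::euclidean_space) atlas \<Rightarrow> ('m, 'e) metric \<Rightarrow> 'm \<Rightarrow> ereal \<Rightarrow>
     (('m, 'e) tangent, 'e) atlas" where
  "tangent_ball_atlas A G x r = (\<lambda>c. (tangent_ball A G x r, \<lambda>v. v c)) ` charts_at A x"

definition retraction_radius ::
    "('m, 'e::euclidean_space) atlas \<Rightarrow> ('m, 'e) metric \<Rightarrow> ('m \<times> ('m, 'e) tangent \<Rightarrow> 'm) \<Rightarrow> 'm \<Rightarrow> ereal"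
  where
  "retraction_radius A G R x =
     (SUP r\<in>{r::real. r > 0 \<and>
        openin (manifold_topology A) ((\<lambda>v. R (x, v)) ` tangent_ball A G x (ereal r)) \<and>
        diffeomorphism (tangent_ball_atlas A G x (ereal r))
          (restrict_atlas A ((\<lambda>v. R (x, v)) ` tangent_ball A G x (ereal r)))
          (\<lambda>v. R (x, v))}. ereal r)"

section \<open>Extended-real-valued functions on Euclidean spaces\<close>

definition proper_fun :: "('a \<Rightarrow> ereal) \<Rightarrow> bool" where
  "proper_fun h \<longleftrightarrow> (\<forall>x. h x \<noteq> -\<infinity>) \<and> (\<exists>x. h x \<noteq> \<infinity>)"

definition lsc_fun :: "('a::euclidean_space \<Rightarrow> ereal) \<Rightarrow> bool" where
  "lsc_fun h \<longleftrightarrow> (\<forall>x. h x \<le> Liminf (at x) h)"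

text \<open>
  Convexity of the epigraph over \<open>S\<close> avoids sums of opposite infinities.
\<close>

definition econvex_on :: "'a::euclidean_space set \<Rightarrow> ('a \<Rightarrow> ereal) \<Rightarrow> bool" where
  "econvex_on S h \<longleftrightarrow> convex {(x, r::real). x \<in> S \<and> h x \<le> ereal r}"

definition econcave_on :: "'a::euclidean_space set \<Rightarrow> ('a \<Rightarrow> ereal) \<Rightarrow> bool" where
  "econcave_on S h \<longleftrightarrow> econvex_on S (\<lambda>x. - h x)"

definition strongly_econvex_on ::
    "real \<Rightarrow> 'a::euclidean_space set \<Rightarrow> ('a \<Rightarrow> ereal) \<Rightarrow> bool" where
  "strongly_econvex_on \<sigma> S h \<longleftrightarrow> econvex_on S (\<lambda>x. h x - ereal (\<sigma> / 2 * (norm x)\<^sup>2))"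

definition regular_subdiff ::
    "('a::euclidean_space \<Rightarrow> ereal) \<Rightarrow> 'a \<Rightarrow> 'a set" where
  "regular_subdiff h x =
     {v. \<bar>h x\<bar> \<noteq> \<infinity> \<and>
         (\<forall>\<epsilon>>0. \<forall>\<^sub>F z in nhds x. h z \<ge> h x + ereal (v \<bullet> (z - x) - \<epsilon> * norm (z - x)))}"

text \<open>
  The limiting (Mordukhovich) subdifferential, which for a proper lsc convex function is the
  subdifferential of convex analysis.
\<close>

definition subdiff :: "('a::euclidean_space \<Rightarrow> ereal) \<Rightarrow> 'a \<Rightarrow> 'a set" where
  "subdiff h x =
     {v. \<bar>h x\<bar> \<noteq> \<infinity> \<and>
         (\<exists>X V. X \<longlonglongrightarrow> x \<and> (\<lambda>n. h (X n)) \<longlonglongrightarrow> h x \<and>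
                (\<forall>n. V n \<in> regular_subdiff h (X n)) \<and> V \<longlonglongrightarrow> v)}"

definition gph_subdiff :: "('a::euclidean_space \<Rightarrow> ereal) \<Rightarrow> ('a \<times> 'a) set" where
  "gph_subdiff h = {(x, v). v \<in> subdiff h x}"

text \<open>
  With \<open>strong\<close> false this is variational convexity, with \<open>strong\<close> true variational strong convexity.
  Lower semicontinuity of \<open>h0\<close> is not part of the definition: the pulled-back function
  \<open>phi_rho_R\<close> below is \<open>\<infinity>\<close> outside an open ball, so it is lsc inside that ball but in general not on
  its boundary.
\<close>

definition variationally_convex ::
    "bool \<Rightarrow> ('a::euclidean_space \<Rightarrow> ereal) \<Rightarrow> 'a \<Rightarrow> 'a \<Rightarrow> bool" where
  "variationally_convex strong h0 wbar zbar \<longleftrightarrow>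
     (wbar, zbar) \<in> gph_subdiff h0 \<and>
     (\<exists>N Z h. convex N \<and> open N \<and> wbar \<in> N \<and> convex Z \<and> open Z \<and> zbar \<in> Z \<and>
        proper_fun h \<and> lsc_fun h \<and> econvex_on UNIV h \<and> (\<forall>w\<in>N. h w \<le> h0 w) \<and>
        (N \<times> Z) \<inter> gph_subdiff h = (N \<times> Z) \<inter> gph_subdiff h0 \<and>
        (\<forall>(w, z)\<in>(N \<times> Z) \<inter> gph_subdiff h. h w = h0 w) \<and>
        (strong \<longrightarrow> (\<exists>\<sigma>>0. strongly_econvex_on \<sigma> N h)))"

section \<open>The optimization problem and its augmented Lagrangian\<close>

definition KKT_pair ::
    "('m, 'e::euclidean_space) atlas \<Rightarrow> ('m, 'e) metric \<Rightarrow> ('m \<Rightarrow> real) \<Rightarrow>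
     ('m \<Rightarrow> 'y::euclidean_space) \<Rightarrow> ('y \<Rightarrow> ereal) \<Rightarrow> 'm \<Rightarrow> 'y \<Rightarrow> bool" where
  "KKT_pair A G f g \<theta> x y \<longleftrightarrow>
     tan_add (grad A G f x) (differential_adj A G g x y) = tan_zero \<and> y \<in> subdiff \<theta> (g x)"

definition phi_rho ::
    "('m \<Rightarrow> real) \<Rightarrow> ('m \<Rightarrow> 'y::euclidean_space) \<Rightarrow> ('y \<Rightarrow> ereal) \<Rightarrow> real \<Rightarrow> 'm \<Rightarrow> 'y \<Rightarrow> ereal" where
  "phi_rho f g \<theta> \<rho> x b = ereal (f x) + \<theta> (g x + b) + ereal (\<rho> / 2 * (norm b)\<^sup>2)"

definition phi_rho_R ::
    "('m, 'e::euclidean_space) atlas \<Rightarrow> ('m, 'e) metric \<Rightarrow> ('m \<times> ('m, 'e) tangent \<Rightarrow> 'm) \<Rightarrow> 'm \<Rightarrow>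
     ('m \<Rightarrow> real) \<Rightarrow> ('m \<Rightarrow> 'y::euclidean_space) \<Rightarrow> ('y \<Rightarrow> ereal) \<Rightarrow> real \<Rightarrow>
     ('m, 'e) tangent \<Rightarrow> 'y \<Rightarrow> ereal" where
  "phi_rho_R A G R xbar f g \<theta> \<rho> \<xi> b =
     (if \<xi> \<in> tangent_ball A G xbar (retraction_radius A G R xbar)
      then phi_rho f g \<theta> \<rho> (R (xbar, \<xi>)) b else \<infinity>)"

definition aug_lag ::
    "('m \<Rightarrow> real) \<Rightarrow> ('m \<Rightarrow> 'y::euclidean_space) \<Rightarrow> ('y \<Rightarrow> ereal) \<Rightarrow> real \<Rightarrow> 'm \<Rightarrow> 'y \<Rightarrow> ereal" where
  "aug_lag f g \<theta> \<rho> x y = (INF b. phi_rho f g \<theta> \<rho> x b - ereal (y \<bullet> b))"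

definition aug_lag_R ::
    "('m, 'e::euclidean_space) atlas \<Rightarrow> ('m, 'e) metric \<Rightarrow> ('m \<times> ('m, 'e) tangent \<Rightarrow> 'm) \<Rightarrow> 'm \<Rightarrow>
     ('m \<Rightarrow> real) \<Rightarrow> ('m \<Rightarrow> 'y::euclidean_space) \<Rightarrow> ('y \<Rightarrow> ereal) \<Rightarrow> real \<Rightarrow>
     ('m, 'e) tangent \<Rightarrow> 'y \<Rightarrow> ereal" where
  "aug_lag_R A G R xbar f g \<theta> \<rho> \<xi> y =
     (INF b. phi_rho_R A G R xbar f g \<theta> \<rho> \<xi> b - ereal (y \<bullet> b))"

definition variational_sufficiency ::
    "bool \<Rightarrow> ('m, 'e::euclidean_space) atlas \<Rightarrow> ('m, 'e) metric \<Rightarrow>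
     ('m \<times> ('m, 'e) tangent \<Rightarrow> 'm) \<Rightarrow> ('e \<Rightarrow> ('m, 'e) tangent) \<Rightarrow>
     ('m \<Rightarrow> real) \<Rightarrow> ('m \<Rightarrow> 'y::euclidean_space) \<Rightarrow> ('y \<Rightarrow> ereal) \<Rightarrow> 'm \<Rightarrow> 'y \<Rightarrow> real \<Rightarrow> bool" where
  "variational_sufficiency strong A G R \<iota> f g \<theta> xbar ybar \<rho> \<longleftrightarrow>
     variationally_convex strong (\<lambda>(u, b). phi_rho_R A G R xbar f g \<theta> \<rho> (\<iota> u) b)
       (0, 0) (0, ybar)"

text \<open>
  The functions \<open>L \<cdot> y\<close>, \<open>y \<in> Y\<close>, are (strongly) convex on one neighbourhood \<open>W\<close>, with one modulus of
  strong convexity. This uniformity in \<open>y\<close> cannot be dropped from the characterization of variational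
  (strong) convexity. On the real line with \<open>g x = x\<close>, \<open>R (x, v) = x + v\<close>, \<open>\<rho> = 1\<close> one has
  \<open>L \<xi> y = f \<xi> + E (\<xi> + y) - y\<^sup>2/2\<close> with \<open>E\<close> the Moreau envelope of \<open>\<theta>\<close>. If \<open>E'' s = min \<bar>s\<bar> 1\<close>,
  \<open>E' 0 = 0\<close> and \<open>f s = - \<bar>s\<bar>\<^sup>3/12\<close>, then \<open>L \<cdot> y\<close> is convex near \<open>0\<close> for every \<open>y\<close> near \<open>0\<close>, but its
  second derivative at \<open>\<xi> = - y\<close> is \<open>- \<bar>y\<bar>/2\<close>.
\<close>

definition uniformly_convex_family ::
    "bool \<Rightarrow> 'a::euclidean_space set \<Rightarrow> 'y set \<Rightarrow> ('a \<Rightarrow> 'y \<Rightarrow> ereal) \<Rightarrow> bool" where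
  "uniformly_convex_family strong W Y L \<longleftrightarrow>
     (if strong then \<exists>\<sigma>>0. \<forall>y\<in>Y. strongly_econvex_on \<sigma> W (\<lambda>\<xi>. L \<xi> y)
      else \<forall>y\<in>Y. econvex_on W (\<lambda>\<xi>. L \<xi> y))"

text \<open>
  The neighbourhood \<open>W\<close> of \<open>0\<close> in the tangent space is given through the frame \<open>\<iota>\<close>.
\<close>

definition convex_concave_nbhd ::
    "bool \<Rightarrow> ('m, 'e::euclidean_space) atlas \<Rightarrow> ('m, 'e) metric \<Rightarrow>
     ('m \<times> ('m, 'e) tangent \<Rightarrow> 'm) \<Rightarrow> ('e \<Rightarrow> ('m, 'e) tangent) \<Rightarrow>
     ('m \<Rightarrow> real) \<Rightarrow> ('m \<Rightarrow> 'y::euclidean_space) \<Rightarrow> ('y \<Rightarrow> ereal) \<Rightarrow> 'm \<Rightarrow> 'y \<Rightarrow> real \<Rightarrow>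
     'e set \<Rightarrow> 'y set \<Rightarrow> bool" where
  "convex_concave_nbhd strong A G R \<iota> f g \<theta> xbar ybar \<rho> W Y \<longleftrightarrow>
     closed (W \<times> Y) \<and> convex (W \<times> Y) \<and> (0, ybar) \<in> interior (W \<times> Y) \<and>
     \<iota> ` W \<subseteq> tangent_ball A G xbar (retraction_radius A G R xbar) \<and>
     uniformly_convex_family strong W Y (\<lambda>\<xi> y. aug_lag_R A G R xbar f g \<theta> \<rho> (\<iota> \<xi>) y) \<and>
     (\<forall>\<xi>\<in>W. econcave_on UNIV (aug_lag_R A G R xbar f g \<theta> \<rho> (\<iota> \<xi>)))"

definition saddle_point ::
    "('a \<Rightarrow> 'b \<Rightarrow> ereal) \<Rightarrow> 'a set \<Rightarrow> 'b set \<Rightarrow> 'a \<Rightarrow> 'b \<Rightarrow> bool" where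
  "saddle_point L S T xbar ybar \<longleftrightarrow>
     xbar \<in> S \<and> ybar \<in> T \<and>
     (\<forall>x\<in>S. L xbar ybar \<le> L x ybar) \<and> (\<forall>y\<in>T. L xbar y \<le> L xbar ybar)"

end

theory Submission
  imports Defs
begin

text \<open>
  The retraction enters only as a parametrization of the manifold near \<open>xbar\<close>: since \<open>R\<close> is smooth on
  the tangent bundle, \<open>F \<xi> = f (R (xbar, \<iota> \<xi>))\<close> and \<open>G \<xi> = g (R (xbar, \<iota> \<xi>))\<close> are \<open>C\<^sup>1\<close> on the model
  space, and because \<open>R\<close> has the identity as derivative at \<open>0\<close> the KKT condition becomes
  \<open>DF(0) + DG(0)\<^sup>* ybar = 0\<close>. What remains is a statement about the function
  \<open>\<phi>(\<xi>, b) = F \<xi> + \<theta> (G \<xi> + b) + \<rho>/2 |b|\<^sup>2\<close> (\<open>perturbed\<close>) on an open ball \<open>U\<close> times \<open>'y\<close>, and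
  its partial minimization \<open>l(\<xi>, y) = inf\<^sub>b \<phi>(\<xi>, b) - y \<bullet> b\<close> (\<open>lagrangian\<close>).

  Both sides of the equivalence are compared with a third property, \<open>local_quadratic_growth\<close>: near the
  reference pair, every subgradient \<open>z\<close> of \<open>\<phi>\<close> at \<open>w\<close> supports \<open>\<phi>\<close> from below, on one fixed
  neighbourhood, by a quadratic with leading term \<open>\<sigma>/2 |w' - w|\<^sup>2\<close>, with \<open>\<sigma> = 0\<close> in the convex and
  \<open>\<sigma> > 0\<close> in the strongly convex reading.

  Growth is equivalent to variational (strong) convexity (\<open>variationally_convex_imp_growth\<close>,
  \<open>growth_imp_variationally_convex\<close>). If a convex minorant \<open>h\<close> shares values and subgradients with \<open>\<phi>\<close>,
  then growth is the subgradient inequality of \<open>h\<close>. Conversely, the supremum of all supporting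
  quadratics is a (strongly) convex minorant that touches \<open>\<phi>\<close> along its subgradient graph; that its own
  graph is not larger follows from Minty's argument, since the resolvent of \<open>\<partial>\<phi>\<close> is locally
  surjective and a monotone relation cannot extend a relation with surjective resolvent.

  Growth is equivalent to uniform (strong) convexity of the augmented Lagrangian \<open>l(\<cdot>, y)\<close>
  (\<open>growth_imp_lagrangian_convex\<close>, \<open>lagrangian_convex_imp_growth\<close>). The reason is the description of the
  subgradients in \<open>subdiff_perturbed\<close>: \<open>(v, y)\<close> is a subgradient of \<open>\<phi>\<close> at \<open>(\<xi>, b)\<close> exactly when \<open>b\<close>
  attains the infimum that defines \<open>l(\<xi>, y)\<close> and \<open>v\<close> is the gradient of \<open>l(\<cdot>, y)\<close> at \<open>\<xi>\<close>. Evaluating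
  the growth inequality at the minimizing shifts \<open>b\<close> gives the gradient inequality of \<open>l(\<cdot>, y)\<close>. In the
  other direction the term \<open>\<rho>/2 |b|\<^sup>2\<close> provides growth in \<open>b\<close> around the minimizing shift, and this
  shift is a Lipschitz function of \<open>\<xi>\<close>, so that growth in \<open>\<xi>\<close> and growth in \<open>b\<close> combine to joint growth
  with a smaller modulus.

  Concavity in \<open>y\<close> holds because \<open>l(\<xi>, \<cdot>)\<close> is an infimum of affine functions. The saddle point property
  holds because the gradient of \<open>l(\<cdot>, ybar)\<close> vanishes at \<open>0\<close> and the minimizing shift at \<open>(0, ybar)\<close>
  is \<open>0\<close>. Raising \<open>\<rho>\<close> by \<open>\<kappa>\<close> adds \<open>\<kappa>/2 |b|\<^sup>2\<close> to \<open>\<phi>\<close>, which moves the subgradient \<open>(v, y)\<close> to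
  \<open>(v, y + \<kappa> b)\<close> and preserves growth (\<open>growth_mono_penalty\<close>).
\<close>

section \<open>Subgradients of extended-real-valued convex functions\<close>

lemma econvex_onD:
  assumes "econvex_on S h" "x \<in> S" "z \<in> S" "h x \<le> ereal a" "h z \<le> ereal c" "0 \<le> t" "t \<le> 1"
  shows "(1 - t) *\<^sub>R x + t *\<^sub>R z \<in> S"
    and "h ((1 - t) *\<^sub>R x + t *\<^sub>R z) \<le> ereal ((1 - t) * a + t * c)"
  using convexD_alt[of "{(x, r::real). x \<in> S \<and> h x \<le> ereal r}" "(x, a)" "(z, c)" t] assms
  by (auto simp: econvex_on_def)

lemma econvex_onI:
  assumes "\<And>x z a c t. x \<in> S \<Longrightarrow> z \<in> S \<Longrightarrow> h x \<le> ereal a \<Longrightarrow> h z \<le> ereal c \<Longrightarrow> 0 \<le> t \<Longrightarrow> t \<le> 1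
    \<Longrightarrow> (1 - t) *\<^sub>R x + t *\<^sub>R z \<in> S \<and>
        h ((1 - t) *\<^sub>R x + t *\<^sub>R z) \<le> ereal ((1 - t) * a + t * c)"
  shows "econvex_on S h"
  unfolding econvex_on_def convex_alt using assms by auto

lemma regular_subdiffE:
  assumes "v \<in> regular_subdiff h x"
  obtains a where "h x = ereal a"
    "\<And>\<epsilon>. \<epsilon> > 0 \<Longrightarrow>
      \<forall>\<^sub>F z in nhds x. ereal (a + v \<bullet> (z - x) - \<epsilon> * norm (z - x)) \<le> h z"
proof -
  obtain a where a: "h x = ereal a" using assms by (auto simp: regular_subdiff_def)
  show ?thesis
  proof (rule that[OF a])
    fix \<epsilon> :: real assume "\<epsilon> > 0"
    then have "\<forall>\<^sub>F z in nhds x. h x + ereal (v \<bullet> (z - x) - \<epsilon> * norm (z - x)) \<le> h z"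
      using assms by (auto simp: regular_subdiff_def)
    then show "\<forall>\<^sub>F z in nhds x. ereal (a + v \<bullet> (z - x) - \<epsilon> * norm (z - x)) \<le> h z"
      by (simp add: a algebra_simps)
  qed
qed

lemma regular_subdiffI:
  assumes a: "h x = ereal a"
    and "\<And>\<epsilon>. \<epsilon> > 0 \<Longrightarrow>
      \<forall>\<^sub>F z in nhds x. ereal (a + v \<bullet> (z - x) - \<epsilon> * norm (z - x)) \<le> h z"
  shows "v \<in> regular_subdiff h x"
  using assms(2) by (auto simp: regular_subdiff_def a algebra_simps)

lemma eventually_norm_le:
  fixes x :: "'a::euclidean_space"
  assumes "d > 0" shows "\<forall>\<^sub>F z in nhds x. norm (z - x) \<le> d"
  using assms eventually_nhds_metric[of _ x] by (auto simp: dist_norm intro!: exI[of _ d])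

lemma half_norm_square_expand:
  fixes x z :: "'a::euclidean_space"
  shows "\<sigma> / 2 * (norm z)\<^sup>2 =
    \<sigma> / 2 * (norm x)\<^sup>2 + (\<sigma> *\<^sub>R x) \<bullet> (z - x) + \<sigma> / 2 * (norm (z - x))\<^sup>2"
  by (simp add: power2_norm_eq_inner inner_diff inner_commute field_simps)

text \<open>
  Subtracting \<open>\<sigma>/2 |\<cdot>|\<^sup>2\<close> turns strong convexity into convexity. The remainder \<open>\<sigma>/2 |z - x|\<^sup>2\<close> of its
  expansion around \<open>x\<close> is absorbed by the error term \<open>\<epsilon> |z - x|\<close>.
\<close>

lemma regular_subdiff_diff_quadratic:
  assumes "v \<in> regular_subdiff h x"
  shows "v - \<sigma> *\<^sub>R x \<in> regular_subdiff (\<lambda>z. h z - ereal (\<sigma> / 2 * (norm z)\<^sup>2)) x"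
proof -
  obtain a where a: "h x = ereal a" and
    v: "\<And>\<epsilon>. \<epsilon> > 0 \<Longrightarrow> \<forall>\<^sub>F z in nhds x. ereal (a + v \<bullet> (z - x) - \<epsilon> * norm (z - x)) \<le> h z"
    using assms by (rule regular_subdiffE) blast
  show ?thesis
  proof (rule regular_subdiffI)
    show "h x - ereal (\<sigma> / 2 * (norm x)\<^sup>2) = ereal (a - \<sigma> / 2 * (norm x)\<^sup>2)" by (simp add: a)
    fix \<epsilon> :: real assume \<epsilon>: "\<epsilon> > 0"
    have "\<forall>\<^sub>F z in nhds x. norm (z - x) \<le> \<epsilon> / (\<bar>\<sigma>\<bar> + 1)"
      using \<epsilon> by (intro eventually_norm_le) auto
    moreover have "\<forall>\<^sub>F z in nhds x. ereal (a + v \<bullet> (z - x) - \<epsilon> / 2 * norm (z - x)) \<le> h z"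
      using v[of "\<epsilon> / 2"] \<epsilon> by simp
    ultimately show "\<forall>\<^sub>F z in nhds x. ereal (a - \<sigma> / 2 * (norm x)\<^sup>2 + (v - \<sigma> *\<^sub>R x) \<bullet> (z - x)
        - \<epsilon> * norm (z - x)) \<le> h z - ereal (\<sigma> / 2 * (norm z)\<^sup>2)"
    proof eventually_elim
      case (elim z)
      have "norm (z - x) * (\<bar>\<sigma>\<bar> + 1) \<le> \<epsilon>" using elim(1) by (simp add: field_simps)
      then have "norm (z - x) * \<bar>\<sigma>\<bar> \<le> \<epsilon>" using norm_ge_zero[of "z - x"] by (simp only: distrib_left)
      then have "\<bar>\<sigma>\<bar> * norm (z - x) * norm (z - x) \<le> \<epsilon> * norm (z - x)"
        by (intro mult_right_mono) (auto simp: mult.commute)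
      moreover have "\<sigma> * (norm (z - x))\<^sup>2 \<le> \<bar>\<sigma>\<bar> * norm (z - x) * norm (z - x)"
        by (simp add: power2_eq_square mult.assoc mult_right_mono)
      ultimately have "\<sigma> / 2 * (norm (z - x))\<^sup>2 \<le> \<epsilon> / 2 * norm (z - x)" by simp
      then have "ereal (a - \<sigma> / 2 * (norm x)\<^sup>2 + (v - \<sigma> *\<^sub>R x) \<bullet> (z - x) - \<epsilon> * norm (z - x))
         \<le> ereal (a + v \<bullet> (z - x) - \<epsilon> / 2 * norm (z - x)) - ereal (\<sigma> / 2 * (norm z)\<^sup>2)"
        unfolding half_norm_square_expand[of \<sigma> z x] by (simp add: inner_diff_left)
      also have "\<dots> \<le> h z - ereal (\<sigma> / 2 * (norm z)\<^sup>2)"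
        using elim(2) by (intro ereal_minus_mono) auto
      finally show ?case .
    qed
  qed
qed

text \<open>
  Convexity propagates the local inequality along the segment from \<open>x\<close> to \<open>z\<close>: at the point with
  parameter \<open>t\<close> both the inequality and its error term scale with \<open>t\<close>, so dividing by \<open>t\<close> leaves an error
  \<open>\<epsilon> |z - x|\<close> with arbitrary \<open>\<epsilon>\<close>.
\<close>

lemma econvex_regular_subgradient:
  assumes h: "econvex_on S h" and v: "v \<in> regular_subdiff h x" and x: "x \<in> S" and z: "z \<in> S"
  shows "h x + ereal (v \<bullet> (z - x)) \<le> h z"
proof -
  obtain a where a: "h x = ereal a" and
    v: "\<And>\<epsilon>. \<epsilon> > 0 \<Longrightarrow> \<forall>\<^sub>F z in nhds x. ereal (a + v \<bullet> (z - x) - \<epsilon> * norm (z - x)) \<le> h z"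
    using v by (rule regular_subdiffE) blast
  have "a + v \<bullet> (z - x) \<le> c" if c: "h z \<le> ereal c" for c
  proof -
    have main: "a + v \<bullet> (z - x) \<le> c + \<epsilon> * norm (z - x)" if \<epsilon>: "\<epsilon> > 0" for \<epsilon> :: real
    proof -
      have "((\<lambda>t. (1 - t) *\<^sub>R x + t *\<^sub>R z) \<longlongrightarrow> (1 - 0) *\<^sub>R x + 0 *\<^sub>R z) (at_right (0::real))"
        by (intro tendsto_intros)
      then have lim: "filterlim (\<lambda>t. (1 - t) *\<^sub>R x + t *\<^sub>R z) (nhds x) (at_right (0::real))" by simp
      have "\<forall>\<^sub>F t in at_right (0::real). 0 < t \<and> t < 1"
        by (auto simp: eventually_at_right_field intro!: exI[of _ 1])
      moreover have "\<forall>\<^sub>F t in at_right (0::real). ereal (a + v \<bullet> ((1 - t) *\<^sub>R x + t *\<^sub>R z - x)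
          - \<epsilon> * norm ((1 - t) *\<^sub>R x + t *\<^sub>R z - x)) \<le> h ((1 - t) *\<^sub>R x + t *\<^sub>R z)"
        by (rule eventually_compose_filterlim[OF v[OF \<epsilon>] lim])
      ultimately have "\<forall>\<^sub>F t in at_right (0::real). 0 < t \<and> t < 1 \<and>
         ereal (a + v \<bullet> ((1 - t) *\<^sub>R x + t *\<^sub>R z - x)
          - \<epsilon> * norm ((1 - t) *\<^sub>R x + t *\<^sub>R z - x)) \<le> h ((1 - t) *\<^sub>R x + t *\<^sub>R z)"
        by eventually_elim auto
      then obtain t :: real where t: "0 < t" "t < 1" and
        lower: "ereal (a + v \<bullet> ((1 - t) *\<^sub>R x + t *\<^sub>R z - x)
          - \<epsilon> * norm ((1 - t) *\<^sub>R x + t *\<^sub>R z - x)) \<le> h ((1 - t) *\<^sub>R x + t *\<^sub>R z)"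
        using eventually_happens[of _ "at_right (0::real)"] by (auto simp: trivial_limit_at_right_real)
      have "h ((1 - t) *\<^sub>R x + t *\<^sub>R z) \<le> ereal ((1 - t) * a + t * c)"
        using econvex_onD(2)[OF h x z _ c, of a t] t by (simp add: a)
      with lower have "a + v \<bullet> ((1 - t) *\<^sub>R x + t *\<^sub>R z - x)
          - \<epsilon> * norm ((1 - t) *\<^sub>R x + t *\<^sub>R z - x) \<le> (1 - t) * a + t * c"
        using order_trans by fastforce
      moreover have step: "(1 - t) *\<^sub>R x + t *\<^sub>R z - x = t *\<^sub>R (z - x)" by (simp add: algebra_simps)
      ultimately have "t * (a + v \<bullet> (z - x)) \<le> t * (c + \<epsilon> * norm (z - x))"
        using t unfolding step norm_scaleR inner_scaleR_right by (simp add: algebra_simps)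
      then show ?thesis using t by simp
    qed
    show ?thesis
    proof (rule field_le_epsilon)
      fix e :: real assume e: "e > 0"
      have "a + v \<bullet> (z - x) \<le> c + e / (norm (z - x) + 1) * norm (z - x)"
        using e by (intro main) (intro divide_pos_pos add_nonneg_pos norm_ge_zero, auto)
      moreover have "e / (norm (z - x) + 1) * norm (z - x) \<le> e / (norm (z - x) + 1) * (norm (z - x) + 1)"
        using e by (intro mult_left_mono divide_nonneg_nonneg) auto
      moreover have "e / (norm (z - x) + 1) * (norm (z - x) + 1) = e"
        using norm_ge_zero[of "z - x"] by (simp del: norm_ge_zero)
      ultimately show "a + v \<bullet> (z - x) \<le> c + e" by linarith
    qed
  qed
  then show ?thesis unfolding a by (rule_tac ereal_le_real) simp
qed

lemma strongly_econvex_regular_subgradient: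
  assumes h: "strongly_econvex_on \<sigma> S h" and v: "v \<in> regular_subdiff h x"
    and x: "x \<in> S" and z: "z \<in> S"
  shows "h x + ereal (v \<bullet> (z - x) + \<sigma> / 2 * (norm (z - x))\<^sup>2) \<le> h z"
proof -
  obtain a where a: "h x = ereal a" using v by (rule regular_subdiffE)
  have "h x - ereal (\<sigma> / 2 * (norm x)\<^sup>2) + ereal ((v - \<sigma> *\<^sub>R x) \<bullet> (z - x))
     \<le> h z - ereal (\<sigma> / 2 * (norm z)\<^sup>2)"
    by (rule econvex_regular_subgradient[OF _ regular_subdiff_diff_quadratic[OF v] x z])
       (use h in \<open>simp add: strongly_econvex_on_def\<close>)
  then show ?thesis unfolding half_norm_square_expand[of \<sigma> z x]
    by (cases "h z") (auto simp: a inner_diff_left)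
qed

lemma strongly_econvex_on_zero: "strongly_econvex_on 0 S h \<longleftrightarrow> econvex_on S h"
  by (simp add: strongly_econvex_on_def flip: zero_ereal_def)

lemma regular_subdiffI_affine:
  assumes a: "h x = ereal a" and "\<forall>\<^sub>F z in nhds x. ereal (a + v \<bullet> (z - x)) \<le> h z"
  shows "v \<in> regular_subdiff h x"
proof (rule regular_subdiffI[where h = h and a = a, OF a])
  fix \<epsilon> :: real assume e: "\<epsilon> > 0"
  show "\<forall>\<^sub>F z in nhds x. ereal (a + v \<bullet> (z - x) - \<epsilon> * norm (z - x)) \<le> h z"
    using assms(2)
  proof eventually_elim
    case (elim z)
    have "ereal (a + v \<bullet> (z - x) - \<epsilon> * norm (z - x)) \<le> ereal (a + v \<bullet> (z - x))"
      using e by simp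
    then show ?case using elim order_trans by blast
  qed
qed

lemma regular_subdiff_subset: "regular_subdiff h x \<subseteq> subdiff h x"
proof
  fix v assume v: "v \<in> regular_subdiff h x"
  then have "\<bar>h x\<bar> \<noteq> \<infinity>" by (auto simp: regular_subdiff_def)
  then show "v \<in> subdiff h x" using v unfolding subdiff_def
    by (intro CollectI conjI exI[of _ "\<lambda>_. x"] exI[of _ "\<lambda>_. v"]) auto
qed

text \<open>
  Regular subgradients of a convex function satisfy a global affine inequality, and such inequalities
  are stable under the limits that define limiting subgradients.
\<close>

lemma subdiff_econvex:
  assumes h: "econvex_on UNIV h"
  shows "subdiff h x = regular_subdiff h x"
proof (rule antisym[OF _ regular_subdiff_subset], rule)
  fix v assume v: "v \<in> subdiff h x"
  then obtain X V where X: "X \<longlonglongrightarrow> x" "(\<lambda>n. h (X n)) \<longlonglongrightarrow> h x" and V: "V \<longlonglongrightarrow> v"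
    and reg: "\<And>n. V n \<in> regular_subdiff h (X n)" by (auto simp: subdiff_def)
  obtain a where a: "h x = ereal a" using v by (auto simp: subdiff_def)
  have "ereal (a + v \<bullet> (z - x)) \<le> h z" for z
  proof -
    have "(\<lambda>n. h (X n) + ereal (V n \<bullet> (z - X n))) \<longlonglongrightarrow> h x + ereal (v \<bullet> (z - x))"
      using a by (intro tendsto_add_ereal X(2) tendsto_intros X(1) V) auto
    moreover have "h (X n) + ereal (V n \<bullet> (z - X n)) \<le> h z" for n
      by (rule econvex_regular_subgradient[OF h reg]) auto
    ultimately have "h x + ereal (v \<bullet> (z - x)) \<le> h z"
      by (intro LIMSEQ_le_const2) auto
    then show ?thesis by (simp add: a)
  qed
  then show "v \<in> regular_subdiff h x" using a by (intro regular_subdiffI_affine[of h x a]) auto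
qed

lemma convex_subgradients_monotone:
  assumes h: "econvex_on UNIV h" and "v \<in> regular_subdiff h x" and "w \<in> regular_subdiff h z"
  shows "(v - w) \<bullet> (x - z) \<ge> 0"
proof -
  obtain a c where "h x = ereal a" "h z = ereal c"
    using assms(2,3) by (auto elim!: regular_subdiffE)
  moreover have "h x + ereal (v \<bullet> (z - x)) \<le> h z" "h z + ereal (w \<bullet> (x - z)) \<le> h x"
    using econvex_regular_subgradient[OF h] assms(2,3) by auto
  ultimately show ?thesis by (simp add: inner_diff)
qed

section \<open>Lower semicontinuity and proximal points\<close>

text \<open>
  A pointwise notion serves for the pulled-back perturbation function, which is lower semicontinuous
  inside the ball of definition but in general not on its boundary. Testing real levels \<open>c\<close> is enough, as these are dense in \<open>ereal\<close>.
\<close>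

definition lsc_at :: "('a::euclidean_space \<Rightarrow> ereal) \<Rightarrow> 'a \<Rightarrow> bool" where
  "lsc_at h x \<longleftrightarrow> (\<forall>c. ereal c < h x \<longrightarrow> (\<forall>\<^sub>F z in nhds x. ereal c < h z))"

lemma lsc_fun_imp_lsc_at:
  assumes "lsc_fun h" shows "lsc_at h x"
  unfolding lsc_at_def
proof safe
  fix c assume c: "ereal c < h x"
  have "h x \<le> Liminf (at x) h" using assms by (simp add: lsc_fun_def)
  then have "\<forall>\<^sub>F z in at x. ereal c < h z" using c by (auto simp: le_Liminf_iff)
  then show "\<forall>\<^sub>F z in nhds x. ereal c < h z" using c
    by (auto simp: eventually_at_filter elim!: eventually_mono)
qed

lemma lsc_at_add_continuous:
  assumes h: "lsc_at h x" and q: "isCont q x"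
  shows "lsc_at (\<lambda>z. h z + ereal (q z)) x"
  unfolding lsc_at_def
proof safe
  fix c assume "ereal c < h x + ereal (q x)"
  then have "ereal (c - q x) < h x" by (cases "h x") auto
  then obtain t where t: "c - q x < t" "ereal t < h x"
    using ereal_dense2 by (metis ereal_less_eq(3) less_ereal.simps(1))
  have "\<forall>\<^sub>F z in nhds x. ereal t < h z" using h t by (auto simp: lsc_at_def)
  moreover have "\<forall>\<^sub>F z in nhds x. c - t < q z"
    using order_tendstoD(1)[of q "q x" "nhds x" "c - t"] q t
    by (auto simp: isCont_def tendsto_at_iff_tendsto_nhds)
  ultimately show "\<forall>\<^sub>F z in nhds x. ereal c < h z + ereal (q z)"
  proof eventually_elim
    case (elim z)
    then show ?case by (cases "h z") auto
  qed
qed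

lemma lsc_at_attains_min:
  fixes h :: "'a::euclidean_space \<Rightarrow> ereal"
  assumes K: "compact K" "K \<noteq> {}" and h: "\<And>x. x \<in> K \<Longrightarrow> lsc_at h x"
  shows "\<exists>x\<in>K. \<forall>z\<in>K. h x \<le> h z"
proof -
  obtain u where u: "\<And>n. u n \<in> h ` K" "u \<longlonglongrightarrow> Inf (h ` K)"
    using Inf_as_limit[of "h ` K"] K(2) by auto
  have "\<forall>n. \<exists>x. x \<in> K \<and> u n = h x" using u(1) by blast
  from choice[OF this] obtain X where "\<forall>n. X n \<in> K \<and> u n = h (X n)" ..
  then have X: "\<And>n. X n \<in> K" "\<And>n. u n = h (X n)" by auto
  obtain x r where x: "x \<in> K" and r: "strict_mono r" "(X \<circ> r) \<longlonglongrightarrow> x"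
    using seq_compactE[OF compact_imp_seq_compact[OF K(1)], of X] X(1) by blast
  have "(u \<circ> r) \<longlonglongrightarrow> Inf (h ` K)" using u(2) r(1) by (rule LIMSEQ_subseq_LIMSEQ)
  then have lim: "(\<lambda>n. h ((X \<circ> r) n)) \<longlonglongrightarrow> Inf (h ` K)" by (simp add: o_def X(2))
  have "h x \<le> Inf (h ` K)"
  proof (rule ccontr)
    assume "\<not> h x \<le> Inf (h ` K)"
    then obtain c where c: "Inf (h ` K) < ereal c" "ereal c < h x"
      using ereal_dense2[of "Inf (h ` K)" "h x"] by (auto simp: not_le)
    have "\<forall>\<^sub>F n in sequentially. ereal c < h ((X \<circ> r) n)"
      using eventually_compose_filterlim[OF _ r(2)] h[OF x] c(2) unfolding lsc_at_def by blast
    then have "ereal c \<le> Inf (h ` K)"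
      by (intro tendsto_lowerbound[OF lim]) (auto elim: eventually_mono)
    then show False using c(1) by simp
  qed
  then have "h x \<le> h z" if "z \<in> K" for z
    using that INF_lower[of z K h] by (rule_tac order_trans)
  then show ?thesis using x by blast
qed

text \<open>
  Fermat's rule for the proximal problem. Completing squares, it also applies when a linear term is
  added to \<open>h\<close>, with a shifted centre \<open>s\<close>.
\<close>

lemma proximal_point_regular_subgradient:
  assumes fin: "h p = ereal a"
    and min: "\<forall>\<^sub>F u in nhds p. h p + ereal (r / 2 * (norm (p - s))\<^sup>2) \<le> h u + ereal (r / 2 * (norm (u - s))\<^sup>2)"
  shows "r *\<^sub>R (s - p) \<in> regular_subdiff h p"
proof -
  define k where "k u = h u + ereal (r / 2 * (norm (u - s))\<^sup>2)" for u
  have id: "r / 2 * (norm (u - s))\<^sup>2 = r / 2 * (norm u)\<^sup>2 - (r *\<^sub>R s) \<bullet> u + r / 2 * (norm s)\<^sup>2" for u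
    by (simp add: power2_norm_eq_inner inner_diff inner_commute field_simps)
  have "(0::'a) \<in> regular_subdiff k p"
    by (rule regular_subdiffI_affine[of k p "a + r / 2 * (norm (p - s))\<^sup>2"])
       (use min in \<open>auto simp: k_def fin\<close>)
  note this[THEN regular_subdiff_diff_quadratic, of r]
  then obtain b where b: "k p - ereal (r / 2 * (norm p)\<^sup>2) = ereal b" and
    ev: "\<And>\<epsilon>. \<epsilon> > 0 \<Longrightarrow> \<forall>\<^sub>F z in nhds p. ereal (b + (0 - r *\<^sub>R p) \<bullet> (z - p) - \<epsilon> * norm (z - p))
       \<le> k z - ereal (r / 2 * (norm z)\<^sup>2)"
    by (rule regular_subdiffE) blast
  show ?thesis
  proof (rule regular_subdiffI[where h = h and a = a, OF fin])
    fix \<epsilon> :: real assume "\<epsilon> > 0"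
    from ev[OF this] show "\<forall>\<^sub>F z in nhds p. ereal (a + r *\<^sub>R (s - p) \<bullet> (z - p) - \<epsilon> * norm (z - p)) \<le> h z"
    proof eventually_elim
      case (elim z)
      have "b = a - (r *\<^sub>R s) \<bullet> p + r / 2 * (norm s)\<^sup>2" using b unfolding k_def fin id by simp
      then show ?case using elim unfolding k_def id by (cases "h z") (auto simp: algebra_simps)
    qed
  qed
qed

section \<open>Variational convexity as local quadratic growth\<close>

text \<open>
  With this convention the two readings of the theorem share one proof, as modulus \<open>0\<close> of strong
  convexity is convexity.
\<close>

definition admissible_modulus :: "bool \<Rightarrow> real \<Rightarrow> bool" where
  "admissible_modulus strong \<sigma> \<longleftrightarrow> (if strong then \<sigma> > 0 else \<sigma> = 0)"

lemma admissible_modulus_nonneg: "admissible_modulus strong \<sigma> \<Longrightarrow> 0 \<le> \<sigma>"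
  by (auto simp: admissible_modulus_def split: if_splits)

definition local_quadratic_growth ::
    "real \<Rightarrow> ('a::euclidean_space \<Rightarrow> ereal) \<Rightarrow> 'a \<Rightarrow> 'a \<Rightarrow> bool" where
  "local_quadratic_growth \<sigma> h wbar zbar \<longleftrightarrow>
     (\<exists>\<delta>>0. \<forall>w\<in>ball wbar \<delta>. \<forall>z\<in>ball zbar \<delta>. z \<in> subdiff h w \<longrightarrow>
        (\<forall>w'\<in>ball wbar \<delta>. h w + ereal (z \<bullet> (w' - w) + \<sigma> / 2 * (norm (w' - w))\<^sup>2) \<le> h w'))"

lemma local_quadratic_growthD:
  assumes "local_quadratic_growth \<sigma> h wbar zbar"
  obtains \<delta> where "\<delta> > 0" "\<And>w z w'. w \<in> ball wbar \<delta> \<Longrightarrow> z \<in> ball zbar \<delta> \<Longrightarrow> z \<in> subdiff h w \<Longrightarrow>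
    w' \<in> ball wbar \<delta> \<Longrightarrow> h w + ereal (z \<bullet> (w' - w) + \<sigma> / 2 * (norm (w' - w))\<^sup>2) \<le> h w'"
  using assms unfolding local_quadratic_growth_def by blast

lemma econvex_on_subset:
  assumes "econvex_on T h" "S \<subseteq> T" "convex S"
  shows "econvex_on S h"
proof (rule econvex_onI)
  fix x z a c t
  assume "x \<in> S" "z \<in> S" "h x \<le> ereal a" "h z \<le> ereal c" "0 \<le> t" "t \<le> (1::real)"
  then show "(1 - t) *\<^sub>R x + t *\<^sub>R z \<in> S \<and>
      h ((1 - t) *\<^sub>R x + t *\<^sub>R z) \<le> ereal ((1 - t) * a + t * c)"
    using econvex_onD(2)[OF assms(1), of x z a c t] assms(2,3) by (auto simp: convex_alt)
qed

lemma norm_square_convex: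
  fixes x z :: "'a::euclidean_space"
  assumes "0 \<le> t" "t \<le> 1"
  shows "(norm ((1 - t) *\<^sub>R x + t *\<^sub>R z))\<^sup>2 \<le> (1 - t) * (norm x)\<^sup>2 + t * (norm z)\<^sup>2"
proof -
  have "(1 - t) * (norm x)\<^sup>2 + t * (norm z)\<^sup>2 - (norm ((1 - t) *\<^sub>R x + t *\<^sub>R z))\<^sup>2
      = t * (1 - t) * (norm (x - z))\<^sup>2"
    by (simp add: power2_norm_eq_inner inner_simps inner_commute algebra_simps)
  moreover have "t * (1 - t) * (norm (x - z))\<^sup>2 \<ge> 0" using assms by simp
  ultimately show ?thesis by linarith
qed

lemma strongly_econvex_imp_econvex:
  assumes h: "strongly_econvex_on \<sigma> S h" and \<sigma>: "\<sigma> \<ge> 0"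
  shows "econvex_on S h"
proof (rule econvex_onI)
  fix x z a c t
  assume x: "x \<in> S" and z: "z \<in> S" and a: "h x \<le> ereal a" and c: "h z \<le> ereal c"
    and t: "0 \<le> t" "t \<le> (1::real)"
  let ?m = "(1 - t) *\<^sub>R x + t *\<^sub>R z"
  have "h x - ereal (\<sigma> / 2 * (norm x)\<^sup>2) \<le> ereal (a - \<sigma> / 2 * (norm x)\<^sup>2)"
    "h z - ereal (\<sigma> / 2 * (norm z)\<^sup>2) \<le> ereal (c - \<sigma> / 2 * (norm z)\<^sup>2)"
    using ereal_minus_mono[OF a order_refl] ereal_minus_mono[OF c order_refl] by (metis ereal_minus(1))+
  note conv = econvex_onD[OF h[unfolded strongly_econvex_on_def] x z this t]
  have "\<sigma> / 2 * (norm ?m)\<^sup>2 \<le> \<sigma> / 2 * ((1 - t) * (norm x)\<^sup>2 + t * (norm z)\<^sup>2)"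
    using norm_square_convex[OF t] \<sigma> by (intro mult_left_mono) auto
  moreover have "(1 - t) * (a - s * X) + t * (c - s * Z) + s * M \<le> (1 - t) * a + t * c"
    if "s * M \<le> s * ((1 - t) * X + t * Z)" for s X Z M :: real
    using that by (simp add: algebra_simps)
  ultimately have "(1 - t) * (a - \<sigma> / 2 * (norm x)\<^sup>2) + t * (c - \<sigma> / 2 * (norm z)\<^sup>2)
      + \<sigma> / 2 * (norm ?m)\<^sup>2 \<le> (1 - t) * a + t * c"
    by blast
  with conv(2) have "h ?m \<le> ereal ((1 - t) * a + t * c)"
    by (cases "h ?m") auto
  with conv(1) show "?m \<in> S \<and> h ?m \<le> ereal ((1 - t) * a + t * c)" by simp
qed

text \<open>
  On the common graph the subgradient inequality of the convex minorant \<open>h\<close> starts from the value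
  \<open>h w = h0 w\<close> and ends below \<open>h w' \<le> h0 w'\<close>, so it is inherited by \<open>h0\<close>.
\<close>

theorem variationally_convex_imp_growth:
  assumes "variationally_convex strong h0 wbar zbar"
  shows "\<exists>\<sigma>. admissible_modulus strong \<sigma> \<and> local_quadratic_growth \<sigma> h0 wbar zbar"
proof -
  obtain N Z h where N: "convex N" "open N" "wbar \<in> N" and Z: "open Z" "zbar \<in> Z"
    and h: "econvex_on UNIV h" and le: "\<And>w. w \<in> N \<Longrightarrow> h w \<le> h0 w"
    and gph: "(N \<times> Z) \<inter> gph_subdiff h = (N \<times> Z) \<inter> gph_subdiff h0"
    and eq: "\<forall>(w, z)\<in>(N \<times> Z) \<inter> gph_subdiff h. h w = h0 w"
    and strong: "strong \<longrightarrow> (\<exists>\<sigma>>0. strongly_econvex_on \<sigma> N h)"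
    using assms unfolding variationally_convex_def by blast
  have "strongly_econvex_on 0 N h"
    unfolding strongly_econvex_on_zero by (rule econvex_on_subset[OF h _ N(1)]) simp
  then obtain \<sigma> where \<sigma>: "admissible_modulus strong \<sigma>" "strongly_econvex_on \<sigma> N h"
    using strong unfolding admissible_modulus_def by (cases strong) auto
  obtain d1 d2 where d: "d1 > 0" "ball wbar d1 \<subseteq> N" "d2 > 0" "ball zbar d2 \<subseteq> Z"
    using N Z open_contains_ball by metis
  have "local_quadratic_growth \<sigma> h0 wbar zbar"
    unfolding local_quadratic_growth_def
  proof (intro exI[of _ "min d1 d2"] conjI ballI impI)
    show "min d1 d2 > 0" using d by simp
    fix w z w'
    assume "w \<in> ball wbar (min d1 d2)" "z \<in> ball zbar (min d1 d2)" "w' \<in> ball wbar (min d1 d2)"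
    then have in_N: "w \<in> N" "z \<in> Z" "w' \<in> N" using d by auto
    assume "z \<in> subdiff h0 w"
    then have wz: "(w, z) \<in> (N \<times> Z) \<inter> gph_subdiff h"
      using gph in_N by (simp add: gph_subdiff_def)
    then have "h w = h0 w" using eq by auto
    moreover have "z \<in> regular_subdiff h w"
      using wz by (simp add: gph_subdiff_def subdiff_econvex[OF h])
    then have "h w + ereal (z \<bullet> (w' - w) + \<sigma> / 2 * (norm (w' - w))\<^sup>2) \<le> h w'"
      by (rule strongly_econvex_regular_subgradient[OF \<sigma>(2)]) (use in_N in auto)
    moreover have "h w' \<le> h0 w'" by (rule le[OF in_N(3)])
    ultimately show "h0 w + ereal (z \<bullet> (w' - w) + \<sigma> / 2 * (norm (w' - w))\<^sup>2) \<le> h0 w'"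
      by simp
  qed
  with \<sigma>(1) show ?thesis by blast
qed

text \<open>
  The quadratics are stored as \<open>c + z \<bullet> w + \<sigma>/2 |w|\<^sup>2\<close>, all with the same leading term. After
  subtracting \<open>\<sigma>/2 |w|\<^sup>2\<close> the supremum is one of affine functions, so its strong convexity is immediate.
\<close>

definition quadratic_sup ::
    "real \<Rightarrow> (real \<times> 'a::euclidean_space) set \<Rightarrow> 'a \<Rightarrow> ereal" where
  "quadratic_sup \<sigma> P w = (SUP (c, z)\<in>P. ereal (c + z \<bullet> w + \<sigma> / 2 * (norm w)\<^sup>2))"

lemma quadratic_sup_upper:
  "(c, z) \<in> P \<Longrightarrow> ereal (c + z \<bullet> w + \<sigma> / 2 * (norm w)\<^sup>2) \<le> quadratic_sup \<sigma> P w"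
  unfolding quadratic_sup_def by (rule SUP_upper2[where i = "(c, z)"]) auto

lemma strongly_econvex_quadratic_sup:
  assumes S: "convex S"
  shows "strongly_econvex_on \<sigma> S (quadratic_sup \<sigma> P)"
  unfolding strongly_econvex_on_def
proof (rule econvex_onI)
  have le_iff: "quadratic_sup \<sigma> P x - ereal (\<sigma> / 2 * (norm x)\<^sup>2) \<le> ereal a
      \<longleftrightarrow> (\<forall>(c, z)\<in>P. c + z \<bullet> x \<le> a)" for x a
  proof -
    have "quadratic_sup \<sigma> P x - ereal (\<sigma> / 2 * (norm x)\<^sup>2) \<le> ereal a
       \<longleftrightarrow> quadratic_sup \<sigma> P x \<le> ereal (a + \<sigma> / 2 * (norm x)\<^sup>2)"
      by (cases "quadratic_sup \<sigma> P x") (auto simp: algebra_simps)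
    also have "\<dots> \<longleftrightarrow> (\<forall>(c, z)\<in>P. c + z \<bullet> x \<le> a)"
      unfolding quadratic_sup_def SUP_le_iff by (auto split: prod.splits)
    finally show ?thesis .
  qed
  fix x z a c t
  assume x: "x \<in> S" "z \<in> S" and t: "0 \<le> t" "t \<le> (1::real)"
    and a: "quadratic_sup \<sigma> P x - ereal (\<sigma> / 2 * (norm x)\<^sup>2) \<le> ereal a"
    and c: "quadratic_sup \<sigma> P z - ereal (\<sigma> / 2 * (norm z)\<^sup>2) \<le> ereal c"
  let ?m = "(1 - t) *\<^sub>R x + t *\<^sub>R z"
  have "e + y \<bullet> ?m \<le> (1 - t) * a + t * c" if "(e, y) \<in> P" for e y
  proof -
    have "e + y \<bullet> x \<le> a" "e + y \<bullet> z \<le> c" using a[unfolded le_iff] c[unfolded le_iff] that by auto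
    then have "(1 - t) * (e + y \<bullet> x) + t * (e + y \<bullet> z) \<le> (1 - t) * a + t * c"
      using t by (intro add_mono mult_left_mono) auto
    then show ?thesis by (simp add: inner_simps algebra_simps)
  qed
  then show "?m \<in> S \<and> quadratic_sup \<sigma> P ?m - ereal (\<sigma> / 2 * (norm ?m)\<^sup>2) \<le> ereal ((1 - t) * a + t * c)"
    unfolding le_iff using S x t by (auto simp: convex_alt)
qed

lemma lsc_quadratic_sup: "lsc_fun (quadratic_sup \<sigma> P)"
  unfolding lsc_fun_def
proof
  fix x
  have "ereal (c + z \<bullet> x + \<sigma> / 2 * (norm x)\<^sup>2) \<le> Liminf (at x) (quadratic_sup \<sigma> P)"
    if "(c, z) \<in> P" for c z
  proof -
    have "((\<lambda>w. ereal (c + z \<bullet> w + \<sigma> / 2 * (norm w)\<^sup>2)) \<longlongrightarrow>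
        ereal (c + z \<bullet> x + \<sigma> / 2 * (norm x)\<^sup>2)) (at x)"
      by (intro tendsto_intros)
    then have "Liminf (at x) (\<lambda>w. ereal (c + z \<bullet> w + \<sigma> / 2 * (norm w)\<^sup>2)) =
        ereal (c + z \<bullet> x + \<sigma> / 2 * (norm x)\<^sup>2)"
      by (intro lim_imp_Liminf) auto
    moreover have "Liminf (at x) (\<lambda>w. ereal (c + z \<bullet> w + \<sigma> / 2 * (norm w)\<^sup>2)) \<le>
        Liminf (at x) (quadratic_sup \<sigma> P)"
      by (intro Liminf_mono always_eventually allI quadratic_sup_upper that)
    ultimately show ?thesis by simp
  qed
  then show "quadratic_sup \<sigma> P x \<le> Liminf (at x) (quadratic_sup \<sigma> P)"
    unfolding quadratic_sup_def[of \<sigma> P x] by (auto intro!: SUP_least)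
qed

text \<open>
  The resolvent of the subdifferential is locally surjective: every \<open>(w, z)\<close> near \<open>(wbar, zbar)\<close> can be
  written as \<open>w + z = w0 + z0\<close> with \<open>z0\<close> a subgradient at a nearby point \<open>w0\<close>. The point \<open>w0\<close> is a
  proximal point of \<open>w + z\<close>; the affine minorant of \<open>h\<close> at \<open>wbar\<close> forces the minimizer over a closed
  ball to lie in the interior of this ball, where Fermat's rule applies.
\<close>

lemma growth_imp_local_resolvent:
  assumes gph: "zbar \<in> subdiff h wbar" and \<delta>: "\<delta> > 0"
    and growth: "\<And>w. w \<in> ball wbar \<delta> \<Longrightarrow> h wbar + ereal (zbar \<bullet> (w - wbar)) \<le> h w"
    and lsc: "\<And>w. w \<in> ball wbar \<delta> \<Longrightarrow> lsc_at h w"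
  obtains \<eta> where "\<eta> > 0" "\<eta> \<le> \<delta>"
    "\<And>w z. w \<in> ball wbar \<eta> \<Longrightarrow> z \<in> ball zbar \<eta> \<Longrightarrow>
      \<exists>w0\<in>ball wbar \<delta>. z - (w0 - w) \<in> ball zbar \<delta> \<and> z - (w0 - w) \<in> regular_subdiff h w0"
proof (rule that)
  define \<epsilon> where "\<epsilon> = \<delta> / 2"
  \<comment> \<open>with this choice the minimizer satisfies \<open>|w0 - w| \<le> 5 \<eta>\<close>, hence \<open>|w0 - wbar| \<le> 6 \<eta> < \<epsilon>\<close>\<close>
  define \<eta> where "\<eta> = \<delta> / 16"
  show "\<eta> > 0" "\<eta> \<le> \<delta>" using \<delta> by (auto simp: \<eta>_def)
  fix w z assume w: "w \<in> ball wbar \<eta>" and z: "z \<in> ball zbar \<eta>"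
  obtain a where a: "h wbar = ereal a" using gph by (auto simp: subdiff_def)
  define k where "k u = h u + ereal (1 / 2 * (norm (u - (w + z)))\<^sup>2)" for u
  have sub: "cball wbar \<epsilon> \<subseteq> ball wbar \<delta>" using \<delta> by (auto simp: \<epsilon>_def)
  have "\<exists>u\<in>cball wbar \<epsilon>. \<forall>v\<in>cball wbar \<epsilon>. k u \<le> k v"
  proof (rule lsc_at_attains_min)
    show "cball wbar \<epsilon> \<noteq> {}" using \<delta> by (simp add: \<epsilon>_def)
    fix u assume "u \<in> cball wbar \<epsilon>"
    then have "lsc_at h u" using lsc sub by blast
    then show "lsc_at k u" unfolding k_def
      by (rule lsc_at_add_continuous) (intro continuous_intros)
  qed simp
  then obtain w0 where w0: "w0 \<in> cball wbar \<epsilon>" and min: "\<And>v. v \<in> cball wbar \<epsilon> \<Longrightarrow> k w0 \<le> k v"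
    by blast
  have "k w0 \<le> k wbar" using min \<delta> by (simp add: \<epsilon>_def)
  moreover have low: "h wbar + ereal (zbar \<bullet> (w0 - wbar)) \<le> h w0" using growth w0 sub by blast
  ultimately obtain b where b: "h w0 = ereal b"
    unfolding k_def a by (cases "h w0") auto
  have ineq: "zbar \<bullet> (w0 - wbar) + 1 / 2 * (norm (w0 - (w + z)))\<^sup>2 \<le> 1 / 2 * (norm (wbar - (w + z)))\<^sup>2"
    using \<open>k w0 \<le> k wbar\<close> low by (simp add: k_def a b)
  have id: "1 / 2 * (norm (u - (w + z)))\<^sup>2 = 1 / 2 * (norm (u - w))\<^sup>2 - z \<bullet> (u - w) + 1 / 2 * (norm z)\<^sup>2" for u
    by (simp add: power2_norm_eq_inner inner_diff inner_add inner_commute field_simps)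
  have nw: "norm (wbar - w) \<le> \<eta>" and nz: "norm (z - zbar) \<le> \<eta>"
    using w z by (auto simp: dist_norm norm_minus_commute)
  have n0: "norm (w0 - wbar) \<le> \<epsilon>" using w0 by (auto simp: dist_norm norm_minus_commute)
  have "1 / 2 * (norm (w0 - w))\<^sup>2 \<le> (z - zbar) \<bullet> (w0 - wbar) + 1 / 2 * (norm (wbar - w))\<^sup>2"
    using ineq unfolding id by (simp add: inner_simps)
  also have "(z - zbar) \<bullet> (w0 - wbar) \<le> norm (z - zbar) * norm (w0 - wbar)"
    by (rule norm_cauchy_schwarz)
  also have "\<dots> \<le> \<eta> * \<epsilon>" using nz n0 \<delta> by (intro mult_mono) (auto simp: \<eta>_def)
  also have "1 / 2 * (norm (wbar - w))\<^sup>2 \<le> 1 / 2 * \<eta>\<^sup>2"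
    using nw by (intro mult_left_mono power_mono) auto
  finally have "(norm (w0 - w))\<^sup>2 \<le> 2 * \<eta> * \<epsilon> + \<eta>\<^sup>2" by simp
  also have "\<dots> \<le> (5 * \<eta>)\<^sup>2" by (simp add: \<eta>_def \<epsilon>_def power2_eq_square)
  finally have n1: "norm (w0 - w) \<le> 5 * \<eta>"
    using \<delta> by (auto simp: \<eta>_def dest: power2_le_imp_le)
  have "norm (w0 - wbar) \<le> norm (w0 - w) + norm (wbar - w)"
    using norm_triangle_ineq4[of "w0 - w" "wbar - w"] by simp
  then have int: "w0 \<in> ball wbar \<epsilon>" using n1 nw \<delta> by (auto simp: dist_norm norm_minus_commute \<epsilon>_def \<eta>_def)
  have "norm (z - (w0 - w) - zbar) \<le> norm (z - zbar) + norm (w0 - w)"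
    using norm_triangle_ineq4[of "z - zbar" "w0 - w"] by (simp add: algebra_simps)
  then have zin: "z - (w0 - w) \<in> ball zbar \<delta>"
    using n1 nz \<delta> by (auto simp: dist_norm norm_minus_commute \<eta>_def)
  have "\<forall>\<^sub>F u in nhds w0. u \<in> ball wbar \<epsilon>" using int by (intro eventually_nhds_in_open) auto
  then have "\<forall>\<^sub>F u in nhds w0. h w0 + ereal (1 / 2 * (norm (w0 - (w + z)))\<^sup>2) \<le>
      h u + ereal (1 / 2 * (norm (u - (w + z)))\<^sup>2)"
    by eventually_elim (use min in \<open>auto simp: k_def\<close>)
  from proximal_point_regular_subgradient[where r = 1, OF b this]
  have "z - (w0 - w) \<in> regular_subdiff h w0" by (simp add: algebra_simps)
  then show "\<exists>w0\<in>ball wbar \<delta>. z - (w0 - w) \<in> ball zbar \<delta> \<and> z - (w0 - w) \<in> regular_subdiff h w0"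
    using w0 sub zin by blast
qed

text \<open>
  The convex minorant is the supremum \<open>h\<close> of the supporting quadratics at all pairs of the localized
  graph \<open>T\<close>. It touches \<open>h0\<close> along \<open>T\<close> and has the subgradients recorded in \<open>T\<close>. A further subgradient
  \<open>z\<close> of \<open>h\<close> at \<open>w\<close> is compared with the pair \<open>(w0, z - (w0 - w))\<close> of \<open>T\<close> given by the local resolvent:
  monotonicity of the subgradients of \<open>h\<close> reads \<open>- |w0 - w|\<^sup>2 \<ge> 0\<close>, so \<open>(w, z)\<close> was in \<open>T\<close> already.
\<close>

theorem growth_imp_variationally_convex:
  assumes gph: "zbar \<in> subdiff h0 wbar" and lsc: "\<forall>\<^sub>F w in nhds wbar. lsc_at h0 w"
    and \<sigma>: "admissible_modulus strong \<sigma>" and growth: "local_quadratic_growth \<sigma> h0 wbar zbar"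
  shows "variationally_convex strong h0 wbar zbar"
proof -
  have \<sigma>0: "\<sigma> \<ge> 0" using \<sigma> by (rule admissible_modulus_nonneg)
  obtain d1 where d1: "d1 > 0" and growth1: "\<And>w z w'. w \<in> ball wbar d1 \<Longrightarrow> z \<in> ball zbar d1 \<Longrightarrow>
      z \<in> subdiff h0 w \<Longrightarrow> w' \<in> ball wbar d1 \<Longrightarrow>
      h0 w + ereal (z \<bullet> (w' - w) + \<sigma> / 2 * (norm (w' - w))\<^sup>2) \<le> h0 w'"
    using growth by (rule local_quadratic_growthD) blast
  obtain d2 where d2: "d2 > 0" and lsc2: "\<And>w. w \<in> ball wbar d2 \<Longrightarrow> lsc_at h0 w"
    using lsc unfolding eventually_nhds_metric by (auto simp: dist_commute)
  define \<delta> where "\<delta> = min d1 d2"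
  have \<delta>: "\<delta> > 0" using d1 d2 by (simp add: \<delta>_def)
  have grow: "h0 w + ereal (z \<bullet> (w' - w) + \<sigma> / 2 * (norm (w' - w))\<^sup>2) \<le> h0 w'"
    if "w \<in> ball wbar \<delta>" "z \<in> ball zbar \<delta>" "z \<in> subdiff h0 w" "w' \<in> ball wbar \<delta>" for w z w'
    using growth1[of w z w'] that by (auto simp: \<delta>_def)
  have "h0 wbar + ereal (zbar \<bullet> (w - wbar)) \<le> h0 w" if "w \<in> ball wbar \<delta>" for w
  proof -
    have "h0 wbar + ereal (zbar \<bullet> (w - wbar)) \<le>
        h0 wbar + ereal (zbar \<bullet> (w - wbar) + \<sigma> / 2 * (norm (w - wbar))\<^sup>2)"
      using \<sigma>0 by (intro add_left_mono) simp
    also have "\<dots> \<le> h0 w" using grow[OF _ _ gph that] \<delta> by simp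
    finally show ?thesis .
  qed
  then obtain \<eta> where \<eta>: "\<eta> > 0" "\<eta> \<le> \<delta>" and resolvent: "\<And>w z. w \<in> ball wbar \<eta> \<Longrightarrow> z \<in> ball zbar \<eta> \<Longrightarrow>
      \<exists>w0\<in>ball wbar \<delta>. z - (w0 - w) \<in> ball zbar \<delta> \<and> z - (w0 - w) \<in> regular_subdiff h0 w0"
    using growth_imp_local_resolvent[OF gph \<delta>, of thesis] lsc2 by (auto simp: \<delta>_def)
  define T where "T = {(w, z). w \<in> ball wbar \<delta> \<and> z \<in> ball zbar \<delta> \<and> z \<in> subdiff h0 w}"
  define P where "P = (\<lambda>(w, z). (real_of_ereal (h0 w) - z \<bullet> w + \<sigma> / 2 * (norm w)\<^sup>2, z - \<sigma> *\<^sub>R w)) ` T"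
  define h where "h = quadratic_sup \<sigma> P"
  have expand: "ereal (real_of_ereal (h0 w) - z \<bullet> w + \<sigma> / 2 * (norm w)\<^sup>2 + (z - \<sigma> *\<^sub>R w) \<bullet> w'
      + \<sigma> / 2 * (norm w')\<^sup>2) = h0 w + ereal (z \<bullet> (w' - w) + \<sigma> / 2 * (norm (w' - w))\<^sup>2)"
    if z: "z \<in> subdiff h0 w" for w z w'
  proof -
    obtain a where "h0 w = ereal a" using z by (auto simp: subdiff_def)
    then show ?thesis unfolding half_norm_square_expand[of \<sigma> w' w]
      by (simp add: inner_simps power2_norm_eq_inner inner_commute field_simps)
  qed
  have h_upper: "h0 w + ereal (z \<bullet> (w' - w) + \<sigma> / 2 * (norm (w' - w))\<^sup>2) \<le> h w'"
    if "(w, z) \<in> T" for w z w'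
  proof -
    have "(real_of_ereal (h0 w) - z \<bullet> w + \<sigma> / 2 * (norm w)\<^sup>2, z - \<sigma> *\<^sub>R w) \<in> P"
      unfolding P_def using that by (intro rev_image_eqI) auto
    note upper = quadratic_sup_upper[OF this, where \<sigma> = \<sigma> and w = w']
    have z: "z \<in> subdiff h0 w" using that by (simp add: T_def)
    from upper show ?thesis unfolding expand[OF z] h_def .
  qed
  have h_le: "h w' \<le> h0 w'" if "w' \<in> ball wbar \<delta>" for w'
    unfolding h_def quadratic_sup_def P_def
    using grow that by (auto intro!: SUP_least simp: T_def expand simp del: times_divide_eq_left)
  have h_strong: "strongly_econvex_on \<sigma> S h" if "convex S" for S
    unfolding h_def by (rule strongly_econvex_quadratic_sup[OF that])
  have h_convex: "econvex_on UNIV h"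
    by (rule strongly_econvex_imp_econvex[OF h_strong \<sigma>0]) simp
  have touch: "h w = h0 w \<and> z \<in> regular_subdiff h w" if wz: "(w, z) \<in> T" for w z
  proof -
    have w: "w \<in> ball wbar \<delta>" and z: "z \<in> subdiff h0 w" using wz by (auto simp: T_def)
    have eq: "h w = h0 w" using h_upper[OF wz, of w] h_le[OF w] by (simp flip: zero_ereal_def)
    obtain a where a: "h0 w = ereal a" using z by (auto simp: subdiff_def)
    have "ereal (a + z \<bullet> (u - w)) \<le> h u" for u
    proof -
      have "ereal (a + z \<bullet> (u - w)) \<le> h0 w + ereal (z \<bullet> (u - w) + \<sigma> / 2 * (norm (u - w))\<^sup>2)"
        using \<sigma>0 by (simp add: a)
      then show ?thesis using h_upper[OF wz, of u] by (rule order_trans)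
    qed
    then have "z \<in> regular_subdiff h w"
      using eq a by (intro regular_subdiffI_affine[where h = h and a = a]) auto
    with eq show ?thesis by simp
  qed
  have gph_T: "(w, z) \<in> T" if w: "w \<in> ball wbar \<eta>" and z: "z \<in> ball zbar \<eta>" and wz: "z \<in> subdiff h w" for w z
  proof -
    obtain w0 where w0: "w0 \<in> ball wbar \<delta>" "z - (w0 - w) \<in> ball zbar \<delta>"
      "z - (w0 - w) \<in> regular_subdiff h0 w0"
      using resolvent[OF w z] by blast
    then have "(w0, z - (w0 - w)) \<in> T" using regular_subdiff_subset by (auto simp: T_def)
    then have "(z - (z - (w0 - w))) \<bullet> (w - w0) \<ge> 0"
      using touch wz by (intro convex_subgradients_monotone[OF h_convex]) (auto simp: subdiff_econvex[OF h_convex])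
    then have "(w0 - w) \<bullet> (w0 - w) \<le> 0" by (simp add: inner_simps)
    then have "w0 = w" by (metis inner_gt_zero_iff linorder_not_le right_minus_eq)
    with \<open>(w0, z - (w0 - w)) \<in> T\<close> show ?thesis by simp
  qed
  have T_center: "(wbar, zbar) \<in> T" using gph \<delta> by (simp add: T_def)
  have graphs: "z \<in> subdiff h w \<longleftrightarrow> z \<in> subdiff h0 w" if "w \<in> ball wbar \<eta>" "z \<in> ball zbar \<eta>" for w z
  proof
    assume "z \<in> subdiff h w"
    then show "z \<in> subdiff h0 w" using gph_T that by (auto simp: T_def)
  next
    assume "z \<in> subdiff h0 w"
    then have "(w, z) \<in> T" using that \<eta> by (auto simp: T_def)
    then show "z \<in> subdiff h w" using touch by (simp add: subdiff_econvex[OF h_convex])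
  qed
  have proper: "proper_fun h"
    unfolding proper_fun_def
  proof
    obtain a where a: "h0 wbar = ereal a" using gph by (auto simp: subdiff_def)
    show "\<forall>x. h x \<noteq> -\<infinity>"
    proof
      fix x show "h x \<noteq> -\<infinity>" using h_upper[OF T_center, of x] by (auto simp: a)
    qed
    show "\<exists>x. h x \<noteq> \<infinity>" using touch[OF T_center] a by (metis PInfty_neq_ereal(1))
  qed
  have eq: "h w = h0 w" if "w \<in> ball wbar \<eta>" "z \<in> ball zbar \<eta>" "z \<in> subdiff h w" for w z
    using gph_T[OF that] touch by blast
  show ?thesis
    unfolding variationally_convex_def
  proof (rule conjI[OF _ exI[of _ "ball wbar \<eta>", OF exI[of _ "ball zbar \<eta>", OF exI[of _ h]]]];
      (intro conjI impI)?)
    show "(wbar, zbar) \<in> gph_subdiff h0" using gph by (simp add: gph_subdiff_def)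
    show "\<forall>w\<in>ball wbar \<eta>. h w \<le> h0 w" using h_le \<eta> by auto
    show "(ball wbar \<eta> \<times> ball zbar \<eta>) \<inter> gph_subdiff h = (ball wbar \<eta> \<times> ball zbar \<eta>) \<inter> gph_subdiff h0"
      using graphs by (auto simp: gph_subdiff_def)
    show "\<forall>(w, z)\<in>(ball wbar \<eta> \<times> ball zbar \<eta>) \<inter> gph_subdiff h. h w = h0 w"
      using eq by (auto simp: gph_subdiff_def)
    show "lsc_fun h" unfolding h_def by (rule lsc_quadratic_sup)
    show "\<exists>\<sigma>>0. strongly_econvex_on \<sigma> (ball wbar \<eta>) h" if strong
      using h_strong[of "ball wbar \<eta>"] \<sigma> that by (auto simp: admissible_modulus_def)
  qed (use \<eta> proper h_convex in auto)
qed

section \<open>Differentiable functions and their regular subgradients\<close>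

lemma has_derivative_eventually:
  fixes f :: "'a::euclidean_space \<Rightarrow> 'b::real_normed_vector"
  assumes "(f has_derivative f') (at x)" "\<epsilon> > 0"
  shows "\<forall>\<^sub>F z in nhds x. norm (f z - f x - f' (z - x)) \<le> \<epsilon> * norm (z - x)"
  using assms unfolding has_derivative_at_alt eventually_nhds_metric dist_norm by blast

lemma has_derivative_eventually_lipschitz:
  fixes f :: "'a::euclidean_space \<Rightarrow> 'b::real_normed_vector"
  assumes "(f has_derivative f') (at x)"
  obtains C where "C \<ge> 0" "\<forall>\<^sub>F z in nhds x. norm (f z - f x) \<le> C * norm (z - x)"
proof -
  have "bounded_linear f'" using assms by (rule has_derivative_bounded_linear)
  then obtain B where B: "B > 0" "\<And>a. norm (f' a) \<le> norm a * B"
    using bounded_linear.pos_bounded by blast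
  have "\<forall>\<^sub>F z in nhds x. norm (f z - f x) \<le> (1 + B) * norm (z - x)"
    using has_derivative_eventually[OF assms zero_less_one]
  proof eventually_elim
    case (elim z)
    have "norm (f z - f x) \<le> norm (f z - f x - f' (z - x)) + norm (f' (z - x))"
      using norm_triangle_sub[of "f z - f x" "f' (z - x)"] by simp
    also have "\<dots> \<le> 1 * norm (z - x) + norm (z - x) * B" using elim B(2) by (rule add_mono)
    finally show ?case by (simp add: algebra_simps)
  qed
  then show ?thesis using B by (intro that[of "1 + B"]) auto
qed

lemma regular_subdiff_differentiable:
  fixes k :: "'a::euclidean_space \<Rightarrow> real"
  assumes k: "(k has_derivative (\<lambda>a. u \<bullet> a)) (at x)"
    and v: "v \<in> regular_subdiff (\<lambda>z. ereal (k z)) x"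
  shows "v = u"
proof (rule ccontr)
  assume "v \<noteq> u"
  then have n: "norm (v - u) > 0" by simp
  define \<epsilon> where "\<epsilon> = norm (v - u) / 4"
  have \<epsilon>: "\<epsilon> > 0" using n by (simp add: \<epsilon>_def)
  have "\<forall>\<^sub>F z in nhds x. (v - u) \<bullet> (z - x) \<le> 2 * \<epsilon> * norm (z - x)"
  proof -
    obtain a where a: "ereal (k x) = ereal a" and
      ev: "\<forall>\<^sub>F z in nhds x. ereal (a + v \<bullet> (z - x) - \<epsilon> * norm (z - x)) \<le> ereal (k z)"
      using v \<epsilon> by (elim regular_subdiffE) blast
    from has_derivative_eventually[OF k \<epsilon>] ev show ?thesis
    proof eventually_elim
      case (elim z)
      then have "a + v \<bullet> (z - x) - \<epsilon> * norm (z - x) \<le> k z" "k z - k x - u \<bullet> (z - x) \<le> \<epsilon> * norm (z - x)"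
        by auto
      then show ?case using a by (simp add: inner_simps)
    qed
  qed
  then obtain d where d: "d > 0" "\<And>z. dist z x < d \<Longrightarrow> (v - u) \<bullet> (z - x) \<le> 2 * \<epsilon> * norm (z - x)"
    unfolding eventually_nhds_metric by blast
  \<comment> \<open>the test direction \<open>v - u\<close>, scaled so that \<open>x + s (v - u)\<close> stays in the ball of radius \<open>d\<close>\<close>
  define s where "s = d / (2 * norm (v - u))"
  have s: "s > 0" "s * norm (v - u) < d" using d n by (auto simp: s_def)
  have "(v - u) \<bullet> (s *\<^sub>R (v - u)) \<le> 2 * \<epsilon> * norm (s *\<^sub>R (v - u))"
    using d(2)[of "x + s *\<^sub>R (v - u)"] s by (simp add: dist_norm)
  then have "s * (norm (v - u))\<^sup>2 \<le> s * (norm (v - u))\<^sup>2 / 2"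
    using s by (simp add: power2_norm_eq_inner[symmetric] \<epsilon>_def power2_eq_square)
  moreover have "s * (norm (v - u))\<^sup>2 > 0" using s n by simp
  ultimately show False by linarith
qed

lemma isCont_filterlim_nhds: "isCont f x \<Longrightarrow> filterlim f (nhds (f x)) (nhds x)"
  by (simp add: isCont_def tendsto_at_iff_tendsto_nhds)

text \<open>
  The first-order criterion for strong convexity: at a convex combination \<open>m\<close> of \<open>x\<close> and \<open>z\<close> the
  supporting inequalities towards \<open>x\<close> and \<open>z\<close> are averaged, and the linear terms cancel.
\<close>

lemma strongly_econvexI_growth:
  assumes S: "convex S"
    and grow: "\<And>x. x \<in> S \<Longrightarrow> \<exists>v a. h x = ereal a \<and>
      (\<forall>z\<in>S. ereal (a + v \<bullet> (z - x) + \<sigma> / 2 * (norm (z - x))\<^sup>2) \<le> h z)"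
  shows "strongly_econvex_on \<sigma> S h"
  unfolding strongly_econvex_on_def
proof (rule econvex_onI)
  fix x z a c t
  assume x: "x \<in> S" and z: "z \<in> S" and t: "0 \<le> t" "t \<le> (1::real)"
    and a: "h x - ereal (\<sigma> / 2 * (norm x)\<^sup>2) \<le> ereal a"
    and c: "h z - ereal (\<sigma> / 2 * (norm z)\<^sup>2) \<le> ereal c"
  define m where "m = (1 - t) *\<^sub>R x + t *\<^sub>R z"
  have m: "m \<in> S" using S x z t unfolding m_def convex_alt by blast
  then obtain v e where e: "h m = ereal e"
    and v: "\<And>z. z \<in> S \<Longrightarrow> ereal (e + v \<bullet> (z - m) + \<sigma> / 2 * (norm (z - m))\<^sup>2) \<le> h z"
    using grow by blast
  have bound: "e - \<sigma> / 2 * (norm m)\<^sup>2 + (v - \<sigma> *\<^sub>R m) \<bullet> (u - m) \<le> b"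
    if u: "u \<in> S" and b: "h u - ereal (\<sigma> / 2 * (norm u)\<^sup>2) \<le> ereal b" for u b
    using v[OF u] b unfolding half_norm_square_expand[of \<sigma> u m]
    by (cases "h u") (auto simp: inner_diff_left)
  have "(1 - t) * (e - \<sigma> / 2 * (norm m)\<^sup>2 + (v - \<sigma> *\<^sub>R m) \<bullet> (x - m)) +
      t * (e - \<sigma> / 2 * (norm m)\<^sup>2 + (v - \<sigma> *\<^sub>R m) \<bullet> (z - m)) \<le> (1 - t) * a + t * c"
    using bound[OF x a] bound[OF z c] t by (intro add_mono mult_left_mono) auto
  moreover have "(1 - t) * (K + P) + t * (K + Q) = K + ((1 - t) * P + t * Q)" for K P Q :: real
    by (simp add: algebra_simps)
  then have "(1 - t) * (e - \<sigma> / 2 * (norm m)\<^sup>2 + (v - \<sigma> *\<^sub>R m) \<bullet> (x - m)) +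
      t * (e - \<sigma> / 2 * (norm m)\<^sup>2 + (v - \<sigma> *\<^sub>R m) \<bullet> (z - m)) =
      e - \<sigma> / 2 * (norm m)\<^sup>2 + (v - \<sigma> *\<^sub>R m) \<bullet> ((1 - t) *\<^sub>R (x - m) + t *\<^sub>R (z - m))"
    unfolding inner_add_right inner_scaleR_right by blast
  moreover have "(1 - t) *\<^sub>R (x - m) + t *\<^sub>R (z - m) = 0" by (simp add: m_def algebra_simps)
  ultimately have "h m - ereal (\<sigma> / 2 * (norm m)\<^sup>2) \<le> ereal ((1 - t) * a + t * c)" by (simp add: e)
  with m show "(1 - t) *\<^sub>R x + t *\<^sub>R z \<in> S \<and>
      h ((1 - t) *\<^sub>R x + t *\<^sub>R z) - ereal (\<sigma> / 2 * (norm ((1 - t) *\<^sub>R x + t *\<^sub>R z))\<^sup>2)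
      \<le> ereal ((1 - t) * a + t * c)"
    unfolding m_def by simp
qed

section \<open>Subgradients of the perturbation function\<close>

text \<open>
  The pulled-back problem: \<open>U\<close> is the open set on which it is considered, \<open>F\<close> and \<open>G\<close> are the objective
  and the constraint map in tangent coordinates, and the last two assumptions are the KKT conditions.
\<close>

locale composite_problem =
  fixes U :: "'e::euclidean_space set"
    and F :: "'e \<Rightarrow> real" and F' :: "'e \<Rightarrow> 'e \<Rightarrow> real"
    and G :: "'e \<Rightarrow> 'y::euclidean_space" and G' :: "'e \<Rightarrow> 'e \<Rightarrow> 'y"
    and \<theta> :: "'y \<Rightarrow> ereal" and ybar :: 'y
  assumes open_U: "open U" and zero_U: "0 \<in> U"
    and F: "\<And>\<xi>. (F has_derivative F' \<xi>) (at \<xi>)" and F': "\<And>a. continuous_on UNIV (\<lambda>\<xi>. F' \<xi> a)"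
    and G: "\<And>\<xi>. (G has_derivative G' \<xi>) (at \<xi>)" and G': "\<And>a. continuous_on UNIV (\<lambda>\<xi>. G' \<xi> a)"
    and \<theta>_proper: "proper_fun \<theta>" and \<theta>_lsc: "lsc_fun \<theta>" and \<theta>_convex: "econvex_on UNIV \<theta>"
    and multiplier: "ybar \<in> subdiff \<theta> (G 0)"
    and stationary: "\<And>a. F' 0 a + ybar \<bullet> G' 0 a = 0"
begin

text \<open>
  The gradient of \<open>F + q \<bullet> G\<close>, written in coordinates so that its joint continuity in \<open>q\<close> and \<open>\<xi>\<close> is
  visible.
\<close>

definition lagrange_grad :: "'y \<Rightarrow> 'e \<Rightarrow> 'e" where
  "lagrange_grad q \<xi> = (\<Sum>i\<in>Basis. (F' \<xi> i + q \<bullet> G' \<xi> i) *\<^sub>R i)"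

lemma lagrange_grad_inner: "lagrange_grad q \<xi> \<bullet> a = F' \<xi> a + q \<bullet> G' \<xi> a"
proof -
  have lin: "linear (\<lambda>a. F' \<xi> a + q \<bullet> G' \<xi> a)"
    using has_derivative_linear[OF F[of \<xi>]] has_derivative_linear[OF G[of \<xi>]]
    by (intro linearI) (auto simp: linear_add linear_cmul inner_simps algebra_simps)
  have "F' \<xi> a + q \<bullet> G' \<xi> a = (\<lambda>a. F' \<xi> a + q \<bullet> G' \<xi> a) (\<Sum>i\<in>Basis. (a \<bullet> i) *\<^sub>R i)"
    by (simp add: euclidean_representation)
  also have "\<dots> = (\<Sum>i\<in>Basis. (a \<bullet> i) *\<^sub>R (F' \<xi> i + q \<bullet> G' \<xi> i))"
    unfolding linear_sum[OF lin] linear_cmul[OF lin] ..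
  also have "\<dots> = lagrange_grad q \<xi> \<bullet> a"
    by (simp add: lagrange_grad_def inner_sum_left mult.commute inner_commute[of a])
  finally show ?thesis by simp
qed

lemma lagrange_grad_derivative:
  "((\<lambda>\<xi>. F \<xi> + q \<bullet> G \<xi>) has_derivative (\<lambda>a. lagrange_grad q \<xi> \<bullet> a)) (at \<xi>)"
  unfolding lagrange_grad_inner by (intro derivative_intros F G)

lemma lagrange_grad_zero: "lagrange_grad ybar 0 = 0"
  using stationary by (simp add: lagrange_grad_def)

lemma tendsto_lagrange_grad:
  assumes "(q \<longlongrightarrow> q0) net" "(\<xi> \<longlongrightarrow> \<xi>0) net"
  shows "((\<lambda>n. lagrange_grad (q n) (\<xi> n)) \<longlongrightarrow> lagrange_grad q0 \<xi>0) net"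
proof -
  have "((\<lambda>n. F' (\<xi> n) i) \<longlongrightarrow> F' \<xi>0 i) net" "((\<lambda>n. G' (\<xi> n) i) \<longlongrightarrow> G' \<xi>0 i) net" for i
    using F'[of i] G'[of i] assms(2) continuous_on_tendsto_compose[of UNIV _ \<xi>] by auto
  then show ?thesis unfolding lagrange_grad_def by (intro tendsto_intros assms)
qed

lemma isCont_F: "isCont F \<xi>" and isCont_G: "isCont G \<xi>"
  using has_derivative_continuous[OF F] has_derivative_continuous[OF G] by auto

lemma tendsto_G: "(\<xi> \<longlongrightarrow> \<xi>0) net \<Longrightarrow> ((\<lambda>n. G (\<xi> n)) \<longlongrightarrow> G \<xi>0) net"
  by (rule isCont_tendsto_compose[OF isCont_G])

definition perturbed :: "real \<Rightarrow> 'e \<times> 'y \<Rightarrow> ereal" where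
  "perturbed \<rho> w = (if fst w \<in> U
     then ereal (F (fst w)) + \<theta> (G (fst w) + snd w) + ereal (\<rho> / 2 * (norm (snd w))\<^sup>2) else \<infinity>)"

text \<open>
  The optimality condition for \<open>b\<close> in the infimum \<open>inf\<^sub>b \<phi>(\<xi>, b) - y \<bullet> b\<close> that defines the augmented
  Lagrangian. Stated as a subgradient condition on \<open>\<theta>\<close>, it is stable under limits.
\<close>

definition shift_optimal :: "real \<Rightarrow> 'e \<Rightarrow> 'y \<Rightarrow> 'y \<Rightarrow> bool" where
  "shift_optimal \<rho> \<xi> y b \<longleftrightarrow> y - \<rho> *\<^sub>R b \<in> regular_subdiff \<theta> (G \<xi> + b)"

lemma \<theta>_not_MInf: "\<theta> u \<noteq> -\<infinity>"
  using \<theta>_proper by (simp add: proper_fun_def)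

lemma shift_optimal_finite:
  assumes "shift_optimal \<rho> \<xi> y b"
  obtains t where "\<theta> (G \<xi> + b) = ereal t"
  using assms unfolding shift_optimal_def by (rule regular_subdiffE)

lemma shift_optimal_center: "shift_optimal \<rho> 0 ybar 0"
  using multiplier by (simp add: shift_optimal_def subdiff_econvex[OF \<theta>_convex])

text \<open>
  The subgradient inequality of \<open>\<theta>\<close> at \<open>G \<xi> + b\<close> with subgradient \<open>y - \<rho> b\<close>, combined with the exact
  expansion of \<open>\<rho>/2 |b'|\<^sup>2\<close> around \<open>b\<close>. The right-hand side depends on \<open>\<xi>'\<close> only through the
  differentiable function \<open>F + (y - \<rho> b) \<bullet> G\<close>; this is why the first-order estimates below involve the
  derivatives of \<open>F\<close> and \<open>G\<close> alone, although \<open>\<theta>\<close> is nonsmooth.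
\<close>

lemma perturbed_lower:
  assumes \<xi>: "\<xi> \<in> U" and opt: "shift_optimal \<rho> \<xi> y b"
  shows "perturbed \<rho> (\<xi>, b) + ereal (F \<xi>' - F \<xi> + (y - \<rho> *\<^sub>R b) \<bullet> (G \<xi>' - G \<xi>) + y \<bullet> (b' - b) +
    \<rho> / 2 * (norm (b' - b))\<^sup>2) \<le> perturbed \<rho> (\<xi>', b')"
proof (cases "\<xi>' \<in> U")
  case True
  obtain t where t: "\<theta> (G \<xi> + b) = ereal t" using opt by (rule shift_optimal_finite)
  have "\<theta> (G \<xi> + b) + ereal ((y - \<rho> *\<^sub>R b) \<bullet> (G \<xi>' + b' - (G \<xi> + b))) \<le> \<theta> (G \<xi>' + b')"
    by (rule econvex_regular_subgradient[OF \<theta>_convex opt[unfolded shift_optimal_def]]) auto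
  then show ?thesis
    unfolding perturbed_def fst_conv snd_conv half_norm_square_expand[of \<rho> b' b] t
    using True \<xi> \<theta>_not_MInf by (cases "\<theta> (G \<xi>' + b')") (auto simp: inner_simps)
qed (simp add: perturbed_def)

lemma perturbed_finite:
  assumes "\<xi> \<in> U" "shift_optimal \<rho> \<xi> y b"
  obtains p where "perturbed \<rho> (\<xi>, b) = ereal p"
  using assms by (auto simp: perturbed_def elim!: shift_optimal_finite)

lemma shift_optimal_imp_regular_subgradient:
  assumes \<xi>: "\<xi> \<in> U" and opt: "shift_optimal \<rho> \<xi> y b" and \<rho>: "\<rho> \<ge> 0"
  shows "(lagrange_grad (y - \<rho> *\<^sub>R b) \<xi>, y) \<in> regular_subdiff (perturbed \<rho>) (\<xi>, b)"
proof -
  let ?q = "y - \<rho> *\<^sub>R b"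
  obtain p where p: "perturbed \<rho> (\<xi>, b) = ereal p" using \<xi> opt by (rule perturbed_finite)
  show ?thesis
  proof (rule regular_subdiffI[where h = "perturbed \<rho>" and a = p, OF p])
    fix \<epsilon> :: real assume \<epsilon>: "\<epsilon> > 0"
    have "filterlim fst (nhds \<xi>) (nhds (\<xi>, b))"
      using isCont_filterlim_nhds[where f = fst and x = "(\<xi>, b)"] by (simp add: continuous_intros)
    from eventually_compose_filterlim[OF has_derivative_eventually[OF lagrange_grad_derivative \<epsilon>] this]
    show "\<forall>\<^sub>F w in nhds (\<xi>, b). ereal (p + (lagrange_grad ?q \<xi>, y) \<bullet> (w - (\<xi>, b)) -
        \<epsilon> * norm (w - (\<xi>, b))) \<le> perturbed \<rho> w"
    proof (rule eventually_mono)
      fix w :: "'e \<times> 'y"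
      assume *: "norm (F (fst w) + ?q \<bullet> G (fst w) - (F \<xi> + ?q \<bullet> G \<xi>) - lagrange_grad ?q \<xi> \<bullet> (fst w - \<xi>))
         \<le> \<epsilon> * norm (fst w - \<xi>)"
      have "norm (fst w - \<xi>) \<le> norm (w - (\<xi>, b))"
        using norm_fst_le[of "fst w - \<xi>" "snd w - b"] by (cases w) simp
      then have "\<epsilon> * norm (fst w - \<xi>) \<le> \<epsilon> * norm (w - (\<xi>, b))" using \<epsilon> by simp
      with * have "lagrange_grad ?q \<xi> \<bullet> (fst w - \<xi>) - \<epsilon> * norm (w - (\<xi>, b)) \<le>
          F (fst w) - F \<xi> + ?q \<bullet> (G (fst w) - G \<xi>)"
        unfolding inner_diff_right[of ?q] by simp
      moreover have "\<rho> / 2 * (norm (snd w - b))\<^sup>2 \<ge> 0" using \<rho> by simp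
      ultimately have "ereal (p + (lagrange_grad ?q \<xi>, y) \<bullet> (w - (\<xi>, b)) - \<epsilon> * norm (w - (\<xi>, b)))
         \<le> ereal (p + (F (fst w) - F \<xi> + ?q \<bullet> (G (fst w) - G \<xi>) + y \<bullet> (snd w - b) +
            \<rho> / 2 * (norm (snd w - b))\<^sup>2))"
        by (cases w) simp
      also have "\<dots> \<le> perturbed \<rho> w"
        using perturbed_lower[OF \<xi> opt, of "fst w" "snd w"] p by simp
      finally show "ereal (p + (lagrange_grad ?q \<xi>, y) \<bullet> (w - (\<xi>, b)) -
        \<epsilon> * norm (w - (\<xi>, b))) \<le> perturbed \<rho> w" .
    qed
  qed
qed

text \<open>
  The subgradient inequality is tested along two families of points. Moving \<open>b\<close> alone leaves
  \<open>\<theta>\<close> and the penalty, and gives optimality of the shift. Moving \<open>\<xi>\<close> while keeping \<open>G \<xi> + b\<close> fixed makes the term with \<open>\<theta>\<close>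
  constant, so that only a differentiable function of \<open>\<xi>\<close> remains and \<open>v\<close> must be its gradient.
\<close>

lemma regular_subgradient_imp_shift_optimal:
  assumes \<xi>: "\<xi> \<in> U" and v: "(v, y) \<in> regular_subdiff (perturbed \<rho>) (\<xi>, b)"
  shows "shift_optimal \<rho> \<xi> y b \<and> v = lagrange_grad (y - \<rho> *\<^sub>R b) \<xi>"
proof
  let ?q = "y - \<rho> *\<^sub>R b"
  obtain p where p: "perturbed \<rho> (\<xi>, b) = ereal p" and
    reg: "\<And>\<epsilon>. \<epsilon> > 0 \<Longrightarrow> \<forall>\<^sub>F w in nhds (\<xi>, b).
      ereal (p + (v, y) \<bullet> (w - (\<xi>, b)) - \<epsilon> * norm (w - (\<xi>, b))) \<le> perturbed \<rho> w"
    using v by (rule regular_subdiffE) blast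
  obtain t where t: "\<theta> (G \<xi> + b) = ereal t"
    using p \<xi> by (cases "\<theta> (G \<xi> + b)") (auto simp: perturbed_def)
  have p_eq: "p = F \<xi> + t + \<rho> / 2 * (norm b)\<^sup>2" using p \<xi> by (simp add: perturbed_def t)
  have "y \<in> regular_subdiff (\<lambda>b'. perturbed \<rho> (\<xi>, b')) b"
  proof (rule regular_subdiffI[where h = "\<lambda>b'. perturbed \<rho> (\<xi>, b')" and a = p, OF p])
    fix \<epsilon> :: real assume "\<epsilon> > 0"
    have "filterlim (\<lambda>b'. (\<xi>, b')) (nhds (\<xi>, b)) (nhds b)"
      by (intro isCont_filterlim_nhds continuous_intros)
    from eventually_compose_filterlim[OF reg[OF \<open>\<epsilon> > 0\<close>] this]
    show "\<forall>\<^sub>F b' in nhds b. ereal (p + y \<bullet> (b' - b) - \<epsilon> * norm (b' - b)) \<le> perturbed \<rho> (\<xi>, b')"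
      by (simp add: norm_Pair)
  qed
  from regular_subdiff_diff_quadratic[OF this, of \<rho>]
  have "?q \<in> regular_subdiff (\<lambda>b'. perturbed \<rho> (\<xi>, b') - ereal (\<rho> / 2 * (norm b')\<^sup>2)) b" .
  then obtain a where a: "perturbed \<rho> (\<xi>, b) - ereal (\<rho> / 2 * (norm b)\<^sup>2) = ereal a" and
    sub: "\<And>\<epsilon>. \<epsilon> > 0 \<Longrightarrow> \<forall>\<^sub>F b' in nhds b. ereal (a + ?q \<bullet> (b' - b) - \<epsilon> * norm (b' - b)) \<le>
      perturbed \<rho> (\<xi>, b') - ereal (\<rho> / 2 * (norm b')\<^sup>2)"
    by (rule regular_subdiffE) blast
  have a_eq: "a = F \<xi> + t" using a by (simp add: p p_eq)
  show "shift_optimal \<rho> \<xi> y b"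
    unfolding shift_optimal_def
  proof (rule regular_subdiffI[where h = \<theta> and a = t, OF t])
    fix \<epsilon> :: real assume "\<epsilon> > 0"
    have "filterlim (\<lambda>u. u - G \<xi>) (nhds b) (nhds (G \<xi> + b))"
      using isCont_filterlim_nhds[where f = "\<lambda>u. u - G \<xi>" and x = "G \<xi> + b"] by (simp add: continuous_intros)
    from eventually_compose_filterlim[OF sub[OF \<open>\<epsilon> > 0\<close>] this]
    show "\<forall>\<^sub>F u in nhds (G \<xi> + b). ereal (t + ?q \<bullet> (u - (G \<xi> + b)) - \<epsilon> * norm (u - (G \<xi> + b))) \<le> \<theta> u"
    proof (rule eventually_mono)
      fix u assume "ereal (a + ?q \<bullet> (u - G \<xi> - b) - \<epsilon> * norm (u - G \<xi> - b))
        \<le> perturbed \<rho> (\<xi>, u - G \<xi>) - ereal (\<rho> / 2 * (norm (u - G \<xi>))\<^sup>2)"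
      then show "ereal (t + ?q \<bullet> (u - (G \<xi> + b)) - \<epsilon> * norm (u - (G \<xi> + b))) \<le> \<theta> u"
        using \<xi> \<theta>_not_MInf[of u] unfolding diff_diff_eq
        by (cases "\<theta> u") (auto simp: perturbed_def a_eq)
    qed
  qed
  define k where "k \<xi>' = F \<xi>' + \<rho> / 2 * ((b + G \<xi> - G \<xi>') \<bullet> (b + G \<xi> - G \<xi>')) + y \<bullet> G \<xi>'" for \<xi>'
  have "(k has_derivative (\<lambda>a. F' \<xi> a + \<rho> / 2 * (b \<bullet> (- G' \<xi> a) + (- G' \<xi> a) \<bullet> b) + y \<bullet> G' \<xi> a)) (at \<xi>)"
    unfolding k_def by (rule derivative_eq_intros F G | simp)+
  also have "(\<lambda>a. F' \<xi> a + \<rho> / 2 * (b \<bullet> (- G' \<xi> a) + (- G' \<xi> a) \<bullet> b) + y \<bullet> G' \<xi> a) =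
      (\<lambda>a. lagrange_grad ?q \<xi> \<bullet> a)"
    unfolding lagrange_grad_inner by (auto simp: inner_simps inner_commute algebra_simps)
  finally have k: "(k has_derivative (\<lambda>a. lagrange_grad ?q \<xi> \<bullet> a)) (at \<xi>)" .
  obtain C where C: "C \<ge> 0" "\<forall>\<^sub>F z in nhds \<xi>. norm (G z - G \<xi>) \<le> C * norm (z - \<xi>)"
    using G by (rule has_derivative_eventually_lipschitz)
  have "v \<in> regular_subdiff (\<lambda>z. ereal (k z)) \<xi>"
  proof (rule regular_subdiffI)
    show "ereal (k \<xi>) = ereal (k \<xi>)" ..
    fix \<epsilon> :: real assume \<epsilon>: "\<epsilon> > 0"
    let ?c = "\<lambda>z. (z, b + G \<xi> - G z)"
    have lim: "filterlim ?c (nhds (\<xi>, b)) (nhds \<xi>)"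
      using isCont_filterlim_nhds[where f = ?c and x = \<xi>] by (simp add: continuous_intros isCont_G)
    have "\<epsilon> / (1 + C) > 0" using \<epsilon> C by simp
    from eventually_compose_filterlim[OF reg[OF this] lim] C(2) eventually_nhds_in_open[OF open_U \<xi>]
    show "\<forall>\<^sub>F z in nhds \<xi>. ereal (k \<xi> + v \<bullet> (z - \<xi>) - \<epsilon> * norm (z - \<xi>)) \<le> ereal (k z)"
    proof eventually_elim
      case (elim z)
      have "norm (?c z - (\<xi>, b)) \<le> norm (z - \<xi>) + norm (G z - G \<xi>)"
        using norm_Pair_le[of "z - \<xi>" "G \<xi> - G z"] by (simp add: norm_minus_commute)
      also have "\<dots> \<le> (1 + C) * norm (z - \<xi>)" using elim(2) by (simp add: algebra_simps)
      finally have "\<epsilon> / (1 + C) * norm (?c z - (\<xi>, b)) \<le> \<epsilon> / (1 + C) * ((1 + C) * norm (z - \<xi>))"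
        using \<epsilon> C by (intro mult_left_mono) auto
      then have "\<epsilon> / (1 + C) * norm (?c z - (\<xi>, b)) \<le> \<epsilon> * norm (z - \<xi>)" using C by simp
      moreover have "perturbed \<rho> (?c z) = ereal (F z + t + \<rho> / 2 * (norm (b + G \<xi> - G z))\<^sup>2)"
        using elim(3) t by (simp add: perturbed_def add.commute)
      then have "p + (v, y) \<bullet> (?c z - (\<xi>, b)) - \<epsilon> / (1 + C) * norm (?c z - (\<xi>, b)) \<le>
         F z + t + \<rho> / 2 * (norm (b + G \<xi> - G z))\<^sup>2"
        using elim(1) by (simp only: ereal_less_eq)
      ultimately have "p + (v, y) \<bullet> (?c z - (\<xi>, b)) - \<epsilon> * norm (z - \<xi>) \<le>
         F z + t + \<rho> / 2 * (norm (b + G \<xi> - G z))\<^sup>2" by linarith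
      then show ?case
        unfolding k_def p_eq power2_norm_eq_inner by (simp add: inner_diff_right[of y] inner_add_right[of y])
    qed
  qed
  then show "v = lagrange_grad ?q \<xi>" by (rule regular_subdiff_differentiable[OF k])
qed

text \<open>
  To pass to the limit in the subgradient inequality, lower semicontinuity allows the values of \<open>\<theta>\<close>
  along the sequence to be replaced by an arbitrary \<open>c\<close> below the value at the limit.
\<close>

lemma shift_optimal_closed:
  assumes \<xi>: "\<xi> \<longlonglongrightarrow> \<xi>0" and y: "y \<longlonglongrightarrow> y0" and b: "b \<longlonglongrightarrow> b0"
    and opt: "\<forall>\<^sub>F n in sequentially. shift_optimal \<rho> (\<xi> n) (y n) (b n)"
    and fin: "\<theta> (G \<xi>0 + b0) = ereal t"
  shows "shift_optimal \<rho> \<xi>0 y0 b0"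
  unfolding shift_optimal_def
proof (rule regular_subdiffI_affine[where h = \<theta> and a = t, OF fin], rule always_eventually, rule allI)
  fix u
  have lim: "(\<lambda>n. G (\<xi> n) + b n) \<longlonglongrightarrow> G \<xi>0 + b0" by (intro tendsto_intros tendsto_G \<xi> b)
  have le: "t + (y0 - \<rho> *\<^sub>R b0) \<bullet> (u - (G \<xi>0 + b0)) \<le> e" if e: "\<theta> u = ereal e" for e
  proof -
    have "c \<le> e - (y0 - \<rho> *\<^sub>R b0) \<bullet> (u - (G \<xi>0 + b0))" if c: "c < t" for c
    proof (rule tendsto_lowerbound)
      show "(\<lambda>n. e - (y n - \<rho> *\<^sub>R b n) \<bullet> (u - (G (\<xi> n) + b n))) \<longlonglongrightarrow>
          e - (y0 - \<rho> *\<^sub>R b0) \<bullet> (u - (G \<xi>0 + b0))"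
        by (intro tendsto_intros y b lim)
      have "\<forall>\<^sub>F z in nhds (G \<xi>0 + b0). ereal c < \<theta> z"
        using lsc_fun_imp_lsc_at[OF \<theta>_lsc, of "G \<xi>0 + b0"] c fin by (simp add: lsc_at_def)
      from eventually_compose_filterlim[OF this lim] opt
      show "\<forall>\<^sub>F n in sequentially. c \<le> e - (y n - \<rho> *\<^sub>R b n) \<bullet> (u - (G (\<xi> n) + b n))"
      proof eventually_elim
        case (elim n)
        obtain s where s: "\<theta> (G (\<xi> n) + b n) = ereal s" using elim(2) by (rule shift_optimal_finite)
        have "\<theta> (G (\<xi> n) + b n) + ereal ((y n - \<rho> *\<^sub>R b n) \<bullet> (u - (G (\<xi> n) + b n))) \<le> \<theta> u"
          by (rule econvex_regular_subgradient[OF \<theta>_convex elim(2)[unfolded shift_optimal_def]]) auto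
        then show ?case using elim(1) by (simp add: s e)
      qed
    qed simp
    then have "t \<le> e - (y0 - \<rho> *\<^sub>R b0) \<bullet> (u - (G \<xi>0 + b0))" by (rule dense_le)
    then show ?thesis by simp
  qed
  show "ereal (t + (y0 - \<rho> *\<^sub>R b0) \<bullet> (u - (G \<xi>0 + b0))) \<le> \<theta> u"
    using \<theta>_not_MInf[of u] le by (cases "\<theta> u") auto
qed

text \<open>
  Inside \<open>U\<close> every limiting subgradient is regular, since the explicit description of the regular
  ones is closed under limits.
\<close>

theorem subdiff_perturbed:
  assumes \<xi>: "\<xi> \<in> U" and \<rho>: "\<rho> \<ge> 0"
  shows "(v, y) \<in> subdiff (perturbed \<rho>) (\<xi>, b) \<longleftrightarrow>
    shift_optimal \<rho> \<xi> y b \<and> v = lagrange_grad (y - \<rho> *\<^sub>R b) \<xi>"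
proof
  assume "shift_optimal \<rho> \<xi> y b \<and> v = lagrange_grad (y - \<rho> *\<^sub>R b) \<xi>"
  then show "(v, y) \<in> subdiff (perturbed \<rho>) (\<xi>, b)"
    using shift_optimal_imp_regular_subgradient[OF \<xi> _ \<rho>] regular_subdiff_subset by blast
next
  assume sub: "(v, y) \<in> subdiff (perturbed \<rho>) (\<xi>, b)"
  then obtain X V where X: "X \<longlonglongrightarrow> (\<xi>, b)" and V: "V \<longlonglongrightarrow> (v, y)"
    and reg: "\<And>n. V n \<in> regular_subdiff (perturbed \<rho>) (X n)" by (auto simp: subdiff_def)
  have lim: "(\<lambda>n. fst (X n)) \<longlonglongrightarrow> \<xi>" "(\<lambda>n. snd (X n)) \<longlonglongrightarrow> b"
    "(\<lambda>n. fst (V n)) \<longlonglongrightarrow> v" "(\<lambda>n. snd (V n)) \<longlonglongrightarrow> y"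
    using tendsto_fst[OF X] tendsto_snd[OF X] tendsto_fst[OF V] tendsto_snd[OF V] by simp_all
  have "\<forall>\<^sub>F n in sequentially. fst (X n) \<in> U"
    using lim(1) open_U \<xi> by (rule topological_tendstoD)
  then have ev: "\<forall>\<^sub>F n in sequentially. shift_optimal \<rho> (fst (X n)) (snd (V n)) (snd (X n)) \<and>
      fst (V n) = lagrange_grad (snd (V n) - \<rho> *\<^sub>R snd (X n)) (fst (X n))"
    by eventually_elim (use regular_subgradient_imp_shift_optimal reg in \<open>metis prod.collapse\<close>)
  obtain t where "\<theta> (G \<xi> + b) = ereal t"
    using sub \<xi> by (cases "\<theta> (G \<xi> + b)") (auto simp: subdiff_def perturbed_def)
  then have "shift_optimal \<rho> \<xi> y b"
    by (rule shift_optimal_closed[OF lim(1,4,2), rotated]) (use ev in \<open>auto elim: eventually_mono\<close>)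
  moreover have "(\<lambda>n. lagrange_grad (snd (V n) - \<rho> *\<^sub>R snd (X n)) (fst (X n)))
      \<longlonglongrightarrow> lagrange_grad (y - \<rho> *\<^sub>R b) \<xi>"
    by (intro tendsto_lagrange_grad tendsto_intros lim)
  then have "(\<lambda>n. fst (V n)) \<longlonglongrightarrow> lagrange_grad (y - \<rho> *\<^sub>R b) \<xi>"
    by (rule Lim_transform_eventually) (use ev in \<open>auto elim: eventually_mono\<close>)
  then have "v = lagrange_grad (y - \<rho> *\<^sub>R b) \<xi>" using lim(3) LIMSEQ_unique by blast
  ultimately show "shift_optimal \<rho> \<xi> y b \<and> v = lagrange_grad (y - \<rho> *\<^sub>R b) \<xi>" ..
qed

lemma center_subgradient: "\<rho> \<ge> 0 \<Longrightarrow> (0, ybar) \<in> subdiff (perturbed \<rho>) (0, 0)"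
  using shift_optimal_center lagrange_grad_zero by (simp add: subdiff_perturbed[OF zero_U])

lemma lsc_at_perturbed:
  assumes "\<xi> \<in> U"
  shows "lsc_at (perturbed \<rho>) (\<xi>, b)"
proof -
  have cF: "isCont (\<lambda>w::'e \<times> 'y. F (fst w)) (\<xi>, b)" and cG: "isCont (\<lambda>w::'e \<times> 'y. G (fst w)) (\<xi>, b)"
    by (auto intro!: isCont_F isCont_G isCont_o2[of _ fst] continuous_intros)
  have "lsc_at (\<lambda>w. \<theta> (G (fst w) + snd w)) (\<xi>, b)"
    unfolding lsc_at_def
  proof (intro allI impI)
    fix c assume "ereal c < \<theta> (G (fst (\<xi>, b)) + snd (\<xi>, b))"
    then have "\<forall>\<^sub>F u in nhds (G \<xi> + b). ereal c < \<theta> u"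
      using lsc_fun_imp_lsc_at[OF \<theta>_lsc] by (simp add: lsc_at_def)
    moreover have "filterlim (\<lambda>w. G (fst w) + snd w) (nhds (G \<xi> + b)) (nhds (\<xi>, b))"
      using isCont_filterlim_nhds[where f = "\<lambda>w. G (fst w) + snd w" and x = "(\<xi>, b)"]
      by (simp add: continuous_intros cG)
    ultimately show "\<forall>\<^sub>F w in nhds (\<xi>, b). ereal c < \<theta> (G (fst w) + snd w)"
      by (rule eventually_compose_filterlim)
  qed
  then have lsc: "lsc_at (\<lambda>w. \<theta> (G (fst w) + snd w) + ereal (F (fst w) + \<rho> / 2 * (norm (snd w))\<^sup>2)) (\<xi>, b)"
    by (rule lsc_at_add_continuous) (intro continuous_intros cF)
  have eq: "perturbed \<rho> w = \<theta> (G (fst w) + snd w) + ereal (F (fst w) + \<rho> / 2 * (norm (snd w))\<^sup>2)"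
    if "fst w \<in> U" for w
    using that by (cases "\<theta> (G (fst w) + snd w)") (auto simp: perturbed_def)
  have "\<forall>\<^sub>F w in nhds (\<xi>, b). w \<in> U \<times> UNIV"
    using assms by (intro eventually_nhds_in_open open_Times open_U) auto
  then have ev: "\<forall>\<^sub>F w in nhds (\<xi>, b). perturbed \<rho> w =
      \<theta> (G (fst w) + snd w) + ereal (F (fst w) + \<rho> / 2 * (norm (snd w))\<^sup>2)"
    by eventually_elim (auto simp: eq)
  show ?thesis
    unfolding lsc_at_def
  proof (intro allI impI)
    fix c assume "ereal c < perturbed \<rho> (\<xi>, b)"
    then have "\<forall>\<^sub>F w in nhds (\<xi>, b).
        ereal c < \<theta> (G (fst w) + snd w) + ereal (F (fst w) + \<rho> / 2 * (norm (snd w))\<^sup>2)"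
      using lsc assms by (simp add: lsc_at_def eq)
    with ev show "\<forall>\<^sub>F w in nhds (\<xi>, b). ereal c < perturbed \<rho> w"
      by eventually_elim simp
  qed
qed

lemma lsc_near_center: "\<forall>\<^sub>F w in nhds (0, 0). lsc_at (perturbed \<rho>) w"
proof -
  have "\<forall>\<^sub>F w in nhds (0::'e, 0::'y). w \<in> U \<times> UNIV"
    using zero_U by (intro eventually_nhds_in_open open_Times open_U) auto
  then show ?thesis by eventually_elim (auto intro: lsc_at_perturbed)
qed

section \<open>The augmented Lagrangian and its minimizing shift\<close>

text \<open>
  The minimizing shift is a proximal point of \<open>\<theta>\<close> with centre \<open>s = G \<xi> + y/\<rho>\<close>. The affine minorant of
  \<open>\<theta>\<close> given by the multiplier makes the proximal problem coercive: outside the ball of radius \<open>D\<close>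
  around \<open>s\<close> its objective is at least its value at \<open>G 0\<close>.
\<close>

lemma shift_optimal_exists:
  assumes \<rho>: "\<rho> > 0"
  shows "\<exists>b. shift_optimal \<rho> \<xi> y b"
proof -
  define s where "s = G \<xi> + y /\<^sub>R \<rho>"
  define k where "k u = \<theta> u + ereal (\<rho> / 2 * (norm (u - s))\<^sup>2)" for u
  define D where "D = norm (G 0 - s) + 2 * norm ybar / \<rho>"
  have D: "D \<ge> norm (G 0 - s)" using \<rho> by (simp add: D_def)
  have sub: "ybar \<in> regular_subdiff \<theta> (G 0)" using multiplier by (simp add: subdiff_econvex[OF \<theta>_convex])
  then obtain t0 where t0: "\<theta> (G 0) = ereal t0" by (rule regular_subdiffE)
  have "\<exists>p\<in>cball s D. \<forall>u\<in>cball s D. k p \<le> k u"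
  proof (rule lsc_at_attains_min)
    show "cball s D \<noteq> {}" using D norm_ge_zero[of "G 0 - s"] by (simp del: norm_ge_zero)
    show "lsc_at k u" for u unfolding k_def
      by (rule lsc_at_add_continuous[OF lsc_fun_imp_lsc_at[OF \<theta>_lsc]]) (intro continuous_intros)
  qed simp
  then obtain p where p: "\<And>u. u \<in> cball s D \<Longrightarrow> k p \<le> k u" by blast
  have p0: "k p \<le> k (G 0)" using D by (intro p) (simp add: dist_norm norm_minus_commute)
  have far: "k (G 0) \<le> k u" if "u \<notin> cball s D" for u
  proof -
    let ?d = "norm (u - s)" and ?e = "norm (G 0 - s)"
    have d: "?d > D" using that by (simp add: dist_norm norm_minus_commute)
    have "\<theta> (G 0) + ereal (ybar \<bullet> (u - G 0)) \<le> \<theta> u"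
      by (rule econvex_regular_subgradient[OF \<theta>_convex sub]) auto
    moreover have "t0 + \<rho> / 2 * ?e\<^sup>2 \<le> t0 + ybar \<bullet> (u - G 0) + \<rho> / 2 * ?d\<^sup>2"
    proof -
      have "- (ybar \<bullet> (u - G 0)) \<le> norm ybar * norm (u - G 0)"
        using norm_cauchy_schwarz[of "- ybar" "u - G 0"] by simp
      also have "\<dots> \<le> norm ybar * (?d + ?e)"
        using norm_triangle_ineq4[of "u - s" "G 0 - s"] by (intro mult_left_mono) auto
      also have "\<dots> \<le> \<rho> / 2 * (?d - ?e) * (?d + ?e)"
      proof (rule mult_right_mono)
        have "2 * norm ybar / \<rho> \<le> ?d - ?e" using d by (simp add: D_def)
        then show "norm ybar \<le> \<rho> / 2 * (?d - ?e)" using \<rho> by (simp add: field_simps)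
      qed simp
      also have "\<dots> = \<rho> / 2 * ?d\<^sup>2 - \<rho> / 2 * ?e\<^sup>2"
        by (simp add: power2_eq_square field_simps)
      finally show ?thesis by linarith
    qed
    ultimately show ?thesis by (cases "\<theta> u") (auto simp: k_def t0)
  qed
  have min: "k p \<le> k u" for u
    using p[of u] far[of u] p0 order_trans by (cases "u \<in> cball s D") blast+
  obtain t where t: "\<theta> p = ereal t"
    using p0 \<theta>_not_MInf[of p] by (cases "\<theta> p") (auto simp: k_def t0)
  have "\<rho> *\<^sub>R (s - p) \<in> regular_subdiff \<theta> p"
    by (rule proximal_point_regular_subgradient[where h = \<theta> and a = t, OF t]) (use min in \<open>auto simp: k_def\<close>)
  moreover have "\<rho> *\<^sub>R (s - p) = y - \<rho> *\<^sub>R (p - G \<xi>)" using \<rho> by (simp add: s_def algebra_simps)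
  ultimately have "shift_optimal \<rho> \<xi> y (p - G \<xi>)" by (simp add: shift_optimal_def)
  then show ?thesis ..
qed

text \<open>
  Nonexpansiveness of the proximal map \<open>s \<mapsto> p\<close>, from monotonicity of the subgradients \<open>\<rho> (s - p)\<close>,
  where \<open>p = G \<xi> + b\<close> and \<open>s = G \<xi> + y/\<rho>\<close>.
\<close>

lemma shift_optimal_lipschitz:
  assumes \<rho>: "\<rho> > 0" and opt: "shift_optimal \<rho> \<xi> y b" "shift_optimal \<rho> \<xi>' y' b'"
  shows "norm (b' - b) \<le> 2 * norm (G \<xi>' - G \<xi>) + norm (y' - y) / \<rho>"
proof -
  define p s where "p = G \<xi>' + b' - (G \<xi> + b)" and "s = (G \<xi>' - G \<xi>) + (y' - y) /\<^sub>R \<rho>"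
  have "(y' - \<rho> *\<^sub>R b' - (y - \<rho> *\<^sub>R b)) \<bullet> p \<ge> 0"
    unfolding p_def using opt by (intro convex_subgradients_monotone[OF \<theta>_convex]) (auto simp: shift_optimal_def)
  moreover have "y' - \<rho> *\<^sub>R b' - (y - \<rho> *\<^sub>R b) = \<rho> *\<^sub>R (s - p)"
    using \<rho> by (simp add: s_def p_def algebra_simps)
  ultimately have "p \<bullet> p \<le> s \<bullet> p" using \<rho> by (simp add: inner_diff_left zero_le_mult_iff)
  also have "\<dots> \<le> norm s * norm p" by (rule norm_cauchy_schwarz)
  finally have "norm p * norm p \<le> norm s * norm p" by (simp add: power2_norm_eq_inner flip: power2_eq_square)
  then have "norm p \<le> norm s" by (cases "p = 0") auto
  also have "\<dots> \<le> norm (G \<xi>' - G \<xi>) + norm (y' - y) / \<rho>"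
    unfolding s_def using \<rho> norm_triangle_ineq[of "G \<xi>' - G \<xi>" "(y' - y) /\<^sub>R \<rho>"] by (simp add: divide_inverse_commute)
  finally have "norm p \<le> norm (G \<xi>' - G \<xi>) + norm (y' - y) / \<rho>" .
  moreover have "norm (b' - b) \<le> norm p + norm (G \<xi>' - G \<xi>)"
    using norm_triangle_ineq4[of p "G \<xi>' - G \<xi>"] by (simp add: p_def algebra_simps)
  ultimately show ?thesis by linarith
qed

definition lagrangian :: "real \<Rightarrow> 'e \<Rightarrow> 'y \<Rightarrow> ereal" where
  "lagrangian \<rho> \<xi> y = (INF b. perturbed \<rho> (\<xi>, b) - ereal (y \<bullet> b))"

lemma lagrangian_le: "lagrangian \<rho> \<xi> y \<le> perturbed \<rho> (\<xi>, b) - ereal (y \<bullet> b)"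
  unfolding lagrangian_def by (rule INF_lower) simp

lemma lagrangian_lower:
  assumes "\<xi> \<in> U" "shift_optimal \<rho> \<xi> y b" "\<rho> > 0"
  shows "perturbed \<rho> (\<xi>, b) + ereal (F \<xi>' - F \<xi> + (y - \<rho> *\<^sub>R b) \<bullet> (G \<xi>' - G \<xi>) - y \<bullet> b)
    \<le> lagrangian \<rho> \<xi>' y"
  unfolding lagrangian_def
proof (rule INF_greatest)
  fix b'
  obtain p where p: "perturbed \<rho> (\<xi>, b) = ereal p" using assms(1,2) by (rule perturbed_finite)
  let ?r = "F \<xi>' - F \<xi> + (y - \<rho> *\<^sub>R b) \<bullet> (G \<xi>' - G \<xi>)"
  have "ereal (p + (?r + y \<bullet> (b' - b) + \<rho> / 2 * (norm (b' - b))\<^sup>2)) \<le> perturbed \<rho> (\<xi>', b')"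
    using perturbed_lower[OF assms(1,2), of \<xi>' b'] by (simp add: p)
  moreover have "p + (?r + y \<bullet> (b' - b)) \<le> p + (?r + y \<bullet> (b' - b) + \<rho> / 2 * (norm (b' - b))\<^sup>2)"
    using assms(3) by simp
  ultimately have "ereal (p + (?r + y \<bullet> (b' - b))) \<le> perturbed \<rho> (\<xi>', b')"
    by (meson ereal_less_eq(3) order_trans)
  then show "perturbed \<rho> (\<xi>, b) + ereal (?r - y \<bullet> b) \<le> perturbed \<rho> (\<xi>', b') - ereal (y \<bullet> b')"
    by (cases "perturbed \<rho> (\<xi>', b')") (auto simp: p inner_diff_right[of y])
qed

lemma lagrangian_eq:
  assumes "\<xi> \<in> U" "shift_optimal \<rho> \<xi> y b" "\<rho> > 0"
  shows "lagrangian \<rho> \<xi> y = perturbed \<rho> (\<xi>, b) - ereal (y \<bullet> b)"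
proof (rule antisym[OF lagrangian_le])
  obtain p where p: "perturbed \<rho> (\<xi>, b) = ereal p" using assms(1,2) by (rule perturbed_finite)
  show "perturbed \<rho> (\<xi>, b) - ereal (y \<bullet> b) \<le> lagrangian \<rho> \<xi> y"
    using lagrangian_lower[OF assms, of \<xi>] by (simp add: p)
qed

lemma lagrangian_growth:
  assumes "\<xi> \<in> U" "shift_optimal \<rho> \<xi> y b" "\<rho> > 0"
  shows "lagrangian \<rho> \<xi> y + ereal (y \<bullet> b' + \<rho> / 2 * (norm (b' - b))\<^sup>2) \<le> perturbed \<rho> (\<xi>, b')"
proof -
  obtain p where p: "perturbed \<rho> (\<xi>, b) = ereal p" using assms(1,2) by (rule perturbed_finite)
  show ?thesis
    using perturbed_lower[OF assms(1,2), of \<xi> b'] unfolding lagrangian_eq[OF assms]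
    by (simp add: p inner_diff_right[of y] add_diff_eq diff_add_eq)
qed

text \<open>
  By the lower bound above the Lagrangian dominates, with equality at \<open>\<xi>\<close>, a constant plus the
  differentiable function \<open>F + (y - \<rho> b) \<bullet> G\<close>.
\<close>

lemma lagrangian_regular_subgradient:
  assumes \<xi>: "\<xi> \<in> U" and opt: "shift_optimal \<rho> \<xi> y b" and \<rho>: "\<rho> > 0"
  shows "lagrange_grad (y - \<rho> *\<^sub>R b) \<xi> \<in> regular_subdiff (\<lambda>\<xi>. lagrangian \<rho> \<xi> y) \<xi>"
proof -
  let ?q = "y - \<rho> *\<^sub>R b"
  obtain p where p: "perturbed \<rho> (\<xi>, b) = ereal p" using \<xi> opt by (rule perturbed_finite)
  have l: "lagrangian \<rho> \<xi> y = ereal (p - y \<bullet> b)" using lagrangian_eq[OF assms] by (simp add: p)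
  show ?thesis
  proof (rule regular_subdiffI[where h = "\<lambda>\<xi>. lagrangian \<rho> \<xi> y", OF l])
    fix \<epsilon> :: real assume "\<epsilon> > 0"
    from has_derivative_eventually[OF lagrange_grad_derivative[of ?q \<xi>] this]
    show "\<forall>\<^sub>F z in nhds \<xi>. ereal (p - y \<bullet> b + lagrange_grad ?q \<xi> \<bullet> (z - \<xi>) - \<epsilon> * norm (z - \<xi>))
        \<le> lagrangian \<rho> z y"
    proof eventually_elim
      case (elim z)
      then have "lagrange_grad ?q \<xi> \<bullet> (z - \<xi>) - \<epsilon> * norm (z - \<xi>) \<le> F z - F \<xi> + ?q \<bullet> (G z - G \<xi>)"
        unfolding inner_diff_right[of ?q] by simp
      then have "ereal (p - y \<bullet> b + lagrange_grad ?q \<xi> \<bullet> (z - \<xi>) - \<epsilon> * norm (z - \<xi>)) \<le>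
          perturbed \<rho> (\<xi>, b) + ereal (F z - F \<xi> + ?q \<bullet> (G z - G \<xi>) - y \<bullet> b)"
        by (simp add: p)
      then show ?case using lagrangian_lower[OF assms, of z] by (rule order_trans)
    qed
  qed
qed

section \<open>Convexity of the augmented Lagrangian and growth\<close>

text \<open>
  The minimizing shift \<open>B \<xi> y\<close> and the gradient \<open>V \<xi> y\<close> tend to \<open>0\<close> as \<open>(\<xi>, y)\<close> tends to \<open>(0, ybar)\<close>, so
  for \<open>(\<xi>, y)\<close> in a small product of balls the growth inequality is available at \<open>(\<xi>, B \<xi> y)\<close> with
  subgradient \<open>(V \<xi> y, y)\<close>. Tested at \<open>(\<xi>', B \<xi>' y)\<close> it is the gradient inequality of the Lagrangian.
\<close>

lemma growth_imp_lagrangian_convex: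
  assumes \<rho>: "\<rho> > 0" and \<sigma>: "\<sigma> \<ge> 0"
    and growth: "local_quadratic_growth \<sigma> (perturbed \<rho>) (0, 0) (0, ybar)"
  obtains r where "r > 0" "cball 0 r \<subseteq> U"
    "\<And>y. y \<in> cball ybar r \<Longrightarrow> strongly_econvex_on \<sigma> (cball 0 r) (\<lambda>\<xi>. lagrangian \<rho> \<xi> y)"
proof -
  obtain \<delta> where \<delta>: "\<delta> > 0" and grow: "\<And>w z w'. w \<in> ball (0, 0) \<delta> \<Longrightarrow> z \<in> ball (0, ybar) \<delta> \<Longrightarrow>
      z \<in> subdiff (perturbed \<rho>) w \<Longrightarrow> w' \<in> ball (0, 0) \<delta> \<Longrightarrow>
      perturbed \<rho> w + ereal (z \<bullet> (w' - w) + \<sigma> / 2 * (norm (w' - w))\<^sup>2) \<le> perturbed \<rho> w'"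
    using growth by (rule local_quadratic_growthD) blast
  obtain B where B: "\<And>\<xi> y. shift_optimal \<rho> \<xi> y (B \<xi> y)"
    using shift_optimal_exists[OF \<rho>] by metis
  let ?net = "nhds (0::'e, ybar)"
  have fst: "((\<lambda>w. fst w) \<longlongrightarrow> 0) ?net" and snd: "((\<lambda>w. snd w) \<longlongrightarrow> ybar) ?net"
    using isCont_filterlim_nhds[where f = fst and x = "(0::'e, ybar)"]
      isCont_filterlim_nhds[where f = snd and x = "(0::'e, ybar)"] by (simp_all add: continuous_intros)
  have limB: "((\<lambda>w. B (fst w) (snd w)) \<longlongrightarrow> 0) ?net"
  proof (rule Lim_null_comparison)
    show "\<forall>\<^sub>F w in ?net. norm (B (fst w) (snd w)) \<le>
        2 * norm (G (fst w) - G 0) + norm (snd w - ybar) / \<rho>"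
      using shift_optimal_lipschitz[OF \<rho> shift_optimal_center B] by (auto intro!: always_eventually)
    have "((\<lambda>w. 2 * norm (G (fst w) - G 0) + norm (snd w - ybar) / \<rho>) \<longlongrightarrow>
        2 * norm (G 0 - G 0) + norm (ybar - ybar) / \<rho>) ?net"
      using \<rho> by (intro tendsto_intros tendsto_G fst snd) auto
    then show "((\<lambda>w. 2 * norm (G (fst w) - G 0) + norm (snd w - ybar) / \<rho>) \<longlongrightarrow> 0) ?net" by simp
  qed
  define V where "V \<xi> y = lagrange_grad (y - \<rho> *\<^sub>R B \<xi> y) \<xi>" for \<xi> y
  have "((\<lambda>w. V (fst w) (snd w)) \<longlongrightarrow> lagrange_grad (ybar - \<rho> *\<^sub>R 0) 0) ?net"
    unfolding V_def by (intro tendsto_lagrange_grad tendsto_intros fst snd limB)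
  then have limV: "((\<lambda>w. V (fst w) (snd w)) \<longlongrightarrow> 0) ?net" by (simp add: lagrange_grad_zero)
  have "((\<lambda>w. (fst w, B (fst w) (snd w))) \<longlongrightarrow> (0, 0)) ?net"
    "((\<lambda>w. (V (fst w) (snd w), snd w)) \<longlongrightarrow> (0, ybar)) ?net"
    by (intro tendsto_intros fst snd limB limV)+
  then have "\<forall>\<^sub>F w in ?net. (fst w, B (fst w) (snd w)) \<in> ball (0, 0) \<delta>"
    "\<forall>\<^sub>F w in ?net. (V (fst w) (snd w), snd w) \<in> ball (0, ybar) \<delta>"
    using \<delta> by (auto elim!: topological_tendstoD simp del: mem_ball)
  moreover have "\<forall>\<^sub>F w in ?net. fst w \<in> U" using fst open_U zero_U by (rule topological_tendstoD)
  ultimately have "\<forall>\<^sub>F w in ?net. (fst w, B (fst w) (snd w)) \<in> ball (0, 0) \<delta> \<and>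
      (V (fst w) (snd w), snd w) \<in> ball (0, ybar) \<delta> \<and> fst w \<in> U"
    by eventually_elim auto
  then obtain d where d: "d > 0" and near: "\<And>w. dist w (0, ybar) < d \<Longrightarrow>
      (fst w, B (fst w) (snd w)) \<in> ball (0, 0) \<delta> \<and> (V (fst w) (snd w), snd w) \<in> ball (0, ybar) \<delta> \<and> fst w \<in> U"
    unfolding eventually_nhds_metric by blast
  define r where "r = d / 3"
  have r: "r > 0" using d by (simp add: r_def)
  have close: "(\<xi>, B \<xi> y) \<in> ball (0, 0) \<delta> \<and> (V \<xi> y, y) \<in> ball (0, ybar) \<delta> \<and> \<xi> \<in> U"
    if "\<xi> \<in> cball 0 r" "y \<in> cball ybar r" for \<xi> y
  proof -
    have "dist (\<xi>, y) (0, ybar) \<le> norm \<xi> + norm (y - ybar)"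
      using norm_Pair_le[of \<xi> "y - ybar"] by (simp add: dist_norm)
    also have "\<dots> < d" using that r by (auto simp: dist_norm norm_minus_commute r_def)
    finally show ?thesis using near[of "(\<xi>, y)"] by simp
  qed
  show ?thesis
  proof (rule that[OF r])
    show "cball 0 r \<subseteq> U" using close[of _ ybar] r by auto
    fix y assume y: "y \<in> cball ybar r"
    show "strongly_econvex_on \<sigma> (cball 0 r) (\<lambda>\<xi>. lagrangian \<rho> \<xi> y)"
    proof (rule strongly_econvexI_growth)
      fix \<xi> assume \<xi>: "\<xi> \<in> cball (0::'e) r"
      let ?b = "B \<xi> y"
      have U: "\<xi> \<in> U" using close[OF \<xi> y] by simp
      obtain p where p: "perturbed \<rho> (\<xi>, ?b) = ereal p" using U B by (rule perturbed_finite)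
      have l: "lagrangian \<rho> \<xi> y = ereal (p - y \<bullet> ?b)" using lagrangian_eq[OF U B \<rho>] by (simp add: p)
      have sub: "(V \<xi> y, y) \<in> subdiff (perturbed \<rho>) (\<xi>, ?b)"
        using U \<rho> B by (simp add: subdiff_perturbed V_def)
      have "ereal (p - y \<bullet> ?b + V \<xi> y \<bullet> (\<xi>' - \<xi>) + \<sigma> / 2 * (norm (\<xi>' - \<xi>))\<^sup>2) \<le> lagrangian \<rho> \<xi>' y"
        if \<xi>': "\<xi>' \<in> cball 0 r" for \<xi>'
      proof -
        let ?b' = "B \<xi>' y"
        have U': "\<xi>' \<in> U" using close[OF \<xi>' y] by simp
        obtain p' where p': "perturbed \<rho> (\<xi>', ?b') = ereal p'" using U' B by (rule perturbed_finite)
        have "perturbed \<rho> (\<xi>, ?b) + ereal ((V \<xi> y, y) \<bullet> ((\<xi>', ?b') - (\<xi>, ?b)) +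
            \<sigma> / 2 * (norm ((\<xi>', ?b') - (\<xi>, ?b)))\<^sup>2) \<le> perturbed \<rho> (\<xi>', ?b')"
          using close[OF \<xi> y] close[OF \<xi>' y] by (intro grow[OF _ _ sub]) auto
        then have "p + (V \<xi> y \<bullet> (\<xi>' - \<xi>) + y \<bullet> (?b' - ?b) +
            \<sigma> / 2 * (norm (\<xi>' - \<xi>, ?b' - ?b))\<^sup>2) \<le> p'"
          by (simp add: p p')
        moreover have "\<sigma> / 2 * (norm (\<xi>' - \<xi>))\<^sup>2 \<le> \<sigma> / 2 * (norm (\<xi>' - \<xi>, ?b' - ?b))\<^sup>2"
          using \<sigma> by (intro mult_left_mono) (simp_all add: norm_Pair)
        ultimately show ?thesis
          using lagrangian_eq[OF U' B \<rho>] by (simp add: p' inner_diff_right[of y])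
      qed
      then show "\<exists>v a. lagrangian \<rho> \<xi> y = ereal a \<and> (\<forall>\<xi>'\<in>cball 0 r.
          ereal (a + v \<bullet> (\<xi>' - \<xi>) + \<sigma> / 2 * (norm (\<xi>' - \<xi>))\<^sup>2) \<le> lagrangian \<rho> \<xi>' y)"
        using l by blast
    qed simp
  qed
qed

text \<open>
  The operator norm of the derivative is bounded by the sum of the norms of its partial derivatives,
  which is continuous.
\<close>

lemma G_locally_lipschitz:
  obtains d L where "d > 0" "L \<ge> 0"
    "\<And>\<xi> \<xi>'. \<xi> \<in> ball 0 d \<Longrightarrow> \<xi>' \<in> ball 0 d \<Longrightarrow> norm (G \<xi>' - G \<xi>) \<le> L * norm (\<xi>' - \<xi>)"
proof -
  define S where "S \<xi> = (\<Sum>i\<in>Basis. norm (G' \<xi> i))" for \<xi>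
  have "isCont S 0" unfolding S_def
    using G' by (intro continuous_intros) (auto simp: continuous_on_eq_continuous_at)
  then have "(S \<longlongrightarrow> S 0) (nhds 0)" by (rule isCont_filterlim_nhds)
  then have "\<forall>\<^sub>F \<xi> in nhds 0. S \<xi> < S 0 + 1" by (rule order_tendstoD) simp
  then obtain d where d: "d > 0" "\<And>\<xi>. \<xi> \<in> ball 0 d \<Longrightarrow> S \<xi> < S 0 + 1"
    unfolding eventually_nhds_metric by (auto simp: dist_commute)
  have onorm: "onorm (G' \<xi>) \<le> S 0 + 1" if "\<xi> \<in> ball 0 d" for \<xi>
  proof (rule onorm_bound)
    show "0 \<le> S 0 + 1" unfolding S_def by (intro add_nonneg_nonneg sum_nonneg) auto
    fix a
    have lin: "linear (G' \<xi>)" using G by (rule has_derivative_linear)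
    have "G' \<xi> a = G' \<xi> (\<Sum>i\<in>Basis. (a \<bullet> i) *\<^sub>R i)" by (simp add: euclidean_representation)
    also have "\<dots> = (\<Sum>i\<in>Basis. (a \<bullet> i) *\<^sub>R G' \<xi> i)" unfolding linear_sum[OF lin] linear_cmul[OF lin] ..
    finally have "norm (G' \<xi> a) \<le> (\<Sum>i\<in>Basis. norm ((a \<bullet> i) *\<^sub>R G' \<xi> i))"
      by (simp only: norm_sum)
    also have "\<dots> \<le> (\<Sum>i\<in>Basis. norm a * norm (G' \<xi> i))"
      by (intro sum_mono) (auto intro!: mult_right_mono Basis_le_norm)
    also have "\<dots> = S \<xi> * norm a" by (simp add: S_def sum_distrib_left mult.commute)
    also have "\<dots> \<le> (S 0 + 1) * norm a" using d(2)[OF that] by (intro mult_right_mono) auto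
    finally show "norm (G' \<xi> a) \<le> (S 0 + 1) * norm a" .
  qed
  show ?thesis
  proof (rule that[OF d(1)])
    show "0 \<le> S 0 + 1" unfolding S_def by (intro add_nonneg_nonneg sum_nonneg) auto
    fix \<xi> \<xi>' :: 'e assume "\<xi> \<in> ball 0 d" "\<xi>' \<in> ball 0 d"
    then show "norm (G \<xi>' - G \<xi>) \<le> (S 0 + 1) * norm (\<xi>' - \<xi>)"
      by (intro differentiable_bound[of "ball 0 d" G G'])
        (auto intro!: onorm has_derivative_at_withinI[OF G])
  qed
qed

text \<open>
  With \<open>b1\<close> the minimizing shift at \<open>(\<xi>', y)\<close>, convexity of the Lagrangian gives \<open>\<sigma>/2 |\<xi>' - \<xi>|\<^sup>2\<close> and the
  penalty gives \<open>\<rho>/2 |b' - b1|\<^sup>2\<close>. The Lipschitz bound \<open>|b1 - b| \<le> 2 L |\<xi>' - \<xi>|\<close> yields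
  \<open>|b' - b|\<^sup>2 \<le> 2 |b' - b1|\<^sup>2 + 8 L\<^sup>2 |\<xi>' - \<xi>|\<^sup>2\<close>, so both terms together dominate
  \<open>\<tau>/2 (|\<xi>' - \<xi>|\<^sup>2 + |b' - b|\<^sup>2)\<close> as soon as \<open>\<tau> (1 + 8 L\<^sup>2) \<le> \<sigma>\<close> and \<open>2 \<tau> \<le> \<rho>\<close>.
\<close>

lemma lagrangian_convex_imp_growth:
  assumes \<rho>: "\<rho> > 0" and \<sigma>: "admissible_modulus strong \<sigma>"
    and W: "0 \<in> interior W" "W \<subseteq> U" and Y: "ybar \<in> interior Y"
    and conv: "\<And>y. y \<in> Y \<Longrightarrow> strongly_econvex_on \<sigma> W (\<lambda>\<xi>. lagrangian \<rho> \<xi> y)"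
  shows "\<exists>\<tau>. admissible_modulus strong \<tau> \<and> local_quadratic_growth \<tau> (perturbed \<rho>) (0, 0) (0, ybar)"
proof -
  obtain d L where d: "d > 0" and L: "L \<ge> 0" and lip: "\<And>\<xi> \<xi>'. \<xi> \<in> ball 0 d \<Longrightarrow> \<xi>' \<in> ball 0 d \<Longrightarrow>
      norm (G \<xi>' - G \<xi>) \<le> L * norm (\<xi>' - \<xi>)"
    by (rule G_locally_lipschitz) blast
  obtain d1 where d1: "d1 > 0" "ball 0 d1 \<subseteq> W" using W(1) mem_interior by blast
  obtain d2 where d2: "d2 > 0" "ball ybar d2 \<subseteq> Y" using Y mem_interior by blast
  define \<delta> where "\<delta> = min d (min d1 d2)"
  \<comment> \<open>for \<open>\<sigma> = 0\<close> this is \<open>0\<close>, so both readings are covered\<close>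
  define \<tau> where "\<tau> = min (\<rho> / 2) (\<sigma> / (1 + 8 * L\<^sup>2))"
  have L8: "1 + 8 * L\<^sup>2 > 0" by (intro add_pos_nonneg) auto
  have adm: "admissible_modulus strong \<tau>"
    using \<sigma> \<rho> L8 by (auto simp: admissible_modulus_def \<tau>_def split: if_splits)
  then have \<tau>0: "\<tau> \<ge> 0" by (rule admissible_modulus_nonneg)
  have \<tau>\<rho>: "\<tau> \<le> \<rho> / 2" unfolding \<tau>_def by (rule min.cobounded1)
  have "\<tau> \<le> \<sigma> / (1 + 8 * L\<^sup>2)" unfolding \<tau>_def by (rule min.cobounded2)
  then have \<tau>\<sigma>: "\<tau> * (1 + 8 * L\<^sup>2) \<le> \<sigma>" using L8 by (simp only: pos_le_divide_eq)
  have "perturbed \<rho> (\<xi>, b) + ereal ((v, y) \<bullet> ((\<xi>', b') - (\<xi>, b)) + \<tau> / 2 * (norm ((\<xi>', b') - (\<xi>, b)))\<^sup>2)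
      \<le> perturbed \<rho> (\<xi>', b')"
    if w: "(\<xi>, b) \<in> ball (0, 0) \<delta>" and z: "(v, y) \<in> ball (0, ybar) \<delta>"
      and sub: "(v, y) \<in> subdiff (perturbed \<rho>) (\<xi>, b)" and w': "(\<xi>', b') \<in> ball (0, 0) \<delta>"
    for \<xi> b v y \<xi>' b'
  proof -
    have \<xi>: "\<xi> \<in> ball 0 \<delta>" and \<xi>': "\<xi>' \<in> ball 0 \<delta>" and y: "y \<in> ball ybar \<delta>"
      using w w' z dist_fst_le[of "(0, 0)" "(\<xi>, b)"] dist_fst_le[of "(0, 0)" "(\<xi>', b')"]
        dist_snd_le[of "(0, ybar)" "(v, y)"] by auto
    then have in_W: "\<xi> \<in> W" "\<xi>' \<in> W" and in_Y: "y \<in> Y" and in_d: "\<xi> \<in> ball 0 d" "\<xi>' \<in> ball 0 d"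
      using d1 d2 by (auto simp: \<delta>_def)
    then have U: "\<xi> \<in> U" "\<xi>' \<in> U" using W(2) by auto
    have opt: "shift_optimal \<rho> \<xi> y b" and v: "v = lagrange_grad (y - \<rho> *\<^sub>R b) \<xi>"
      using sub U \<rho> by (auto simp: subdiff_perturbed)
    obtain b1 where b1: "shift_optimal \<rho> \<xi>' y b1" using shift_optimal_exists[OF \<rho>] by blast
    let ?\<Delta> = "\<xi>' - \<xi>"
    have "lagrangian \<rho> \<xi> y + ereal (v \<bullet> ?\<Delta> + \<sigma> / 2 * (norm ?\<Delta>)\<^sup>2) \<le> lagrangian \<rho> \<xi>' y"
      using lagrangian_regular_subgradient[OF U(1) opt \<rho>]
      by (intro strongly_econvex_regular_subgradient[OF conv[OF in_Y] _ in_W]) (simp add: v)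
    moreover have "lagrangian \<rho> \<xi>' y + ereal (y \<bullet> b' + \<rho> / 2 * (norm (b' - b1))\<^sup>2) \<le> perturbed \<rho> (\<xi>', b')"
      using lagrangian_growth[OF U(2) b1 \<rho>] .
    moreover obtain p where p: "perturbed \<rho> (\<xi>, b) = ereal p" using U(1) opt by (rule perturbed_finite)
    moreover obtain p1 where p1: "perturbed \<rho> (\<xi>', b1) = ereal p1" using U(2) b1 by (rule perturbed_finite)
    ultimately have main: "ereal (p + v \<bullet> ?\<Delta> + y \<bullet> (b' - b) + \<sigma> / 2 * (norm ?\<Delta>)\<^sup>2 + \<rho> / 2 * (norm (b' - b1))\<^sup>2)
        \<le> perturbed \<rho> (\<xi>', b')"
      unfolding lagrangian_eq[OF U(1) opt \<rho>] lagrangian_eq[OF U(2) b1 \<rho>]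
      by (cases "perturbed \<rho> (\<xi>', b')") (auto simp: inner_diff_right[of y])
    have "norm (b1 - b) \<le> 2 * norm (G \<xi>' - G \<xi>)"
      using shift_optimal_lipschitz[OF \<rho> opt b1] by simp
    then have "norm (b1 - b) \<le> 2 * L * norm ?\<Delta>" using lip[OF in_d] by simp
    then have "norm (b' - b) \<le> norm (b' - b1) + 2 * L * norm ?\<Delta>"
      using norm_triangle_ineq[of "b' - b1" "b1 - b"] by simp
    then have "(norm (b' - b))\<^sup>2 \<le> (norm (b' - b1) + 2 * L * norm ?\<Delta>)\<^sup>2" by (rule power_mono) simp
    also have "\<dots> \<le> 2 * (norm (b' - b1))\<^sup>2 + 8 * L\<^sup>2 * (norm ?\<Delta>)\<^sup>2"
      using sum_squares_bound[of "norm (b' - b1)" "2 * L * norm ?\<Delta>"]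
      by (simp add: power2_sum power_mult_distrib)
    finally have nb: "(norm (b' - b))\<^sup>2 \<le> 2 * (norm (b' - b1))\<^sup>2 + 8 * L\<^sup>2 * (norm ?\<Delta>)\<^sup>2" .
    have "\<tau> / 2 * (norm (?\<Delta>, b' - b))\<^sup>2 = \<tau> / 2 * ((norm ?\<Delta>)\<^sup>2 + (norm (b' - b))\<^sup>2)"
      by (simp add: norm_Pair)
    also have "\<dots> \<le> \<tau> / 2 * ((norm ?\<Delta>)\<^sup>2 + (2 * (norm (b' - b1))\<^sup>2 + 8 * L\<^sup>2 * (norm ?\<Delta>)\<^sup>2))"
      using nb \<tau>0 by (intro mult_left_mono add_left_mono) auto
    also have "\<dots> = \<tau> * (1 + 8 * L\<^sup>2) / 2 * (norm ?\<Delta>)\<^sup>2 + \<tau> * (norm (b' - b1))\<^sup>2"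
      by (simp add: field_simps)
    also have "\<dots> \<le> \<sigma> / 2 * (norm ?\<Delta>)\<^sup>2 + \<rho> / 2 * (norm (b' - b1))\<^sup>2"
      using \<tau>\<sigma> \<tau>\<rho> by (intro add_mono mult_right_mono) auto
    finally have "ereal (p + (v \<bullet> ?\<Delta> + y \<bullet> (b' - b) + \<tau> / 2 * (norm (?\<Delta>, b' - b))\<^sup>2)) \<le>
        ereal (p + v \<bullet> ?\<Delta> + y \<bullet> (b' - b) + \<sigma> / 2 * (norm ?\<Delta>)\<^sup>2 + \<rho> / 2 * (norm (b' - b1))\<^sup>2)"
      by simp
    then have "ereal (p + (v \<bullet> ?\<Delta> + y \<bullet> (b' - b) + \<tau> / 2 * (norm (?\<Delta>, b' - b))\<^sup>2)) \<le> perturbed \<rho> (\<xi>', b')"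
      using main by (rule order_trans)
    then show ?thesis by (simp add: p)
  qed
  moreover have "\<delta> > 0" using d d1 d2 by (simp add: \<delta>_def)
  ultimately have "local_quadratic_growth \<tau> (perturbed \<rho>) (0, 0) (0, ybar)"
    unfolding local_quadratic_growth_def by (intro exI[of _ \<delta>]) fast
  with adm show ?thesis by blast
qed

text \<open>
  With \<open>\<kappa> = \<rho>' - \<rho>\<close>, a subgradient \<open>(v, y)\<close> for \<open>\<rho>'\<close> corresponds to the subgradient \<open>(v, y - \<kappa> b)\<close> for
  \<open>\<rho>\<close>, which is still near \<open>(0, ybar)\<close> as \<open>b\<close> is near \<open>0\<close>. The additional term \<open>\<kappa>/2 |b|\<^sup>2\<close> is convex, so
  it only helps.
\<close>

lemma growth_mono_penalty:
  assumes growth: "local_quadratic_growth \<sigma> (perturbed \<rho>) (0, 0) (0, ybar)"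
    and \<rho>: "0 \<le> \<rho>" "\<rho> \<le> \<rho>'"
  shows "local_quadratic_growth \<sigma> (perturbed \<rho>') (0, 0) (0, ybar)"
proof -
  define \<kappa> where "\<kappa> = \<rho>' - \<rho>"
  have \<kappa>: "\<kappa> \<ge> 0" using \<rho> by (simp add: \<kappa>_def)
  have split: "perturbed \<rho>' (\<xi>, b) = perturbed \<rho> (\<xi>, b) + ereal (\<kappa> / 2 * (norm b)\<^sup>2)" for \<xi> b
    by (cases "\<theta> (G \<xi> + b)") (auto simp: perturbed_def \<kappa>_def field_simps)
  obtain \<delta> where \<delta>: "\<delta> > 0" and grow: "\<And>w z w'. w \<in> ball (0, 0) \<delta> \<Longrightarrow> z \<in> ball (0, ybar) \<delta> \<Longrightarrow>
      z \<in> subdiff (perturbed \<rho>) w \<Longrightarrow> w' \<in> ball (0, 0) \<delta> \<Longrightarrow>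
      perturbed \<rho> w + ereal (z \<bullet> (w' - w) + \<sigma> / 2 * (norm (w' - w))\<^sup>2) \<le> perturbed \<rho> w'"
    using growth by (rule local_quadratic_growthD) blast
  obtain r where r: "r > 0" "ball 0 r \<subseteq> U" using open_U zero_U open_contains_ball by blast
  \<comment> \<open>\<open>\<delta>' (1 + \<kappa>) \<le> \<delta>\<close> keeps the shifted multiplier \<open>y - \<kappa> b\<close> within \<open>\<delta>\<close> of \<open>ybar\<close>\<close>
  define \<delta>' where "\<delta>' = min r (\<delta> / (1 + \<kappa>))"
  have "\<delta>' \<le> \<delta> / (1 + \<kappa>)" by (simp add: \<delta>'_def)
  then have \<delta>'1: "\<delta>' * (1 + \<kappa>) \<le> \<delta>" using \<kappa> by (simp add: pos_le_divide_eq)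
  have \<delta>'0: "\<delta>' > 0" using r \<delta> \<kappa> by (simp add: \<delta>'_def)
  have "\<delta>' * 1 \<le> \<delta>' * (1 + \<kappa>)" using \<kappa> \<delta>'0 by (intro mult_left_mono) auto
  then have \<delta>'2: "\<delta>' \<le> \<delta>" using \<delta>'1 by simp
  have "perturbed \<rho>' (\<xi>, b) + ereal ((v, y) \<bullet> ((\<xi>', b') - (\<xi>, b)) + \<sigma> / 2 * (norm ((\<xi>', b') - (\<xi>, b)))\<^sup>2)
      \<le> perturbed \<rho>' (\<xi>', b')"
    if w: "(\<xi>, b) \<in> ball (0, 0) \<delta>'" and z: "(v, y) \<in> ball (0, ybar) \<delta>'"
      and sub: "(v, y) \<in> subdiff (perturbed \<rho>') (\<xi>, b)" and w': "(\<xi>', b') \<in> ball (0, 0) \<delta>'"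
    for \<xi> b v y \<xi>' b'
  proof -
    have \<xi>: "\<xi> \<in> ball 0 \<delta>'" and b: "norm b < \<delta>'"
      using w dist_fst_le[of "(0, 0)" "(\<xi>, b)"] dist_snd_le[of "(0, 0)" "(\<xi>, b)"] by auto
    then have U: "\<xi> \<in> U" using r by (auto simp: \<delta>'_def)
    then have "shift_optimal \<rho>' \<xi> y b" "v = lagrange_grad (y - \<rho>' *\<^sub>R b) \<xi>"
      using sub \<rho> by (auto simp: subdiff_perturbed)
    then have opt: "shift_optimal \<rho> \<xi> (y - \<kappa> *\<^sub>R b) b" and v: "v = lagrange_grad ((y - \<kappa> *\<^sub>R b) - \<rho> *\<^sub>R b) \<xi>"
      by (simp_all add: shift_optimal_def \<kappa>_def algebra_simps)
    have "norm ((v, y - \<kappa> *\<^sub>R b) - (0, ybar)) \<le> norm ((v, y) - (0, ybar)) + norm (0::'e, \<kappa> *\<^sub>R b)"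
      using norm_triangle_ineq4[of "(v, y) - (0, ybar)" "(0, \<kappa> *\<^sub>R b)"] by (simp add: algebra_simps)
    also have "norm ((v, y) - (0, ybar)) < \<delta>'" using z by (simp only: mem_ball dist_norm norm_minus_commute)
    also have "norm (0::'e, \<kappa> *\<^sub>R b) \<le> \<kappa> * \<delta>'" using b \<kappa> by (simp add: norm_Pair mult_left_mono)
    finally have "norm ((v, y - \<kappa> *\<^sub>R b) - (0, ybar)) < \<delta>" using \<delta>'1 by (simp add: algebra_simps)
    then have z': "(v, y - \<kappa> *\<^sub>R b) \<in> ball (0, ybar) \<delta>" by (simp only: mem_ball dist_norm norm_minus_commute)
    have "(v, y - \<kappa> *\<^sub>R b) \<in> subdiff (perturbed \<rho>) (\<xi>, b)"
      using U opt v \<rho> by (simp add: subdiff_perturbed)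
    then have "perturbed \<rho> (\<xi>, b) + ereal ((v, y - \<kappa> *\<^sub>R b) \<bullet> ((\<xi>', b') - (\<xi>, b)) +
        \<sigma> / 2 * (norm ((\<xi>', b') - (\<xi>, b)))\<^sup>2) \<le> perturbed \<rho> (\<xi>', b')"
      using w w' \<delta>'2 by (intro grow[OF _ z']) auto
    moreover have "\<kappa> / 2 * (norm (b' - b))\<^sup>2 \<ge> 0" using \<kappa> by simp
    moreover obtain p where "perturbed \<rho> (\<xi>, b) = ereal p" using U opt by (rule perturbed_finite)
    ultimately show ?thesis
      unfolding split half_norm_square_expand[of \<kappa> b' b]
      by (cases "perturbed \<rho> (\<xi>', b')") (auto simp: inner_diff_left)
  qed
  then show ?thesis
    unfolding local_quadratic_growth_def using \<delta>'0 by (intro exI[of _ \<delta>']) fast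
qed

lemma lagrangian_saddle:
  assumes \<rho>: "\<rho> > 0" and \<sigma>: "\<sigma> \<ge> 0" and W: "0 \<in> W"
    and conv: "strongly_econvex_on \<sigma> W (\<lambda>\<xi>. lagrangian \<rho> \<xi> ybar)"
  shows "\<xi> \<in> W \<Longrightarrow> lagrangian \<rho> 0 ybar \<le> lagrangian \<rho> \<xi> ybar" and "lagrangian \<rho> 0 y \<le> lagrangian \<rho> 0 ybar"
proof -
  assume \<xi>: "\<xi> \<in> W"
  have "0 \<in> regular_subdiff (\<lambda>\<xi>. lagrangian \<rho> \<xi> ybar) 0"
    using lagrangian_regular_subgradient[OF zero_U shift_optimal_center \<rho>] by (simp add: lagrange_grad_zero)
  from econvex_regular_subgradient[OF strongly_econvex_imp_econvex[OF conv \<sigma>] this W \<xi>]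
  show "lagrangian \<rho> 0 ybar \<le> lagrangian \<rho> \<xi> ybar" by (simp flip: zero_ereal_def)
next
  show "lagrangian \<rho> 0 y \<le> lagrangian \<rho> 0 ybar"
    using lagrangian_le[of \<rho> 0 y 0] lagrangian_eq[OF zero_U shift_optimal_center \<rho>] by simp
qed

theorem variationally_convex_iff_growth:
  assumes "\<rho> \<ge> 0"
  shows "variationally_convex strong (perturbed \<rho>) (0, 0) (0, ybar) \<longleftrightarrow>
    (\<exists>\<sigma>. admissible_modulus strong \<sigma> \<and> local_quadratic_growth \<sigma> (perturbed \<rho>) (0, 0) (0, ybar))"
proof
  assume "\<exists>\<sigma>. admissible_modulus strong \<sigma> \<and> local_quadratic_growth \<sigma> (perturbed \<rho>) (0, 0) (0, ybar)"
  then obtain \<sigma> where "admissible_modulus strong \<sigma>"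
    "local_quadratic_growth \<sigma> (perturbed \<rho>) (0, 0) (0, ybar)" by blast
  then show "variationally_convex strong (perturbed \<rho>) (0, 0) (0, ybar)"
    by (rule growth_imp_variationally_convex[OF center_subgradient[OF assms] lsc_near_center])
qed (rule variationally_convex_imp_growth)

end

text \<open>
  Each \<open>b\<close> with a finite value \<open>h b\<close> contributes an affine function of \<open>y\<close>. A value \<open>\<infinity>\<close> does not affect
  the infimum, and a value \<open>- \<infinity>\<close> makes it \<open>- \<infinity>\<close> for all \<open>y\<close>.
\<close>

lemma econcave_INF_affine: "econcave_on UNIV (\<lambda>y. INF b. h b - ereal (y \<bullet> b))"
  unfolding econcave_on_def
proof (rule econvex_onI)
  fix x z :: 'a and a c t :: real
  assume a: "- (INF b. h b - ereal (x \<bullet> b)) \<le> ereal a" and c: "- (INF b. h b - ereal (z \<bullet> b)) \<le> ereal c"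
    and t: "0 \<le> t" "t \<le> 1"
  let ?m = "(1 - t) *\<^sub>R x + t *\<^sub>R z"
  have iff: "- (INF b. h b - ereal (y \<bullet> b)) \<le> ereal e \<longleftrightarrow> (\<forall>b. ereal (y \<bullet> b - e) \<le> h b)" for y e
  proof -
    have "- (INF b. h b - ereal (y \<bullet> b)) \<le> ereal e \<longleftrightarrow> ereal (- e) \<le> (INF b. h b - ereal (y \<bullet> b))"
      by (metis ereal_uminus_le_reorder uminus_ereal.simps(1))
    also have "\<dots> \<longleftrightarrow> (\<forall>b. ereal (- e) \<le> h b - ereal (y \<bullet> b))" by (simp add: le_INF_iff)
    also have "\<dots> \<longleftrightarrow> (\<forall>b. ereal (y \<bullet> b - e) \<le> h b)"
    proof (intro all_cong1)
      fix b show "(ereal (- e) \<le> h b - ereal (y \<bullet> b)) = (ereal (y \<bullet> b - e) \<le> h b)"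
        by (cases "h b") (auto simp: algebra_simps)
    qed
    finally show ?thesis .
  qed
  have "ereal (?m \<bullet> b - ((1 - t) * a + t * c)) \<le> h b" for b
  proof (cases "h b")
    case (real e)
    then have "x \<bullet> b - a \<le> e" "z \<bullet> b - c \<le> e" using a c unfolding iff by (metis ereal_less_eq(3))+
    then have "(1 - t) * (x \<bullet> b - a) + t * (z \<bullet> b - c) \<le> (1 - t) * e + t * e"
      using t by (intro add_mono mult_left_mono) auto
    then show ?thesis by (simp add: real inner_simps algebra_simps)
  next
    case MInf
    then show ?thesis using a unfolding iff by (auto dest: spec[of _ b])
  qed simp
  then show "?m \<in> UNIV \<and> - (INF b. h b - ereal (?m \<bullet> b)) \<le> ereal ((1 - t) * a + t * c)"
    unfolding iff by simp
qed

section \<open>Continuously differentiable functions along a retraction\<close>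

lemma Ck_on_1_iff: "Ck_on (Suc 0) S f \<longleftrightarrow>
    (\<forall>x\<in>S. f differentiable (at x)) \<and> (\<forall>v. continuous_on S (\<lambda>x. frechet_derivative f (at x) v))"
  by simp

text \<open>
  The derivative of the composition is expanded in the standard basis to separate the dependence of
  the outer derivative on the base point from its argument.
\<close>

lemma Ck_on_1_compose:
  fixes f :: "'a::euclidean_space \<Rightarrow> 'b::euclidean_space" and g :: "'b \<Rightarrow> 'c::euclidean_space"
  assumes f: "Ck_on (Suc 0) S f" and g: "Ck_on (Suc 0) T g" and sub: "f ` S \<subseteq> T"
  shows "Ck_on (Suc 0) S (\<lambda>x. g (f x))"
proof -
  have df: "(f has_derivative frechet_derivative f (at x)) (at x)" if "x \<in> S" for x
    using f that by (simp add: frechet_derivative_works)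
  have dg: "(g has_derivative frechet_derivative g (at (f x))) (at (f x))" if "x \<in> S" for x
    using g sub that by (auto simp flip: frechet_derivative_works)
  have comp: "((\<lambda>x. g (f x)) has_derivative
      (\<lambda>v. frechet_derivative g (at (f x)) (frechet_derivative f (at x) v))) (at x)" if "x \<in> S" for x
    using diff_chain_at[OF df[OF that] dg[OF that]] by (simp add: o_def)
  have cf: "continuous_on S f"
    using df has_derivative_continuous by (blast intro: continuous_at_imp_continuous_on)
  have "continuous_on S (\<lambda>x. frechet_derivative (\<lambda>x. g (f x)) (at x) v)" for v
  proof -
    have "continuous_on S (\<lambda>x. \<Sum>i\<in>Basis. (frechet_derivative f (at x) v \<bullet> i) *\<^sub>R
        frechet_derivative g (at (f x)) i)"
    proof (intro continuous_intros)
      show "continuous_on S (\<lambda>x. frechet_derivative f (at x) v)" using f by simp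
      show "continuous_on S (\<lambda>x. frechet_derivative g (at (f x)) i)" for i
        using g by (intro continuous_on_compose2[OF _ cf sub]) simp
    qed
    then show ?thesis
    proof (rule continuous_on_eq)
      fix x assume x: "x \<in> S"
      have lin: "linear (frechet_derivative g (at (f x)))" using dg[OF x] by (rule has_derivative_linear)
      have "frechet_derivative (\<lambda>x. g (f x)) (at x) v =
          frechet_derivative g (at (f x)) (frechet_derivative f (at x) v)"
        using frechet_derivative_at[OF comp[OF x]] by metis
      also have "\<dots> = frechet_derivative g (at (f x))
          (\<Sum>i\<in>Basis. (frechet_derivative f (at x) v \<bullet> i) *\<^sub>R i)"
        by (simp add: euclidean_representation)
      finally show "(\<Sum>i\<in>Basis. (frechet_derivative f (at x) v \<bullet> i) *\<^sub>R frechet_derivative g (at (f x)) i)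
          = frechet_derivative (\<lambda>x. g (f x)) (at x) v"
        unfolding linear_sum[OF lin] linear_cmul[OF lin] by simp
    qed
  qed
  with comp show ?thesis unfolding Ck_on_1_iff by (auto simp: differentiable_def)
qed

lemma Ck_on_1_cong:
  assumes f: "Ck_on (Suc 0) S f" and S: "open S" and eq: "\<And>x. x \<in> S \<Longrightarrow> f x = g x"
  shows "Ck_on (Suc 0) S g"
proof -
  have d: "(g has_derivative frechet_derivative f (at x)) (at x)" if "x \<in> S" for x
    using has_derivative_transform_within_open[OF _ S that eq] f that
    by (auto simp: frechet_derivative_works)
  have "frechet_derivative f (at x) v = frechet_derivative g (at x) v" if "x \<in> S" for x v
    using frechet_derivative_at[OF d[OF that]] by simp
  then have "continuous_on S (\<lambda>x. frechet_derivative g (at x) v)" for v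
    using f by (auto intro: continuous_on_eq)
  with d show ?thesis unfolding Ck_on_1_iff by (auto simp: differentiable_def)
qed

lemma Ck_on_1_local:
  assumes "\<And>x. \<exists>S. open S \<and> x \<in> S \<and> Ck_on (Suc 0) S f"
  shows "Ck_on (Suc 0) UNIV f"
  unfolding Ck_on_1_iff
proof safe
  fix x show "f differentiable at x" using assms[of x] by auto
next
  fix v
  have "isCont (\<lambda>x. frechet_derivative f (at x) v) x" for x
    using assms[of x] by (auto simp: continuous_on_eq_continuous_at)
  then show "continuous_on UNIV (\<lambda>x. frechet_derivative f (at x) v)"
    by (simp add: continuous_on_eq_continuous_at)
qed

lemma Ck_on_1_linear:
  fixes L :: "'a::euclidean_space \<Rightarrow> 'b::euclidean_space"
  assumes "linear L" shows "Ck_on (Suc 0) UNIV (\<lambda>x. p + L x)"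
proof -
  have d: "((\<lambda>x. p + L x) has_derivative L) (at x)" for x
    using linear_imp_has_derivative[OF assms] by (auto intro!: derivative_eq_intros)
  then have "frechet_derivative (\<lambda>x. p + L x) (at x) = L" for x
    using frechet_derivative_at[OF d] by simp
  with d show ?thesis unfolding Ck_on_1_iff by (auto simp: differentiable_def)
qed

lemma frame_properties:
  assumes "orthonormal_frame A G x \<iota>"
  shows "\<iota> a \<in> tangent_space A x" "linear (\<lambda>a. \<iota> a c)" "\<iota> 0 = tan_zero" "inj \<iota>"
    "G x (\<iota> a) (\<iota> b) = a \<bullet> b" "v \<in> tangent_space A x \<Longrightarrow> \<exists>a. v = \<iota> a"
proof -
  have bij: "bij_betw \<iota> UNIV (tangent_space A x)" using assms by (simp add: orthonormal_frame_def)
  show "\<iota> a \<in> tangent_space A x" "inj \<iota>" using bij by (auto simp: bij_betw_def)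
  show "v \<in> tangent_space A x \<Longrightarrow> \<exists>a. v = \<iota> a" using bij by (auto simp: bij_betw_def)
  show "linear (\<lambda>a. \<iota> a c)" using assms by (intro linearI) (auto simp: orthonormal_frame_def)
  have "\<iota> (0 *\<^sub>R 0) = tan_scale 0 (\<iota> 0)" using assms by (simp only: orthonormal_frame_def)
  then show "\<iota> 0 = tan_zero" by simp
  show "G x (\<iota> a) (\<iota> b) = a \<bullet> b" using assms by (simp add: orthonormal_frame_def)
qed

text \<open>
  In the chart of the tangent bundle over \<open>c\<close>, the vector \<open>\<iota> \<xi>\<close> has the coordinates
  \<open>(snd c x, \<iota> \<xi> c)\<close>, an affine function of \<open>\<xi>\<close>. Hence \<open>\<xi> \<mapsto> R (x, \<iota> \<xi>)\<close> is, in the chart \<open>d\<close>, a local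
  representative of \<open>R\<close> composed with an affine map.
\<close>

lemma retraction_local_chart:
  fixes A :: "('m, 'e::euclidean_space) atlas"
  assumes A: "smooth_manifold A" and x: "x \<in> points A" and R: "manifold_retraction A R"
    and \<iota>: "orthonormal_frame A G x \<iota>" and d: "d \<in> A" "R (x, \<iota> \<xi>0) \<in> fst d"
  obtains S where "open S" "\<xi>0 \<in> S" "\<And>\<xi>. \<xi> \<in> S \<Longrightarrow> R (x, \<iota> \<xi>) \<in> fst d"
    "Ck_on (Suc 0) S (\<lambda>\<xi>. snd d (R (x, \<iota> \<xi>)))"
proof -
  obtain c where c: "c \<in> charts_at A x" using x by (auto simp: points_def charts_at_def)
  then have cA: "c \<in> A" "x \<in> fst c" by (auto simp: charts_at_def)
  define c' :: "('m \<times> ('m, 'e) tangent, 'e \<times> 'e) chart" where "c' = ({(x, v). x \<in> fst c \<and> v \<in> tangent_space A x}, \<lambda>(x, v). (snd c x, v c))"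
  have c': "c' \<in> tangent_bundle_atlas A" using cA by (auto simp: tangent_bundle_atlas_def c'_def)
  have "Ck_map (Suc 0) (tangent_bundle_atlas A) A R"
    using R by (auto simp: manifold_retraction_def smooth_map_def simp del: One_nat_def)
  then have op: "open (rep_domain c' d R)" and ck: "Ck_on (Suc 0) (rep_domain c' d R) (local_rep c' d R)"
    using c' d(1) by (auto simp: Ck_map_def)
  have inj: "inj_on (snd c') (fst c')"
  proof (rule inj_onI)
    fix p q assume p: "p \<in> fst c'" and q: "q \<in> fst c'" and eq: "snd c' p = snd c' q"
    obtain y v z w where pq: "p = (y, v)" "q = (z, w)" by (cases p, cases q)
    have in_c: "y \<in> fst c" "z \<in> fst c" "v \<in> tangent_space A y" "w \<in> tangent_space A z"
      and eqs: "snd c y = snd c z" "v c = w c" using p q eq by (auto simp: c'_def pq)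
    have "y = z" using A cA(1) in_c eqs by (auto simp: smooth_manifold_def inj_on_def)
    moreover have "c \<in> charts_at A z" using cA in_c by (simp add: charts_at_def)
    then have "v = w" using tangent_of_coordinates[of c A z] in_c eqs \<open>y = z\<close> by metis
    ultimately show "p = q" by (simp add: pq)
  qed
  let ?j = "\<lambda>\<xi>. (snd c x, 0) + (0, \<iota> \<xi> c)"
  have in_c': "(x, \<iota> \<xi>) \<in> fst c'" for \<xi> using cA frame_properties(1)[OF \<iota>] by (simp add: c'_def)
  have j: "?j \<xi> = snd c' (x, \<iota> \<xi>)" for \<xi> by (simp add: c'_def)
  have inv: "chart_inv c' (?j \<xi>) = (x, \<iota> \<xi>)" for \<xi>
    unfolding j chart_inv_def by (rule inv_into_f_f[OF inj in_c'])
  have lin: "linear (\<lambda>\<xi>. (0::'e, \<iota> \<xi> c))"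
    using linear_add[OF frame_properties(2)[OF \<iota>, of c]] linear_cmul[OF frame_properties(2)[OF \<iota>, of c]]
    by (intro linearI) auto
  have j1: "Ck_on (Suc 0) UNIV ?j" using lin by (rule Ck_on_1_linear)
  define S where "S = ?j -` rep_domain c' d R"
  have "continuous_on UNIV ?j"
    by (intro continuous_intros linear_continuous_on linear_conv_bounded_linear[THEN iffD1]
        frame_properties(2)[OF \<iota>])
  then have S: "open S" unfolding S_def using op by (rule open_vimage[rotated])
  show ?thesis
  proof (rule that[OF S])
    have "?j \<xi>0 \<in> rep_domain c' d R" using in_c'[of \<xi>0] d(2) by (auto simp: j rep_domain_def simp del: add_Pair)
    then show "\<xi>0 \<in> S" by (simp add: S_def)
    show "R (x, \<iota> \<xi>) \<in> fst d" if "\<xi> \<in> S" for \<xi>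
    proof -
      have "snd c' (x, \<iota> \<xi>) \<in> snd c' ` {p \<in> fst c'. R p \<in> fst d}"
        using that unfolding S_def rep_domain_def vimage_eq j .
      then show ?thesis using inj_onD[OF inj _ in_c'] by blast
    qed
    have "Ck_on (Suc 0) S ?j" using j1 by (auto intro: continuous_on_subset)
    then have "Ck_on (Suc 0) S (\<lambda>\<xi>. local_rep c' d R (?j \<xi>))"
      by (rule Ck_on_1_compose[OF _ ck]) (auto simp: S_def)
    then show "Ck_on (Suc 0) S (\<lambda>\<xi>. snd d (R (x, \<iota> \<xi>)))"
      unfolding local_rep_def inv .
  qed
qed

lemma Ck_map_euclidean_chart:
  assumes f: "Ck_map 1 A euclidean_atlas f" and d: "d \<in> A"
  shows "Ck_on (Suc 0) (snd d ` fst d) (\<lambda>u. f (chart_inv d u))"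
proof -
  have "Ck_on (Suc 0) (rep_domain d (UNIV, \<lambda>x. x) f) (local_rep d (UNIV, \<lambda>x. x) f)"
    using f d by (auto simp: Ck_map_def euclidean_atlas_def simp del: Ck_on.simps)
  then show ?thesis by (simp add: rep_domain_def local_rep_def)
qed

lemma pullback_Ck_on_1:
  assumes A: "smooth_manifold A" and x: "x \<in> points A" and R: "manifold_retraction A R"
    and \<iota>: "orthonormal_frame A G x \<iota>" and f: "Ck_map 1 A euclidean_atlas f"
  shows "Ck_on (Suc 0) UNIV (\<lambda>\<xi>. f (R (x, \<iota> \<xi>)))"
proof (rule Ck_on_1_local)
  fix \<xi>0
  obtain c where c: "c \<in> A" "x \<in> fst c" using x by (auto simp: points_def)
  have "(x, \<iota> \<xi>0) \<in> points (tangent_bundle_atlas A)"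
    using c frame_properties(1)[OF \<iota>] by (auto simp: points_def tangent_bundle_atlas_def)
  then have "R (x, \<iota> \<xi>0) \<in> points A"
    using R by (auto simp: manifold_retraction_def smooth_map_def Ck_map_def)
  then obtain d where d: "d \<in> A" "R (x, \<iota> \<xi>0) \<in> fst d" by (auto simp: points_def)
  obtain S where S: "open S" "\<xi>0 \<in> S" and in_d: "\<And>\<xi>. \<xi> \<in> S \<Longrightarrow> R (x, \<iota> \<xi>) \<in> fst d"
    and ck: "Ck_on (Suc 0) S (\<lambda>\<xi>. snd d (R (x, \<iota> \<xi>)))"
    using retraction_local_chart[OF A x R \<iota> d] by blast
  have "Ck_on (Suc 0) S (\<lambda>\<xi>. f (chart_inv d (snd d (R (x, \<iota> \<xi>)))))"
    using in_d by (intro Ck_on_1_compose[OF ck Ck_map_euclidean_chart[OF f d(1)]]) auto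
  then have "Ck_on (Suc 0) S (\<lambda>\<xi>. f (R (x, \<iota> \<xi>)))"
    by (rule Ck_on_1_cong[OF _ S(1)]) (simp add: chart_inv_left[OF A d(1) in_d])
  with S show "\<exists>S. open S \<and> \<xi>0 \<in> S \<and> Ck_on (Suc 0) S (\<lambda>\<xi>. f (R (x, \<iota> \<xi>)))" by blast
qed

text \<open>
  In coordinates the derivative of \<open>\<xi> \<mapsto> R (x, \<iota> \<xi>)\<close> at \<open>0\<close> is \<open>\<iota>\<close>, because \<open>DR\<^sub>x(0\<^sub>x)\<close> is the identity.
\<close>

lemma pullback_derivative_zero:
  assumes A: "smooth_manifold A" and x: "x \<in> points A" and R: "manifold_retraction A R"
    and \<iota>: "orthonormal_frame A G x \<iota>" and f: "Ck_map 1 A euclidean_atlas f"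
  shows "((\<lambda>\<xi>. f (R (x, \<iota> \<xi>))) has_derivative (\<lambda>a. differential A f x (\<iota> a))) (at 0)"
proof -
  define c where "c = (SOME c. c \<in> charts_at A x)"
  have "\<exists>c. c \<in> charts_at A x" using x by (auto simp: points_def charts_at_def)
  then have c: "c \<in> charts_at A x" unfolding c_def by (rule someI_ex)
  then have cA: "c \<in> A" "x \<in> fst c" by (auto simp: charts_at_def)
  have R0: "R (x, \<iota> 0) = x"
    using R x frame_properties(3)[OF \<iota>] by (simp add: manifold_retraction_def)
  obtain S where S: "open S" "0 \<in> S" and in_c: "\<And>\<xi>. \<xi> \<in> S \<Longrightarrow> R (x, \<iota> \<xi>) \<in> fst c"
    by (rule retraction_local_chart[OF A x R \<iota> cA(1), of 0]) (auto simp: cA(2) R0)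
  have lin: "linear (\<lambda>a. \<iota> a c)" by (rule frame_properties(2)[OF \<iota>])
  have "((\<lambda>a. snd c (R (x, tangent_of A c x a))) has_derivative (\<lambda>a. a)) (at (\<iota> 0 c))"
    using R x c frame_properties(3)[OF \<iota>] by (simp add: manifold_retraction_def)
  from diff_chain_at[OF linear_imp_has_derivative[OF lin] this]
  have "((\<lambda>\<xi>. snd c (R (x, \<iota> \<xi>))) has_derivative (\<lambda>a. \<iota> a c)) (at 0)"
    by (simp add: o_def tangent_of_coordinates[OF c frame_properties(1)[OF \<iota>]])
  moreover have "((\<lambda>u. f (chart_inv c u)) has_derivative
      frechet_derivative (\<lambda>u. f (chart_inv c u)) (at (snd c x))) (at (snd c (R (x, \<iota> 0))))"
    using Ck_map_euclidean_chart[OF f cA(1)] cA(2) R0 by (simp add: frechet_derivative_works)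
  ultimately have "((\<lambda>\<xi>. f (chart_inv c (snd c (R (x, \<iota> \<xi>))))) has_derivative
      (\<lambda>a. frechet_derivative (\<lambda>u. f (chart_inv c u)) (at (snd c x)) (\<iota> a c))) (at 0)"
    by (rule diff_chain_at[unfolded o_def])
  then have "((\<lambda>\<xi>. f (R (x, \<iota> \<xi>))) has_derivative
      (\<lambda>a. frechet_derivative (\<lambda>u. f (chart_inv c u)) (at (snd c x)) (\<iota> a c))) (at 0)"
    by (rule has_derivative_transform_within_open[OF _ S]) (simp add: chart_inv_left[OF A cA(1) in_c])
  then show ?thesis by (simp add: differential_def c_def Let_def)
qed

text \<open>
  The frame carries the Riesz representation theorem from the model space to the tangent space; it
  shows that the definite descriptions behind \<open>grad\<close> and \<open>differential_adj\<close> denote.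
\<close>

lemma riesz_tangent:
  assumes \<iota>: "orthonormal_frame A G x \<iota>" and lin: "linear (\<lambda>a. \<phi> (\<iota> a) :: real)"
  shows "\<exists>u. (THE v. v \<in> tangent_space A x \<and> (\<forall>w\<in>tangent_space A x. G x v w = \<phi> w)) = \<iota> u \<and>
    (\<forall>a. u \<bullet> a = \<phi> (\<iota> a))"
proof -
  note fp = frame_properties[OF \<iota>]
  define u where "u = (\<Sum>i\<in>Basis. \<phi> (\<iota> i) *\<^sub>R i)"
  have u: "u \<bullet> a = \<phi> (\<iota> a)" for a
  proof -
    have "\<phi> (\<iota> a) = (\<lambda>a. \<phi> (\<iota> a)) (\<Sum>i\<in>Basis. (a \<bullet> i) *\<^sub>R i)" by (simp add: euclidean_representation)
    also have "\<dots> = (\<Sum>i\<in>Basis. (a \<bullet> i) *\<^sub>R \<phi> (\<iota> i))" unfolding linear_sum[OF lin] linear_cmul[OF lin] ..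
    also have "\<dots> = u \<bullet> a" by (simp add: u_def inner_sum_left mult.commute inner_commute[of a])
    finally show ?thesis by simp
  qed
  have "(THE v. v \<in> tangent_space A x \<and> (\<forall>w\<in>tangent_space A x. G x v w = \<phi> w)) = \<iota> u"
  proof (rule the_equality)
    show "\<iota> u \<in> tangent_space A x \<and> (\<forall>w\<in>tangent_space A x. G x (\<iota> u) w = \<phi> w)"
      using fp(1,5,6) u by metis
    fix v assume v: "v \<in> tangent_space A x \<and> (\<forall>w\<in>tangent_space A x. G x v w = \<phi> w)"
    then obtain u' where u': "v = \<iota> u'" using fp(6) by blast
    have "u' \<bullet> a = u \<bullet> a" for a using v u[of a] fp(1,5) by (metis u')
    then have "u' = u" by (metis vector_eq_rdot)
    then show "v = \<iota> u" by (simp add: u')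
  qed
  then show ?thesis using u by blast
qed

lemma KKT_stationary:
  assumes A: "smooth_manifold A" and x: "x \<in> points A" and R: "manifold_retraction A R"
    and \<iota>: "orthonormal_frame A G x \<iota>"
    and f: "Ck_map 1 A euclidean_atlas f" and g: "Ck_map 1 A euclidean_atlas g"
    and kkt: "KKT_pair A G f g \<theta> x y"
  shows "differential A f x (\<iota> a) + y \<bullet> differential A g x (\<iota> a) = 0"
proof -
  have lf: "linear (\<lambda>a. differential A f x (\<iota> a))" and lg: "linear (\<lambda>a. differential A g x (\<iota> a))"
    using pullback_derivative_zero[OF A x R \<iota>] f g has_derivative_linear by blast+
  obtain u where u: "grad A G f x = \<iota> u" "\<And>a. u \<bullet> a = differential A f x (\<iota> a)"
    unfolding grad_def using riesz_tangent[OF \<iota> lf] by blast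
  have ly: "linear (\<lambda>a. y \<bullet> differential A g x (\<iota> a))"
    using linear_compose[OF lg, of "\<lambda>z. y \<bullet> z"] by (simp add: o_def bounded_linear.linear bounded_linear_inner_right)
  obtain u' where u': "differential_adj A G g x y = \<iota> u'" "\<And>a. u' \<bullet> a = y \<bullet> differential A g x (\<iota> a)"
    unfolding differential_adj_def using riesz_tangent[OF \<iota> ly] by blast
  have "\<iota> (u + u') = \<iota> 0"
    using kkt \<iota> frame_properties(3)[OF \<iota>] by (simp add: KKT_pair_def u(1) u'(1) orthonormal_frame_def)
  then have "u + u' = 0" using frame_properties(4)[OF \<iota>] by (simp add: inj_eq)
  then show ?thesis by (simp flip: u(2) u'(2) add: inner_add_left[symmetric])
qed

section \<open>The characterization on the manifold\<close>

lemma uniformly_convex_family_iff: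
  "uniformly_convex_family strong W Y L \<longleftrightarrow>
    (\<exists>\<sigma>. admissible_modulus strong \<sigma> \<and> (\<forall>y\<in>Y. strongly_econvex_on \<sigma> W (\<lambda>\<xi>. L \<xi> y)))"
  by (cases strong) (auto simp: uniformly_convex_family_def admissible_modulus_def strongly_econvex_on_zero)

lemma frame_in_tangent_ball:
  assumes "orthonormal_frame A G x \<iota>"
  shows "\<iota> \<xi> \<in> tangent_ball A G x r \<longleftrightarrow> ereal (norm \<xi>) < r"
  using frame_properties(1,5)[OF assms]
  by (simp add: tangent_ball_def tan_norm_def norm_eq_sqrt_inner)

theorem proposition7:
  fixes A :: "('m, 'e::euclidean_space) atlas"
    and G :: "('m, 'e) metric"
    and f :: "'m \<Rightarrow> real"
    and g :: "'m \<Rightarrow> 'y::euclidean_space"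
    and \<theta> :: "'y \<Rightarrow> ereal"
    and R :: "'m \<times> ('m, 'e) tangent \<Rightarrow> 'm"
    and \<iota> :: "'e \<Rightarrow> ('m, 'e) tangent"
    and xbar :: 'm and ybar :: 'y and \<rho> :: real and strong :: bool
  assumes "riemannian_manifold A G"
    and "connected_space (manifold_topology A)"
    and "Ck_map 1 A euclidean_atlas f"
    and "Ck_map 1 A euclidean_atlas g"
    and "proper_fun \<theta>" and "lsc_fun \<theta>" and "econvex_on UNIV \<theta>"
    and "xbar \<in> points A"
    and "KKT_pair A G f g \<theta> xbar ybar"
    and "manifold_retraction A R"
    and "orthonormal_frame A G xbar \<iota>"
    and "\<rho> > 0"
  shows
    "(variational_sufficiency strong A G R \<iota> f g \<theta> xbar ybar \<rho> \<longleftrightarrow>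
        (\<exists>W Y. convex_concave_nbhd strong A G R \<iota> f g \<theta> xbar ybar \<rho> W Y)) \<and>
     (\<forall>W Y. convex_concave_nbhd strong A G R \<iota> f g \<theta> xbar ybar \<rho> W Y \<longrightarrow>
        saddle_point (aug_lag f g \<theta> \<rho>) ((\<lambda>\<xi>. R (xbar, \<iota> \<xi>)) ` W) Y xbar ybar) \<and>
     (variational_sufficiency strong A G R \<iota> f g \<theta> xbar ybar \<rho> \<longrightarrow>
        (\<forall>\<rho>'\<ge>\<rho>.
           variational_sufficiency strong A G R \<iota> f g \<theta> xbar ybar \<rho>' \<and>
           (\<exists>W Y. convex_concave_nbhd strong A G R \<iota> f g \<theta> xbar ybar \<rho>' W Y \<and>
              saddle_point (aug_lag f g \<theta> \<rho>') ((\<lambda>\<xi>. R (xbar, \<iota> \<xi>)) ` W) Y xbar ybar)))"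
proof -
  define r where "r = retraction_radius A G R xbar"
  define U where "U = {\<xi>::'e. ereal (norm \<xi>) < r}"
  define F where "F \<xi> = f (R (xbar, \<iota> \<xi>))" for \<xi>
  define H where "H \<xi> = g (R (xbar, \<iota> \<xi>))" for \<xi>
  have smooth: "smooth_manifold A" using assms(1) by (simp add: riemannian_manifold_def)
  have ball_iff: "\<iota> \<xi> \<in> tangent_ball A G xbar (retraction_radius A G R xbar) \<longleftrightarrow> \<xi> \<in> U" for \<xi>
    by (simp add: U_def r_def frame_in_tangent_ball[OF assms(11)])
  have R0: "R (xbar, \<iota> 0) = xbar"
    using assms(8,10) frame_properties(3)[OF assms(11)] by (simp add: manifold_retraction_def)
  \<comment> \<open>the supremum of an empty set of radii is \<open>- \<infinity>\<close>, so a priori \<open>U\<close> could be empty; then both sides of the equivalence fail\<close>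
  have zero_in_U: "0 \<in> U" if "variational_sufficiency strong A G R \<iota> f g \<theta> xbar ybar \<rho> \<or>
      convex_concave_nbhd strong A G R \<iota> f g \<theta> xbar ybar \<rho> W Y" for W Y
    using that
  proof
    assume "variational_sufficiency strong A G R \<iota> f g \<theta> xbar ybar \<rho>"
    then have "\<bar>phi_rho_R A G R xbar f g \<theta> \<rho> (\<iota> 0) 0\<bar> \<noteq> \<infinity>"
      by (simp add: variational_sufficiency_def variationally_convex_def gph_subdiff_def subdiff_def)
    then show ?thesis using ball_iff[of 0] by (auto simp: phi_rho_R_def split: if_splits)
  next
    assume nbhd: "convex_concave_nbhd strong A G R \<iota> f g \<theta> xbar ybar \<rho> W Y"
    then have "0 \<in> W" using interior_subset[of "W \<times> Y"] by (auto simp: convex_concave_nbhd_def)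
    then show ?thesis using nbhd ball_iff[of 0] by (auto simp: convex_concave_nbhd_def)
  qed
  show ?thesis
  proof (cases "0 \<in> U")
    case False
    with zero_in_U show ?thesis by blast
  next
    case zero: True
    \<comment> \<open>the constraint map is called \<open>H\<close> here because \<open>G\<close> is the metric\<close>
    interpret composite_problem U F "\<lambda>\<xi>. frechet_derivative F (at \<xi>)" H "\<lambda>\<xi>. frechet_derivative H (at \<xi>)" \<theta> ybar
    proof
      show "open U" unfolding U_def by (intro open_Collect_less continuous_intros)
      have F1: "Ck_on (Suc 0) UNIV F" unfolding F_def
        by (rule pullback_Ck_on_1[OF smooth assms(8,10,11,3)])
      have H1: "Ck_on (Suc 0) UNIV H" unfolding H_def
        by (rule pullback_Ck_on_1[OF smooth assms(8,10,11,4)])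
      show "(F has_derivative frechet_derivative F (at \<xi>)) (at \<xi>)" for \<xi>
        using F1 by (simp add: frechet_derivative_works)
      show "(H has_derivative frechet_derivative H (at \<xi>)) (at \<xi>)" for \<xi>
        using H1 by (simp add: frechet_derivative_works)
      show "continuous_on UNIV (\<lambda>\<xi>. frechet_derivative F (at \<xi>) a)" for a using F1 by simp
      show "continuous_on UNIV (\<lambda>\<xi>. frechet_derivative H (at \<xi>) a)" for a using H1 by simp
      show "ybar \<in> subdiff \<theta> (H 0)" using assms(9) by (simp add: KKT_pair_def H_def R0)
      have "frechet_derivative F (at 0) = (\<lambda>a. differential A f xbar (\<iota> a))"
        "frechet_derivative H (at 0) = (\<lambda>a. differential A g xbar (\<iota> a))"
        unfolding F_def H_def
        using pullback_derivative_zero[OF smooth assms(8,10,11,3)]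
          pullback_derivative_zero[OF smooth assms(8,10,11,4)] frechet_derivative_at by metis+
      then show "frechet_derivative F (at 0) a + ybar \<bullet> frechet_derivative H (at 0) a = 0" for a
        using KKT_stationary[OF smooth assms(8,10,11,3,4,9)] by simp
    qed (use zero assms in auto)
    have phi: "(\<lambda>(u, b). phi_rho_R A G R xbar f g \<theta> \<rho> (\<iota> u) b) = perturbed \<rho>" for \<rho>
      by (auto simp: fun_eq_iff phi_rho_R_def phi_rho_def perturbed_def ball_iff F_def H_def)
    have phi': "phi_rho_R A G R xbar f g \<theta> \<rho> (\<iota> u) b = perturbed \<rho> (u, b)" for \<rho> u b
      using fun_cong[OF phi[of \<rho>], of "(u, b)"] by simp
    have lag_R: "aug_lag_R A G R xbar f g \<theta> \<rho> (\<iota> \<xi>) = lagrangian \<rho> \<xi>" for \<rho> \<xi>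
      by (rule ext) (simp add: aug_lag_R_def lagrangian_def phi')
    have lag: "aug_lag f g \<theta> \<rho> (R (xbar, \<iota> \<xi>)) y = lagrangian \<rho> \<xi> y" if "\<xi> \<in> U" for \<rho> \<xi> y
      using that by (simp add: aug_lag_def lagrangian_def phi_rho_def perturbed_def F_def H_def)
    have suff: "variational_sufficiency strong A G R \<iota> f g \<theta> xbar ybar \<rho> \<longleftrightarrow>
        (\<exists>\<sigma>. admissible_modulus strong \<sigma> \<and> local_quadratic_growth \<sigma> (perturbed \<rho>) (0, 0) (0, ybar))"
      if "\<rho> > 0" for \<rho>
      unfolding variational_sufficiency_def phi
      using variationally_convex_iff_growth[of \<rho> strong] that by simp
    have concave: "econcave_on UNIV (lagrangian \<rho> \<xi>)" for \<rho> \<xi>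
      unfolding lag_R[symmetric] aug_lag_R_def by (rule econcave_INF_affine)
    have nbhd: "convex_concave_nbhd strong A G R \<iota> f g \<theta> xbar ybar \<rho> W Y \<longleftrightarrow>
        closed (W \<times> Y) \<and> convex (W \<times> Y) \<and> 0 \<in> interior W \<and> ybar \<in> interior Y \<and> W \<subseteq> U \<and>
        (\<exists>\<sigma>. admissible_modulus strong \<sigma> \<and>
          (\<forall>y\<in>Y. strongly_econvex_on \<sigma> W (\<lambda>\<xi>. lagrangian \<rho> \<xi> y)))" for \<rho> W Y
      unfolding convex_concave_nbhd_def uniformly_convex_family_iff lag_R
      using concave by (auto simp: interior_Times ball_iff)
    have growth_imp_nbhd: "\<exists>W Y. convex_concave_nbhd strong A G R \<iota> f g \<theta> xbar ybar \<rho> W Y"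
      if \<rho>: "\<rho> > 0" and \<sigma>: "admissible_modulus strong \<sigma>"
        and growth: "local_quadratic_growth \<sigma> (perturbed \<rho>) (0, 0) (0, ybar)" for \<rho> \<sigma>
    proof -
      obtain r where "r > 0" "cball 0 r \<subseteq> U"
        "\<And>y. y \<in> cball ybar r \<Longrightarrow> strongly_econvex_on \<sigma> (cball 0 r) (\<lambda>\<xi>. lagrangian \<rho> \<xi> y)"
        using growth_imp_lagrangian_convex[OF \<rho> admissible_modulus_nonneg[OF \<sigma>] growth] by blast
      then have "convex_concave_nbhd strong A G R \<iota> f g \<theta> xbar ybar \<rho> (cball 0 r) (cball ybar r)"
        unfolding nbhd using \<sigma> by (auto simp: interior_cball intro!: closed_Times convex_Times)
      then show ?thesis by blast
    qed
    have nbhd_imp_suff: "variational_sufficiency strong A G R \<iota> f g \<theta> xbar ybar \<rho>"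
      if "\<rho> > 0" "convex_concave_nbhd strong A G R \<iota> f g \<theta> xbar ybar \<rho> W Y" for \<rho> W Y
      using that lagrangian_convex_imp_growth[OF that(1), of strong _ W Y] unfolding nbhd suff[OF that(1)]
      by blast
    have iff: "variational_sufficiency strong A G R \<iota> f g \<theta> xbar ybar \<rho> \<longleftrightarrow>
        (\<exists>W Y. convex_concave_nbhd strong A G R \<iota> f g \<theta> xbar ybar \<rho> W Y)" if "\<rho> > 0" for \<rho>
      using suff[OF that] growth_imp_nbhd[OF that] nbhd_imp_suff[OF that] by blast
    have saddle: "saddle_point (aug_lag f g \<theta> \<rho>) ((\<lambda>\<xi>. R (xbar, \<iota> \<xi>)) ` W) Y xbar ybar"
      if \<rho>: "\<rho> > 0" and n: "convex_concave_nbhd strong A G R \<iota> f g \<theta> xbar ybar \<rho> W Y" for \<rho> W Y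
    proof -
      have W: "0 \<in> W" "W \<subseteq> U" and Y: "ybar \<in> Y" using n interior_subset unfolding nbhd by blast+
      obtain \<sigma> where \<sigma>: "admissible_modulus strong \<sigma>"
        and conv: "strongly_econvex_on \<sigma> W (\<lambda>\<xi>. lagrangian \<rho> \<xi> ybar)"
        using n Y unfolding nbhd by blast
      note saddle = lagrangian_saddle[OF \<rho> admissible_modulus_nonneg[OF \<sigma>] W(1) conv]
      have "aug_lag f g \<theta> \<rho> xbar y = lagrangian \<rho> 0 y" for y using lag[OF zero] by (simp add: R0)
      moreover have "xbar \<in> (\<lambda>\<xi>. R (xbar, \<iota> \<xi>)) ` W" using W(1) R0 by (metis imageI)
      ultimately show ?thesis
        unfolding saddle_point_def using saddle Y W(2) by (auto simp: lag subset_iff)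
    qed
    have mono: "variational_sufficiency strong A G R \<iota> f g \<theta> xbar ybar \<rho>'"
      if "variational_sufficiency strong A G R \<iota> f g \<theta> xbar ybar \<rho>" "\<rho> \<le> \<rho>'" for \<rho>'
    proof -
      have "\<rho>' > 0" "0 \<le> \<rho>" using assms(12) that(2) by auto
      then show ?thesis
        using that growth_mono_penalty[OF _ \<open>0 \<le> \<rho>\<close> that(2)] unfolding suff[OF assms(12)] suff[OF \<open>\<rho>' > 0\<close>]
        by blast
    qed
    show ?thesis
    proof (intro conjI allI impI)
      show "variational_sufficiency strong A G R \<iota> f g \<theta> xbar ybar \<rho> \<longleftrightarrow>
        (\<exists>W Y. convex_concave_nbhd strong A G R \<iota> f g \<theta> xbar ybar \<rho> W Y)"
        by (rule iff[OF assms(12)])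
      show "saddle_point (aug_lag f g \<theta> \<rho>) ((\<lambda>\<xi>. R (xbar, \<iota> \<xi>)) ` W) Y xbar ybar"
        if "convex_concave_nbhd strong A G R \<iota> f g \<theta> xbar ybar \<rho> W Y" for W Y
        by (rule saddle[OF assms(12) that])
      fix \<rho>' assume s: "variational_sufficiency strong A G R \<iota> f g \<theta> xbar ybar \<rho>" and le: "\<rho> \<le> \<rho>'"
      have pos: "\<rho>' > 0" using assms(12) le by simp
      show s': "variational_sufficiency strong A G R \<iota> f g \<theta> xbar ybar \<rho>'" by (rule mono[OF s le])
      then show "\<exists>W Y. convex_concave_nbhd strong A G R \<iota> f g \<theta> xbar ybar \<rho>' W Y \<and>
          saddle_point (aug_lag f g \<theta> \<rho>') ((\<lambda>\<xi>. R (xbar, \<iota> \<xi>)) ` W) Y xbar ybar"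
        using iff[OF pos] saddle[OF pos] by blast
    qed
  qed
qed

end
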